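(* Let $C=\operatorname{Spec}A_0$ be a smooth affine curve over $\mathbb{C}$, $D_+,D_-$ $\mathbb{Q}$-divisors on $C$ with $D_++D_-\le0$, and $A=A_0[D_+,D_-]$. With the points $a_1,\dots,a_k,b_1,\dots,b_l\in C$, the integers $m_i,m_j^\pm$ and the curves $O_i,\bar O_j^\pm$ as defined in the context, the canonical divisor of the surface $V=\operatorname{Spec}A$ is given by $$K_V=\pi^*(K_C)+\sum_{i=1}^k(m_i-1)[O_i]+\sum_{j=1}^l\left((m_j^+-1)[\bar O_j^+]+(-m_j^--1)[\bar O_j^-]\right).$$
   Context: For a $\mathbb{Q}$-divisor $D=\sum D(a)\,a$ on $C$, $\lfloor D\rfloor=\sum\lfloor D(a)\rfloor a$. The normal graded $A_0$-algebra $A_0[D_+,D_-]=\bigoplus_{n\in\mathbb{Z}}A_n\subseteq\operatorname{Frac}(A_0)[u,u^{-1}]$ ($\deg u=1$) is defined by $A_n=H^0(C,\mathcal{O}_C(\lfloor nD_+\rfloor))\cdot u^n$, $A_{-n}=H^0(C,\mathcal{O}_C(\lfloor nD_-\rfloor))\cdot u^{-n}$ for $n\ge0$; $\pi:V\to C$ is induced by $A_0\subseteq A$, and the grading gives a $\mathbb{C}^*$-action on $V$. $K_C$ and $K_V$ denote canonical (Weil) divisors, the equality being one of divisor classes. Let $a_1,\ldots,a_k$ be the points $a\in C$ with $D_+(a)=-D_-(a)\ne0$ and $b_1,\ldots,b_l$ the points $b\in C$ with $D_+(b)+D_-(b)<0$. Write $D_\pm(a_i)=\mp\frac{e_i}{m_i}$,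 $D_+(b_j)=-\frac{e_j^+}{m_j^+}$, $D_-(b_j)=\frac{e_j^-}{m_j^-}$ with integers satisfying $m_i>0$, $m_j^+>0$, $m_j^-<0$, $\gcd(e_i,m_i)=\gcd(e_j^+,m_j^+)=\gcd(e_j^-,m_j^-)=1$ (so $m_j^+=1$ if $D_+(b_j)=0$ and $m_j^-=-1$ if $D_-(b_j)=0$). The fiber $\pi^{-1}(a_i)$ is a single $\mathbb{C}^*$-orbit $O_i$, and $\pi^{-1}(b_j)=\bar O_j^+\cup\bar O_j^-$ is a union of two orbit closures, with $\pi^*(a_i)=m_iO_i$, $\pi^*(b_j)=m_j^+\bar O_j^+-m_j^-\bar O_j^-$ as divisors on $V$; the orbit $O_j^\pm$ is the one on which homogeneous elements of $A$ of positive, respectively negative, degree do not all vanish. *)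

theory Defs
  imports
    Complex_Main
    "HOL-Library.Extended_Nat"
    "HOL-Combinatorics.Permutations"
    "HOL-Computational_Algebra.Polynomial_Factorial"
    "HOL-Algebra.Generated_Rings"
begin

text \<open>
  An integral affine variety over the complex numbers is represented by its coordinate ring R, a
  subset of its function field, which is the whole of a type of class \<open>field\<close>. The scalars are
  given by a ring homomorphism \<open>\<iota>\<close> from the complex numbers to that field.
\<close>

definition ring_on :: "'f::field set \<Rightarrow> 'f ring" where
  "ring_on S = \<lparr>carrier = S, monoid.mult = (*), one = 1, zero = 0, add = (+)\<rparr>"

definition affine_variety :: "(complex \<Rightarrow> 'f::field) \<Rightarrow> 'f set \<Rightarrow> bool" where
  "affine_variety \<iota> R \<longleftrightarrow>
     \<iota> \<in> ring_hom (ring_on UNIV) (ring_on UNIV) \<and>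
     (\<exists>S. finite S \<and> R = generate_ring (ring_on UNIV) (range \<iota> \<union> S)) \<and>
     (\<forall>x. \<exists>a\<in>R. \<exists>b\<in>R. b \<noteq> 0 \<and> x = a / b)"

definition prime_chain :: "'f::field set \<Rightarrow> (nat \<Rightarrow> 'f set) \<Rightarrow> nat \<Rightarrow> bool" where
  "prime_chain R p n \<longleftrightarrow>
     (\<forall>i\<le>n. primeideal (p i) (ring_on R)) \<and> (\<forall>i<n. p i \<subset> p (Suc i))"

definition height :: "'f::field set \<Rightarrow> 'f set \<Rightarrow> enat" where
  "height R P = Sup {enat n |n p. prime_chain R p n \<and> p n = P}"

definition krull_dim :: "'f::field set \<Rightarrow> enat" where
  "krull_dim R = Sup {enat n |n p. prime_chain R p n}"

definition localization :: "'f::field set \<Rightarrow> 'f set \<Rightarrow> 'f set" where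
  "localization R P = {a / b |a b. a \<in> R \<and> b \<in> R - P}"

definition local_max :: "'f::field set \<Rightarrow> 'f set \<Rightarrow> 'f set" where
  "local_max R P = {a / b |a b. a \<in> P \<and> b \<in> R - P}"

definition closed_points :: "'f::field set \<Rightarrow> 'f set set" where
  "closed_points R = {M. maximalideal M (ring_on R)}"

text \<open>Smooth at a closed point means that the local ring there is regular, i.e. that its maximal
  ideal has as many generators as its dimension.\<close>

definition smooth :: "'f::field set \<Rightarrow> bool" where
  "smooth R \<longleftrightarrow> (\<forall>M\<in>closed_points R. \<exists>S \<subseteq> localization R M. finite S \<and>
     enat (card S) = height R M \<and> genideal (ring_on (localization R M)) S = local_max R M)"

definition smooth_affine_curve :: "(complex \<Rightarrow> 'f::field) \<Rightarrow> 'f set \<Rightarrow> bool" where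
  "smooth_affine_curve \<iota> R \<longleftrightarrow> affine_variety \<iota> R \<and> krull_dim R = 1 \<and> smooth R"


section \<open>Divisors\<close>

text \<open>
  A prime divisor is represented by its prime ideal, and a Weil divisor by its coefficient function,
  which is zero outside the prime divisors. On a curve the prime divisors are the closed points.
\<close>

definition prime_divisors :: "'f::field set \<Rightarrow> 'f set set" where
  "prime_divisors R = {P. primeideal P (ring_on R) \<and> height R P = 1}"

text \<open>The valuation of \<open>f \<noteq> 0\<close> at P, for R normal, so that the localization is a discrete valuation
  ring: \<open>f = g t\<^sup>n\<close> with t a uniformizer and g a unit.\<close>

definition ord_at :: "'f::field set \<Rightarrow> 'f set \<Rightarrow> 'f \<Rightarrow> int" where
  "ord_at R P f = (THE n. \<exists>g t. g \<in> Units (ring_on (localization R P)) \<and>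
     t \<in> localization R P \<and> cgenideal (ring_on (localization R P)) t = local_max R P \<and>
     f = g * t powi n)"

definition principal_divisor :: "'f::field set \<Rightarrow> 'f \<Rightarrow> 'f set \<Rightarrow> int" where
  "principal_divisor R f = (\<lambda>P. if P \<in> prime_divisors R then ord_at R P f else 0)"

definition divisor_class :: "'f::field set \<Rightarrow> ('f set \<Rightarrow> int) \<Rightarrow> ('f set \<Rightarrow> int) set" where
  "divisor_class R D = {\<lambda>P. D P + principal_divisor R f P |f. f \<noteq> 0}"

definition rr_space :: "'f::field set \<Rightarrow> ('f set \<Rightarrow> int) \<Rightarrow> 'f set" where
  "rr_space R D = {f. f = 0 \<or> (\<forall>P\<in>prime_divisors R. ord_at R P f + D P \<ge> 0)}"

definition Q_divisor :: "'f::field set \<Rightarrow> ('f set \<Rightarrow> rat) \<Rightarrow> bool" where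
  "Q_divisor R D \<longleftrightarrow> finite {a. D a \<noteq> 0} \<and> {a. D a \<noteq> 0} \<subseteq> closed_points R"


section \<open>Differential forms and canonical divisors\<close>

text \<open>
  Rational n-forms on a variety with function field F are represented as alternating F-multilinear
  functions on n-tuples of C-derivations of F. As F is finitely generated over C, the module of
  Kaehler differentials of F is a finite-dimensional F-vector space with dual the space of
  derivations, so this is the n-th exterior power of that module. Tuples are indexed by \<open>{..<n}\<close>,
  and forms take the value 0 on tuples not consisting of derivations.
\<close>

definition derivation :: "(complex \<Rightarrow> 'f::field) \<Rightarrow> ('f \<Rightarrow> 'f) \<Rightarrow> bool" where
  "derivation \<iota> d \<longleftrightarrow> (\<forall>x y. d (x + y) = d x + d y) \<and>
     (\<forall>x y. d (x * y) = x * d y + y * d x) \<and> (\<forall>z. d (\<iota> z) = 0)"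

type_synonym 'f form = "(nat \<Rightarrow> 'f \<Rightarrow> 'f) \<Rightarrow> 'f"

text \<open>\<open>wedge \<iota> n x\<close> is \<open>dx\<^sub>0 \<and> \<dots> \<and> dx\<^sub>n\<^sub>-\<^sub>1\<close>.\<close>

definition wedge :: "(complex \<Rightarrow> 'f::field) \<Rightarrow> nat \<Rightarrow> (nat \<Rightarrow> 'f) \<Rightarrow> 'f form" where
  "wedge \<iota> n x = (\<lambda>d. if \<forall>i<n. derivation \<iota> (d i)
     then \<Sum>p | p permutes {..<n}. of_int (sign p) * (\<Prod>i<n. d i (x (p i))) else 0)"

text \<open>The S-module generated by the \<open>dx\<^sub>0 \<and> \<dots> \<and> dx\<^sub>n\<^sub>-\<^sub>1\<close> with all \<open>x\<^sub>i\<close> in the subring S of F. With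
  \<open>S = UNIV\<close> these are the rational n-forms. For S a local ring of the variety it is the image in
  them of the n-th exterior power of the module of Kaehler differentials of S, which is the latter
  itself if S is regular.\<close>

definition forms :: "(complex \<Rightarrow> 'f::field) \<Rightarrow> nat \<Rightarrow> 'f set \<Rightarrow> 'f form set" where
  "forms \<iota> n S = {\<lambda>d. \<Sum>j<k. c j * wedge \<iota> n (x j) d |(k::nat) c x.
     \<forall>j<k. c j \<in> S \<and> (\<forall>i<n. x j i \<in> S)}"

text \<open>Write \<open>\<omega> = g \<eta>\<close> with \<open>\<eta>\<close> a generator of the forms that are regular at P; the order of \<open>\<omega>\<close> is
  that of g.\<close>

definition ord_form ::
    "(complex \<Rightarrow> 'f::field) \<Rightarrow> nat \<Rightarrow> 'f set \<Rightarrow> 'f set \<Rightarrow> 'f form \<Rightarrow> int" where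
  "ord_form \<iota> n R P \<omega> = (THE k. \<exists>g \<eta>. g \<noteq> 0 \<and> ord_at R P g = k \<and> \<omega> = (\<lambda>d. g * \<eta> d) \<and>
     forms \<iota> n (localization R P) = {\<lambda>d. s * \<eta> d |s. s \<in> localization R P})"

definition form_divisor ::
    "(complex \<Rightarrow> 'f::field) \<Rightarrow> nat \<Rightarrow> 'f set \<Rightarrow> 'f form \<Rightarrow> 'f set \<Rightarrow> int" where
  "form_divisor \<iota> n R \<omega> = (\<lambda>P. if P \<in> prime_divisors R then ord_form \<iota> n R P \<omega> else 0)"

text \<open>The canonical divisors of a normal variety of dimension n.\<close>

definition canonical_class ::
    "(complex \<Rightarrow> 'f::field) \<Rightarrow> nat \<Rightarrow> 'f set \<Rightarrow> ('f set \<Rightarrow> int) set" where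
  "canonical_class \<iota> n R = {form_divisor \<iota> n R \<omega> |\<omega>. \<omega> \<in> forms \<iota> n UNIV \<and> \<omega> \<noteq> (\<lambda>_. 0)}"


section \<open>The graded algebra\<close>

text \<open>With K the fraction field of \<open>A\<^sub>0\<close>, the algebra A is a subset of the field \<open>K(u)\<close>, which is
  the type \<open>'k poly fract\<close>; \<open>u\<close> is the class of the polynomial \<open>[:0, 1:]\<close>.\<close>

definition emb :: "'k::field \<Rightarrow> 'k poly fract" where
  "emb f = to_fract [:f:]"

definition u :: "'k::field poly fract" where
  "u = to_fract [:0, 1:]"

definition laurent :: "(int \<Rightarrow> 'k::field) \<Rightarrow> 'k poly fract" where
  "laurent c = (\<Sum>n | c n \<noteq> 0. emb (c n) * u powi n)"

text \<open>The set of \<open>f\<close> with \<open>f u\<^sup>n \<in> A\<^sub>n\<close>.\<close>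

definition piece :: "'k::field set \<Rightarrow> ('k set \<Rightarrow> rat) \<Rightarrow> ('k set \<Rightarrow> rat) \<Rightarrow> int \<Rightarrow> 'k set" where
  "piece A0 Dp Dm n = rr_space A0
     (\<lambda>a. if n \<ge> 0 then \<lfloor>of_int n * Dp a\<rfloor> else \<lfloor>of_int (- n) * Dm a\<rfloor>)"

definition dpd_algebra ::
    "'k::field set \<Rightarrow> ('k set \<Rightarrow> rat) \<Rightarrow> ('k set \<Rightarrow> rat) \<Rightarrow> 'k poly fract set" where
  "dpd_algebra A0 Dp Dm =
     {laurent c |c. finite {n. c n \<noteq> 0} \<and> (\<forall>n. c n \<in> piece A0 Dp Dm n)}"

text \<open>The morphism \<open>\<pi>\<close>, on prime ideals.\<close>

definition proj :: "'k::field set \<Rightarrow> 'k poly fract set \<Rightarrow> 'k set" where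
  "proj A0 P = {f \<in> A0. emb f \<in> P}"

definition fiber :: "'k::field set \<Rightarrow> 'k poly fract set \<Rightarrow> 'k set \<Rightarrow> 'k poly fract set set" where
  "fiber A0 A a = {M \<in> closed_points A. proj A0 M = a}"

text \<open>The coefficient at P of \<open>\<pi>\<^sup>*D\<close>, for a divisor D on the smooth curve, is the order at P of a
  local equation of D near \<open>\<pi>(P)\<close>. It is 0 if P dominates the curve.\<close>

definition pullback :: "'k::field set \<Rightarrow> 'k poly fract set \<Rightarrow> ('k set \<Rightarrow> int) \<Rightarrow>
    'k poly fract set \<Rightarrow> int" where
  "pullback A0 A D = (\<lambda>P. if P \<in> prime_divisors A \<and> proj A0 P \<in> prime_divisors A0
     then ord_at A P (emb (SOME f. f \<noteq> 0 \<and> ord_at A0 (proj A0 P) f = D (proj A0 P))) else 0)"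

text \<open>The action of \<open>z \<in> \<complex>\<^sup>*\<close> (multiplication by \<open>z\<^sup>n\<close> in degree n) on closed points, and its orbits.\<close>

definition torus_act :: "(complex \<Rightarrow> 'k::field) \<Rightarrow> complex \<Rightarrow> 'k poly fract set \<Rightarrow> 'k poly fract set"
  where "torus_act \<iota> z M =
    {laurent (\<lambda>n. \<iota> z powi n * c n) |c. finite {n. c n \<noteq> 0} \<and> laurent c \<in> M}"

definition torus_orbits ::
    "(complex \<Rightarrow> 'k::field) \<Rightarrow> 'k poly fract set \<Rightarrow> 'k poly fract set set set" where
  "torus_orbits \<iota> A = {{torus_act \<iota> z M |z. z \<noteq> 0} |M. M \<in> closed_points A}"

text \<open>For a set Z of closed points whose closure is an irreducible curve, the divisor of the latter;
  its prime ideal is the intersection of the maximal ideals in Z.\<close>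

definition curve_divisor :: "'f::field set set \<Rightarrow> 'f set \<Rightarrow> int" where
  "curve_divisor Z = (\<lambda>P. if P = \<Inter> Z then 1 else 0)"

text \<open>Z is an orbit in the fiber over b on which the homogeneous elements of A of degree in N do not
  all vanish.\<close>

definition orbit_over :: "(complex \<Rightarrow> 'k::field) \<Rightarrow> 'k set \<Rightarrow> ('k set \<Rightarrow> rat) \<Rightarrow> ('k set \<Rightarrow> rat) \<Rightarrow>
    int set \<Rightarrow> 'k set \<Rightarrow> 'k poly fract set set \<Rightarrow> bool" where
  "orbit_over \<iota> A0 Dp Dm N b Z \<longleftrightarrow>
     Z \<in> torus_orbits \<iota> (dpd_algebra A0 Dp Dm) \<and> Z \<subseteq> fiber A0 (dpd_algebra A0 Dp Dm) b \<and>
     (\<exists>n\<in>N. \<exists>f\<in>piece A0 Dp Dm n. \<exists>M\<in>Z. emb f * u powi n \<notin> M)"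

definition a_points :: "'k::field set \<Rightarrow> ('k set \<Rightarrow> rat) \<Rightarrow> ('k set \<Rightarrow> rat) \<Rightarrow> 'k set set" where
  "a_points A0 Dp Dm = {a \<in> closed_points A0. Dp a = - Dm a \<and> Dp a \<noteq> 0}"

definition b_points :: "'k::field set \<Rightarrow> ('k set \<Rightarrow> rat) \<Rightarrow> ('k set \<Rightarrow> rat) \<Rightarrow> 'k set set" where
  "b_points A0 Dp Dm = {b \<in> closed_points A0. Dp b + Dm b < 0}"

end

(* Let omega be the rational 1-form on C that defines K_C. The order of the 2-form omega /\ du/u is
   computed at every prime divisor P of V. If P dominates C, the local ring at P is a localization of
   K[u], and the order is 0. If P lies over a point a of C, with uniformizer t, the valuation of P is
   monomial, with value m on t and -e on u, where -e/m is D_+(a) or -D_-(a). Choose alpha and beta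
   with m alpha - e beta = 1. Then tau = t^alpha u^beta is a uniformizer at P, s = t^e u^m is a unit,
   and dtau, ds generate the differentials of the local ring, while dlog tau /\ dlog s equals
   dlog t /\ dlog u. Hence t dlog t /\ du/u has order m - 1, and omega /\ du/u has order
   m K_C(a) + m - 1. *)
theory Submission
  imports Defs "HOL-Analysis.Continuum_Not_Denumerable"
    "HOL-Computational_Algebra.Fundamental_Theorem_Algebra"
begin

section \<open>Subrings of a field and their primes\<close>

text \<open>Orders of functions and forms are definite descriptions, so nothing can be computed at a
  prime divisor of V before its local ring is known to be a discrete valuation ring. Normality is
  therefore established one prime divisor at a time, by exhibiting the valuation. Primes over a
  point a are recognized by homogeneous elements: suitable powers of elements of opposite degrees
  multiply to degree 0, where membership is tested on C. A prime that misses an element of positive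
  degree contains the centre of the valuation of slope D_+(a); missing negative degree gives slope
  -D_-(a). Height one turns the inclusion into equality. The exponent matrix with rows (alpha, beta)
  and (e, m) has determinant 1, so every t^j u^n is a product of powers of tau and s. The value -e
  of u depends on the component; the denominator in du/u cancels it. A derivation of K that kills a
  uniformizer is zero, which makes the derivations of K proportional to each other; a nonzero one is
  extracted from the form that defines K_C.\<close>

locale field_subring =
  fixes R :: "'f::field set"
  assumes one_in [simp, intro]: "1 \<in> R"
    and add_in [intro]: "x \<in> R \<Longrightarrow> y \<in> R \<Longrightarrow> x + y \<in> R"
    and mult_in [intro]: "x \<in> R \<Longrightarrow> y \<in> R \<Longrightarrow> x * y \<in> R"
    and uminus_in [intro]: "x \<in> R \<Longrightarrow> - x \<in> R"
begin

lemma zero_in [simp, intro]: "0 \<in> R"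
  using add_in[OF one_in uminus_in[OF one_in]] by simp

lemma diff_in [intro]: "x \<in> R \<Longrightarrow> y \<in> R \<Longrightarrow> x - y \<in> R"
  using add_in[of x "- y"] uminus_in[of y] by simp

lemma power_in [intro]: "x \<in> R \<Longrightarrow> x ^ n \<in> R"
  by (induction n) auto

lemma sum_in: "(\<And>i. i \<in> I \<Longrightarrow> f i \<in> R) \<Longrightarrow> sum f I \<in> R"
  by (induction I rule: infinite_finite_induct) auto

lemma prod_in: "(\<And>i. i \<in> I \<Longrightarrow> f i \<in> R) \<Longrightarrow> prod f I \<in> R"
  by (induction I rule: infinite_finite_induct) auto

lemma cring: "cring (ring_on R)"
proof (rule cringI)
  show "abelian_group (ring_on R)"
    by (rule abelian_groupI) (auto simp: ring_on_def add.assoc add.commute intro: bexI[of _ "- x" for x])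
  show "comm_monoid (ring_on R)"
    by (rule comm_monoidI) (auto simp: ring_on_def mult.assoc mult.commute)
qed (auto simp: ring_on_def distrib_right)

lemma ring: "ring (ring_on R)"
  using cring by (simp add: cring_def)

lemma a_inv_ring_on:
  assumes "x \<in> R"
  shows "\<ominus>\<^bsub>ring_on R\<^esub> x = - x"
proof -
  interpret r: ring "ring_on R" by (rule ring)
  show ?thesis by (rule r.minus_equality) (use assms in \<open>auto simp: ring_on_def\<close>)
qed

end

text \<open>Ideals in terms of the operations of the field itself, so that arguments with elements
  avoid the operations of the record \<open>ring_on R\<close>.\<close>

definition field_ideal :: "'f::field set \<Rightarrow> 'f set \<Rightarrow> bool" where
  "field_ideal R I \<longleftrightarrow> I \<subseteq> R \<and> 0 \<in> I \<and> (\<forall>x\<in>I. \<forall>y\<in>I. x + y \<in> I) \<and> (\<forall>r\<in>R. \<forall>x\<in>I. r * x \<in> I)"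

lemma field_idealD:
  assumes "field_ideal R I"
  shows "I \<subseteq> R" "0 \<in> I" "x \<in> I \<Longrightarrow> y \<in> I \<Longrightarrow> x + y \<in> I" "r \<in> R \<Longrightarrow> x \<in> I \<Longrightarrow> r * x \<in> I"
    "r \<in> R \<Longrightarrow> x \<in> I \<Longrightarrow> x * r \<in> I"
  using assms by (auto simp: field_ideal_def mult.commute)

context field_subring begin

lemma field_ideal_uminus: "field_ideal R I \<Longrightarrow> x \<in> I \<Longrightarrow> - x \<in> I"
  using field_idealD(4)[of R I "-1" x] by auto

lemma field_ideal_diff: "field_ideal R I \<Longrightarrow> x \<in> I \<Longrightarrow> y \<in> I \<Longrightarrow> x - y \<in> I"
  using field_idealD(3)[of R I x "-y"] field_ideal_uminus by auto

lemma field_ideal_sum: "field_ideal R I \<Longrightarrow> (\<And>i. i \<in> J \<Longrightarrow> f i \<in> I) \<Longrightarrow> sum f J \<in> I"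
  by (induction J rule: infinite_finite_induct) (auto simp: field_ideal_def)

lemma ideal_ring_on_iff: "ideal I (ring_on R) \<longleftrightarrow> field_ideal R I"
proof
  assume "ideal I (ring_on R)"
  then interpret ideal I "ring_on R" .
  show "field_ideal R I"
    unfolding field_ideal_def
    using a_subset additive_subgroup.zero_closed[OF is_additive_subgroup]
      additive_subgroup.a_closed[OF is_additive_subgroup] I_l_closed
    by (auto simp: ring_on_def)
next
  assume I: "field_ideal R I"
  show "ideal I (ring_on R)"
  proof (rule idealI)
    interpret r: ring "ring_on R" by (rule ring)
    show "subgroup I (add_monoid (ring_on R))"
    proof (rule group.subgroupI)
      show "group (add_monoid (ring_on R))" by (rule r.a_group)
      fix x assume x: "x \<in> I"
      then have "\<ominus>\<^bsub>ring_on R\<^esub> x = - x"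
        using field_idealD(1)[OF I] by (intro a_inv_ring_on) auto
      then show "inv\<^bsub>add_monoid (ring_on R)\<^esub> x \<in> I"
        using field_ideal_uminus[OF I x] by (simp add: a_inv_def)
    qed (use field_idealD[OF I] in \<open>auto simp: ring_on_def\<close>)
  qed (use ring field_idealD[OF I] in \<open>auto simp: ring_on_def\<close>)
qed

lemma primeideal_ring_on_iff:
  "primeideal P (ring_on R) \<longleftrightarrow>
     field_ideal R P \<and> 1 \<notin> P \<and> (\<forall>x\<in>R. \<forall>y\<in>R. x * y \<in> P \<longrightarrow> x \<in> P \<or> y \<in> P)"
proof -
  have "R \<noteq> P \<longleftrightarrow> 1 \<notin> P" if "field_ideal R P"
    using field_idealD(1)[OF that] field_idealD(4)[OF that, of _ 1] by auto
  then show ?thesis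
    unfolding primeideal_def primeideal_axioms_def ideal_ring_on_iff
    using cring by (auto simp: ring_on_def)
qed

lemma maximalideal_ring_on_iff:
  "maximalideal M (ring_on R) \<longleftrightarrow>
     field_ideal R M \<and> 1 \<notin> M \<and> (\<forall>J. field_ideal R J \<longrightarrow> M \<subseteq> J \<longrightarrow> 1 \<notin> J \<longrightarrow> J = M)"
proof -
  have *: "R = P \<longleftrightarrow> 1 \<in> P" if "field_ideal R P" for P
    using field_idealD(1)[OF that] field_idealD(4)[OF that, of _ 1] by auto
  have "R \<noteq> M \<and> (\<forall>J. ideal J (ring_on R) \<longrightarrow> M \<subseteq> J \<longrightarrow> J \<subseteq> R \<longrightarrow> J = M \<or> J = R) \<longleftrightarrow>
      1 \<notin> M \<and> (\<forall>J. field_ideal R J \<longrightarrow> M \<subseteq> J \<longrightarrow> 1 \<notin> J \<longrightarrow> J = M)" if M: "field_ideal R M"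
    unfolding ideal_ring_on_iff *[OF M] using * field_idealD(1) by blast
  then show ?thesis
    unfolding maximalideal_def maximalideal_axioms_def ideal_ring_on_iff
    by (auto simp: ring_on_def)
qed

lemma primeD:
  assumes "primeideal P (ring_on R)"
  shows "field_ideal R P" "1 \<notin> P" "x \<in> R \<Longrightarrow> y \<in> R \<Longrightarrow> x * y \<in> P \<Longrightarrow> x \<in> P \<or> y \<in> P"
    "P \<subseteq> R" "0 \<in> P" "x \<in> P \<Longrightarrow> y \<in> P \<Longrightarrow> x + y \<in> P" "r \<in> R \<Longrightarrow> x \<in> P \<Longrightarrow> r * x \<in> P"
    "r \<in> R \<Longrightarrow> x \<in> P \<Longrightarrow> x * r \<in> P"
  using assms unfolding primeideal_ring_on_iff by (auto dest: field_idealD)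

lemma prime_power:
  assumes "primeideal P (ring_on R)" "x \<in> R" "x ^ n \<in> P"
  shows "x \<in> P"
  using assms(3) by (induction n) (use primeD[OF assms(1)] assms(2) in auto)

lemma prime_prod:
  assumes "primeideal P (ring_on R)" "finite I" "\<And>i. i \<in> I \<Longrightarrow> f i \<in> R" "prod f I \<in> P"
  shows "\<exists>i\<in>I. f i \<in> P"
  using assms(2-4)
proof (induction I rule: finite_induct)
  case empty
  then show ?case using primeD[OF assms(1)] by simp
next
  case (insert i I)
  then show ?case using primeD(3)[OF assms(1), of "f i" "prod f I"] prod_in[of I f] by auto
qed

lemma prime_power_notin: "primeideal P (ring_on R) \<Longrightarrow> x \<in> R \<Longrightarrow> x \<notin> P \<Longrightarrow> x ^ n \<notin> P"
  using prime_power by blast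

lemma primeideal_zero: "primeideal {0} (ring_on R)"
  unfolding primeideal_ring_on_iff field_ideal_def by auto

lemma closed_point_iff: "M \<in> closed_points R \<longleftrightarrow> maximalideal M (ring_on R)"
  by (simp add: closed_points_def)

lemma closed_point_prime: "M \<in> closed_points R \<Longrightarrow> primeideal M (ring_on R)"
  using cring.maximalideal_prime[OF cring] by (simp add: closed_points_def)

lemma closed_pointD:
  assumes "M \<in> closed_points R" "field_ideal R J" "M \<subseteq> J" "1 \<notin> J"
  shows "J = M"
  using assms unfolding closed_point_iff maximalideal_ring_on_iff by blast

lemma ideal_plus_principal:
  assumes I: "field_ideal R I" and x: "x \<in> R"
  shows "field_ideal R {a + r * x |a r. a \<in> I \<and> r \<in> R}"
  unfolding field_ideal_def
proof (intro conjI ballI)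
  show "{a + r * x |a r. a \<in> I \<and> r \<in> R} \<subseteq> R" using field_idealD(1)[OF I] x by auto
  show "0 \<in> {a + r * x |a r. a \<in> I \<and> r \<in> R}"
    using field_idealD(2)[OF I] by (auto intro!: exI[of _ 0])
next
  fix y z assume "y \<in> {a + r * x |a r. a \<in> I \<and> r \<in> R}" "z \<in> {a + r * x |a r. a \<in> I \<and> r \<in> R}"
  then obtain a r a' r' where "y = a + r * x" "z = a' + r' * x" "a \<in> I" "r \<in> R" "a' \<in> I" "r' \<in> R"
    by auto
  then show "y + z \<in> {a + r * x |a r. a \<in> I \<and> r \<in> R}"
    using field_idealD(3)[OF I] unfolding mem_Collect_eq
    by (intro exI[of _ "a + a'"] exI[of _ "r + r'"]) (auto simp: algebra_simps)
next
  fix s y assume "s \<in> R" "y \<in> {a + r * x |a r. a \<in> I \<and> r \<in> R}"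
  then obtain a r where "y = a + r * x" "a \<in> I" "r \<in> R" by auto
  then show "s * y \<in> {a + r * x |a r. a \<in> I \<and> r \<in> R}"
    using field_idealD(4)[OF I] \<open>s \<in> R\<close>
    unfolding mem_Collect_eq by (intro exI[of _ "s * a"] exI[of _ "s * r"]) (auto simp: distrib_left mult.assoc)
qed

text \<open>The quotient by M is a field: the ideal generated by M and \<open>x\<close> is strictly
  larger than M, hence contains 1.\<close>

lemma closed_point_inverse:
  assumes M: "M \<in> closed_points R" and x: "x \<in> R" "x \<notin> M"
  shows "\<exists>y\<in>R. 1 - y * x \<in> M"
proof (rule ccontr)
  assume *: "\<not> (\<exists>y\<in>R. 1 - y * x \<in> M)"
  have I: "field_ideal R M" using primeD(1)[OF closed_point_prime[OF M]] .
  let ?J = "{a + r * x |a r. a \<in> M \<and> r \<in> R}"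
  have "1 \<notin> ?J"
  proof
    assume "1 \<in> ?J"
    then obtain a r where ar: "1 = a + r * x" "a \<in> M" "r \<in> R" by auto
    then have "1 - r * x = a" by (metis add_diff_cancel_right')
    then show False using * ar by auto
  qed
  moreover have "M \<subseteq> ?J" unfolding subset_iff mem_Collect_eq by (metis add_0_right mult_zero_left zero_in)
  ultimately have "?J = M" using closed_pointD[OF M ideal_plus_principal[OF I x(1)]] by blast
  moreover have "x \<in> ?J"
    using field_idealD(2)[OF I] unfolding mem_Collect_eq by (intro exI[of _ 0] exI[of _ 1]) auto
  ultimately show False using x by blast
qed

lemma closed_pointI:
  assumes I: "field_ideal R M" and 1: "1 \<notin> M" and inv: "\<And>x. x \<in> R \<Longrightarrow> x \<notin> M \<Longrightarrow> \<exists>y\<in>R. 1 - y * x \<in> M"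
  shows "M \<in> closed_points R"
  unfolding closed_point_iff maximalideal_ring_on_iff
proof (intro conjI allI impI I 1)
  fix J assume J: "field_ideal R J" "M \<subseteq> J" "1 \<notin> J"
  have "x \<in> M" if "x \<in> J" for x
  proof (rule ccontr)
    assume "x \<notin> M"
    moreover have "x \<in> R" using that field_idealD(1)[OF J(1)] by auto
    ultimately obtain y where y: "y \<in> R" "1 - y * x \<in> M" using inv by blast
    then have "(1 - y * x) + y * x \<in> J"
      using field_idealD(3,4)[OF J(1)] J(2) that by blast
    then show False using J(3) by simp
  qed
  then show "J = M" using J(2) by auto
qed

lemma exists_closed_point:
  assumes I: "field_ideal R I" and 1: "1 \<notin> I"
  shows "\<exists>M\<in>closed_points R. I \<subseteq> M"
proof -
  define S where "S = {J. field_ideal R J \<and> 1 \<notin> J \<and> I \<subseteq> J}"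
  have "\<exists>M\<in>S. \<forall>X\<in>S. M \<subseteq> X \<longrightarrow> X = M"
  proof (rule subset_Zorn_nonempty)
    show "S \<noteq> {}" using I 1 by (auto simp: S_def)
    fix C assume C: "C \<noteq> {}" "subset.chain S C"
    have CS: "\<And>J. J \<in> C \<Longrightarrow> field_ideal R J \<and> 1 \<notin> J \<and> I \<subseteq> J"
      using C(2) by (auto simp: subset.chain_def S_def)
    have tot: "\<And>J K. J \<in> C \<Longrightarrow> K \<in> C \<Longrightarrow> J \<subseteq> K \<or> K \<subseteq> J"
      using C(2) by (auto simp: subset.chain_def)
    have "field_ideal R (\<Union>C)"
      unfolding field_ideal_def
    proof (intro conjI ballI)
      show "\<Union>C \<subseteq> R" using CS field_idealD(1) by blast
      show "0 \<in> \<Union>C" using CS field_idealD(2) C(1) by blast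
    next
      fix x y assume "x \<in> \<Union>C" "y \<in> \<Union>C"
      then obtain J K where JK: "J \<in> C" "K \<in> C" "x \<in> J" "y \<in> K" by blast
      then show "x + y \<in> \<Union>C"
        using tot[OF JK(1,2)] CS field_idealD(3) by blast
    next
      fix r x assume "r \<in> R" "x \<in> \<Union>C"
      then show "r * x \<in> \<Union>C" using CS field_idealD(4) by blast
    qed
    then show "\<Union>C \<in> S" using CS C(1) by (auto simp: S_def)
  qed
  then obtain M where M: "M \<in> S" "\<And>X. X \<in> S \<Longrightarrow> M \<subseteq> X \<Longrightarrow> X = M" by blast
  then have "M \<in> closed_points R"
    unfolding closed_point_iff maximalideal_ring_on_iff by (auto simp: S_def)
  then show ?thesis using M(1) by (auto simp: S_def)
qed

section \<open>Height one and dimension one\<close>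

lemma prime_chain_strict:
  assumes "prime_chain R p n" "i < j" "j \<le> n"
  shows "p i \<subset> p j"
  using assms(2,3)
proof (induction j)
  case (Suc j)
  have "p j \<subset> p (Suc j)" using assms(1) Suc.prems by (simp add: prime_chain_def)
  then show ?case using Suc by (cases "i = j") auto
qed simp

text \<open>The zero ideal of a domain is prime and lies below every prime, so height one means that
  P is nonzero and no prime lies strictly between. A chain of length two ending in P would have such
  a prime in its middle.\<close>

lemma height_eq_1_iff:
  assumes P: "primeideal P (ring_on R)"
  shows "height R P = 1 \<longleftrightarrow>
    P \<noteq> {0} \<and> (\<forall>Q. primeideal Q (ring_on R) \<longrightarrow> Q \<noteq> {0} \<longrightarrow> Q \<subseteq> P \<longrightarrow> Q = P)"
proof -
  define N where "N = {n. \<exists>p. prime_chain R p n \<and> p n = P}"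
  have hN: "height R P = Sup (enat ` N)"
    unfolding height_def N_def by (rule arg_cong[where f = Sup]) auto
  have no0: "0 \<in> Q" if "primeideal Q (ring_on R)" for Q using primeD[OF that] by auto
  show ?thesis
  proof
    assume h: "height R P = 1"
    have le: "n \<le> 1" if "n \<in> N" for n
    proof -
      have "enat n \<le> Sup (enat ` N)" using that by (intro Sup_upper) auto
      then show ?thesis using h hN by (simp add: one_enat_def)
    qed
    have "\<exists>n\<in>N. n \<ge> 1"
    proof (rule ccontr)
      assume "\<not> ?thesis"
      then have "Sup (enat ` N) \<le> 0" by (intro Sup_least) (auto simp: zero_enat_def)
      then show False using h hN by simp
    qed
    then obtain n p where np: "prime_chain R p n" "p n = P" "n \<ge> 1" by (auto simp: N_def)
    then have "p 0 \<subset> P" using prime_chain_strict[OF np(1), of 0 n] by simp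
    moreover have "0 \<in> p 0" using np(1) no0 by (auto simp: prime_chain_def)
    ultimately have "P \<noteq> {0}" by auto
    moreover have "Q = P" if Q: "primeideal Q (ring_on R)" "Q \<noteq> {0}" "Q \<subseteq> P" for Q
    proof (rule ccontr)
      assume "Q \<noteq> P"
      define p where "p i = (if i = 0 then {0} else if i = 1 then Q else P)" for i :: nat
      have "{0} \<subset> Q" using no0[OF Q(1)] Q(2) by auto
      then have "prime_chain R p 2"
        using Q \<open>Q \<noteq> P\<close> P primeideal_zero
        by (auto simp: prime_chain_def p_def less_Suc_eq numeral_2_eq_2)
      then have "2 \<in> N" by (auto simp: N_def p_def)
      then show False using le by force
    qed
    ultimately show "P \<noteq> {0} \<and> (\<forall>Q. primeideal Q (ring_on R) \<longrightarrow> Q \<noteq> {0} \<longrightarrow> Q \<subseteq> P \<longrightarrow> Q = P)"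
      by blast
  next
    assume h: "P \<noteq> {0} \<and> (\<forall>Q. primeideal Q (ring_on R) \<longrightarrow> Q \<noteq> {0} \<longrightarrow> Q \<subseteq> P \<longrightarrow> Q = P)"
    have "{0} \<subset> P" using h no0[OF P] by auto
    then have "prime_chain R (\<lambda>i. if i = 0 then {0} else P) 1"
      using P primeideal_zero by (auto simp: prime_chain_def)
    then have "1 \<in> N" unfolding N_def by (auto intro!: exI[of _ "\<lambda>i. if i = 0 then {0} else P"])
    moreover have "n \<le> 1" if n: "n \<in> N" for n
    proof (rule ccontr)
      assume "\<not> n \<le> 1"
      obtain p where p: "prime_chain R p n" "p n = P" using n unfolding N_def by blast
      have a: "p 0 \<subset> p 1" "p 1 \<subset> p n"
        using prime_chain_strict[OF p(1)] \<open>\<not> n \<le> 1\<close> by auto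
      moreover have "primeideal (p 0) (ring_on R)" "primeideal (p 1) (ring_on R)"
        using p(1) \<open>\<not> n \<le> 1\<close> by (auto simp: prime_chain_def)
      ultimately show False using h no0[of "p 0"] p(2) by blast
    qed
    ultimately have "Sup (enat ` N) = enat 1"
      by (intro antisym Sup_least Sup_upper) auto
    then show "height R P = 1" using hN by (simp add: one_enat_def)
  qed
qed

lemma prime_divisors_iff:
  "P \<in> prime_divisors R \<longleftrightarrow> primeideal P (ring_on R) \<and> P \<noteq> {0} \<and>
     (\<forall>Q. primeideal Q (ring_on R) \<longrightarrow> Q \<noteq> {0} \<longrightarrow> Q \<subseteq> P \<longrightarrow> Q = P)"
  using height_eq_1_iff by (auto simp: prime_divisors_def)

text \<open>With chains of length at most one, a nonzero prime equals any maximal ideal above it.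
  The existence of a nonzero prime rules out that the zero ideal is maximal, which would be a closed
  point but no prime divisor.\<close>

lemma krull_dim_1:
  assumes dim: "krull_dim R = 1"
  shows "prime_divisors R = closed_points R"
    and "\<exists>P. primeideal P (ring_on R) \<and> P \<noteq> {0}"
    and "primeideal P (ring_on R) \<Longrightarrow> P \<noteq> {0} \<Longrightarrow> P \<in> closed_points R"
proof -
  define N where "N = {n. \<exists>p. prime_chain R p n}"
  have dN: "krull_dim R = Sup (enat ` N)"
    unfolding krull_dim_def N_def by (rule arg_cong[where f = Sup]) auto
  have no0: "0 \<in> Q" if "primeideal Q (ring_on R)" for Q using primeD[OF that] by auto
  have le: "n \<le> 1" if "n \<in> N" for n
  proof -
    have "enat n \<le> Sup (enat ` N)" using that by (intro Sup_upper) auto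
    then show ?thesis using dim dN by (simp add: one_enat_def)
  qed
  have "\<exists>n\<in>N. n \<ge> 1"
  proof (rule ccontr)
    assume "\<not> ?thesis"
    then have "Sup (enat ` N) \<le> 0" by (intro Sup_least) (auto simp: zero_enat_def)
    then show False using dim dN by simp
  qed
  then obtain n p where np: "prime_chain R p n" "n \<ge> 1" by (auto simp: N_def)
  then have "p 0 \<subset> p n" "primeideal (p 0) (ring_on R)" "primeideal (p n) (ring_on R)"
    using prime_chain_strict[OF np(1), of 0 n] by (auto simp: prime_chain_def)
  moreover from this have "0 \<in> p 0" using no0 by blast
  ultimately show ex: "\<exists>P. primeideal P (ring_on R) \<and> P \<noteq> {0}" by (intro exI[of _ "p n"]) auto
  have eq: "Q = P" if Q: "primeideal Q (ring_on R)" "Q \<noteq> {0}" "Q \<subseteq> P" "primeideal P (ring_on R)" for P Q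
  proof (rule ccontr)
    assume "Q \<noteq> P"
    define p where "p i = (if i = 0 then {0} else if i = 1 then Q else P)" for i :: nat
    have "{0} \<subset> Q" using no0[OF Q(1)] Q(2) by auto
    then have "prime_chain R p 2"
      using Q \<open>Q \<noteq> P\<close> primeideal_zero
      by (auto simp: prime_chain_def p_def less_Suc_eq numeral_2_eq_2)
    then have "2 \<in> N" by (auto simp: N_def)
    then show False using le by force
  qed
  have cl: "P \<in> closed_points R" if P: "primeideal P (ring_on R)" "P \<noteq> {0}" for P
  proof -
    obtain M where "M \<in> closed_points R" "P \<subseteq> M"
      using exists_closed_point[OF primeD(1,2)[OF P(1)]] by blast
    then show ?thesis using eq[of P M] P closed_point_prime by auto
  qed
  then show "primeideal P (ring_on R) \<Longrightarrow> P \<noteq> {0} \<Longrightarrow> P \<in> closed_points R" .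
  have nz: "M \<noteq> {0}" if "M \<in> closed_points R" for M
  proof
    assume "M = {0}"
    obtain P where P: "primeideal P (ring_on R)" "P \<noteq> {0}" using ex by blast
    have "P = M" using closed_pointD[OF that primeD(1)[OF P(1)] _ primeD(2)[OF P(1)]] no0[OF P(1)] \<open>M = {0}\<close> by auto
    then show False using P \<open>M = {0}\<close> by simp
  qed
  show "prime_divisors R = closed_points R"
  proof (intro equalityI subsetI)
    fix P assume "P \<in> prime_divisors R"
    then show "P \<in> closed_points R" using cl unfolding prime_divisors_iff by blast
  next
    fix P assume P: "P \<in> closed_points R"
    show "P \<in> prime_divisors R"
      unfolding prime_divisors_iff using nz[OF P] eq[OF _ _ _ closed_point_prime[OF P]] closed_point_prime[OF P] by blast
  qed
qed

end

section \<open>Discrete valuations\<close>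

locale loc_ring = field_subring R for R :: "'f::field set" +
  fixes P assumes prime: "primeideal P (ring_on R)"
begin

lemmas P = primeD[OF prime]

lemma in_locI: "a \<in> R \<Longrightarrow> b \<in> R \<Longrightarrow> b \<notin> P \<Longrightarrow> a / b \<in> localization R P"
  by (auto simp: localization_def)

lemma loc_incl: "a \<in> R \<Longrightarrow> a \<in> localization R P"
  using in_locI[of a 1] P by auto

lemma prod_notin: "a \<in> R \<Longrightarrow> b \<in> R \<Longrightarrow> a \<notin> P \<Longrightarrow> b \<notin> P \<Longrightarrow> a * b \<notin> P"
  using P(3) by blast

lemma notin_nz: "b \<notin> P \<Longrightarrow> b \<noteq> 0"
  using P by auto

lemma field_subring_localization: "field_subring (localization R P)"
proof
  show "1 \<in> localization R P" using loc_incl by auto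
next
  fix x y assume "x \<in> localization R P" "y \<in> localization R P"
  then obtain a b c d where xy: "x = a / b" "y = c / d" "a \<in> R" "b \<in> R" "c \<in> R" "d \<in> R" "b \<notin> P" "d \<notin> P"
    by (auto simp: localization_def)
  have nz: "b \<noteq> 0" "d \<noteq> 0" using xy notin_nz by auto
  have "x + y = (a * d + c * b) / (b * d)" using nz xy by (simp add: field_simps)
  then show "x + y \<in> localization R P" using xy by (simp add: in_locI add_in mult_in prod_notin)
  have "x * y = (a * c) / (b * d)" using nz xy by (simp add: field_simps)
  then show "x * y \<in> localization R P" using xy by (simp add: in_locI add_in mult_in prod_notin)
next
  fix x assume "x \<in> localization R P"
  then obtain a b where "x = a / b" "a \<in> R" "b \<in> R" "b \<notin> P" by (auto simp: localization_def)
  then show "- x \<in> localization R P" using in_locI[of "- a" b] by auto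
qed

text \<open>The localization is a local ring: a fraction whose numerator lies outside P can be
  inverted, so the maximal ideal consists of the nonunits.\<close>

lemma local_max_eq: "local_max R P = {x \<in> localization R P. x = 0 \<or> 1 / x \<notin> localization R P}"
proof -
  have "x = 0 \<or> 1 / x \<notin> localization R P" if x: "x \<in> local_max R P" for x
  proof (rule ccontr)
    assume *: "\<not> ?thesis"
    obtain a b where ab: "x = a / b" "a \<in> P" "b \<in> R" "b \<notin> P" using x unfolding local_max_def by blast
    obtain c d where cd: "1 / x = c / d" "c \<in> R" "d \<in> R" "d \<notin> P" using * by (auto simp: localization_def)
    have "b * d = c * a" using ab cd * notin_nz by (auto simp: field_simps)
    then have "b * d \<in> P" using P(7)[of c a] cd ab by simp
    then show False using prod_notin ab cd by blast
  qed
  moreover have "x \<in> local_max R P" if x: "x \<in> localization R P" "x = 0 \<or> 1 / x \<notin> localization R P" for x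
  proof -
    obtain a b where ab: "x = a / b" "a \<in> R" "b \<in> R" "b \<notin> P" using x by (auto simp: localization_def)
    have "a \<in> P" using x(2) ab in_locI[of b a] P(5) by auto
    then show ?thesis using ab by (auto simp: local_max_def)
  qed
  moreover have "local_max R P \<subseteq> localization R P"
    using P(4) by (auto simp: local_max_def localization_def)
  ultimately show ?thesis by auto
qed

end

lemma ring_on_cgenideal: "cgenideal (ring_on L) t = {x * t |x. x \<in> L}"
  by (auto simp: cgenideal_def ring_on_def)

lemma (in field_subring) ring_on_Units: "Units (ring_on R) = {x \<in> R. x \<noteq> 0 \<and> 1 / x \<in> R}"
proof -
  have "(\<exists>y\<in>R. y * x = 1 \<and> x * y = 1) \<longleftrightarrow> x \<noteq> 0 \<and> 1 / x \<in> R" for x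
  proof
    assume "\<exists>y\<in>R. y * x = 1 \<and> x * y = 1"
    then obtain y where y: "y \<in> R" "x * y = 1" by blast
    then have "x \<noteq> 0" by auto
    then have "y = 1 / x" using y by (simp add: field_simps)
    then show "x \<noteq> 0 \<and> 1 / x \<in> R" using y \<open>x \<noteq> 0\<close> by simp
  qed (auto intro!: bexI[of _ "1 / x"])
  then show ?thesis by (auto simp: Units_def ring_on_def)
qed

text \<open>The ultrametric inequality will follow from closure of the localization under addition.
  The value \<open>v 0\<close> is arbitrary, so 0 is treated apart throughout.\<close>

definition valuation_at :: "'f::field set \<Rightarrow> 'f set \<Rightarrow> ('f \<Rightarrow> int) \<Rightarrow> bool" where
  "valuation_at R P v \<longleftrightarrow> (\<forall>x y. x \<noteq> 0 \<longrightarrow> y \<noteq> 0 \<longrightarrow> v (x * y) = v x + v y) \<and>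
     localization R P = {x. x = 0 \<or> v x \<ge> 0} \<and> (\<exists>t. t \<noteq> 0 \<and> v t = 1)"

locale multiplicative_val =
  fixes v :: "'f::field \<Rightarrow> int"
  assumes mult: "x \<noteq> 0 \<Longrightarrow> y \<noteq> 0 \<Longrightarrow> v (x * y) = v x + v y"
begin

lemma one [simp]: "v 1 = 0" using mult[of 1 1] by simp

lemma inv: "x \<noteq> 0 \<Longrightarrow> v (1 / x) = - v x" using mult[of x "1 / x"] by simp

lemma inverse: "x \<noteq> 0 \<Longrightarrow> v (inverse x) = - v x" using inv[of x] by (simp add: inverse_eq_divide)

lemma div: "x \<noteq> 0 \<Longrightarrow> y \<noteq> 0 \<Longrightarrow> v (x / y) = v x - v y" using mult[of x "1 / y"] inv[of y] by simp

lemma pow: "x \<noteq> 0 \<Longrightarrow> v (x ^ n) = int n * v x"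
  by (induction n) (auto simp: mult algebra_simps)

lemma powi: "x \<noteq> 0 \<Longrightarrow> v (x powi n) = n * v x"
  by (cases "n \<ge> 0") (auto simp: power_int_def pow inverse power_inverse)

lemma uminus [simp]: "v (- x) = v x"
proof (cases "x = 0")
  case False
  have "2 * v (-1) = 0" using mult[of "-1" "-1"] by simp
  then show ?thesis using mult[of "-1" x] False by simp
qed simp

end

locale ultrametric_val = multiplicative_val v for v :: "'f::field \<Rightarrow> int" +
  assumes add: "x \<noteq> 0 \<Longrightarrow> y \<noteq> 0 \<Longrightarrow> x + y \<noteq> 0 \<Longrightarrow> min (v x) (v y) \<le> v (x + y)"

locale dvr = loc_ring R P for R :: "'f::field set" and P +
  fixes v :: "'f \<Rightarrow> int"
  assumes val: "valuation_at R P v"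
begin

sublocale multiplicative_val v
  using val by unfold_locales (auto simp: valuation_at_def)

sublocale L: field_subring "localization R P"
  by (rule field_subring_localization)

lemma loc_eq: "localization R P = {x. x = 0 \<or> v x \<ge> 0}"
  using val by (simp add: valuation_at_def)

lemma loc_iff: "x \<in> localization R P \<longleftrightarrow> x = 0 \<or> v x \<ge> 0"
  using loc_eq by auto

lemma max_iff: "x \<in> local_max R P \<longleftrightarrow> x = 0 \<or> v x > 0"
  unfolding local_max_eq using inv[of x] by (auto simp: loc_iff)

lemma nonneg: "x \<in> R \<Longrightarrow> x \<noteq> 0 \<Longrightarrow> v x \<ge> 0"
  using loc_incl loc_iff by blast

lemma P_iff: "x \<in> R \<Longrightarrow> x \<in> P \<longleftrightarrow> x = 0 \<or> v x > 0"
proof -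
  assume x: "x \<in> R"
  have "x \<in> local_max R P" if "x \<in> P" unfolding local_max_def mem_Collect_eq
    using that P(2) by (intro exI[of _ x] exI[of _ 1]) auto
  moreover have "x \<in> P" if m: "x \<in> local_max R P"
  proof -
    obtain a b where ab: "x = a / b" "a \<in> P" "b \<in> R" "b \<notin> P" using m unfolding local_max_def by blast
    then have "x * b \<in> P" using notin_nz by auto
    then show ?thesis using P(3) x ab by blast
  qed
  ultimately show ?thesis using max_iff by blast
qed

lemma uniformizer: obtains t where "t \<noteq> 0" "v t = 1"
  using val by (auto simp: valuation_at_def)

lemma uniformizer_in: obtains t where "t \<in> P" "t \<noteq> 0" "v t = 1"
proof -
  obtain t where t: "t \<noteq> 0" "v t = 1" by (rule uniformizer)
  then have "t \<in> local_max R P" by (simp add: max_iff)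
  then obtain a b where ab: "t = a / b" "a \<in> P" "b \<in> R" "b \<notin> P" by (auto simp: local_max_def)
  then have nz: "a \<noteq> 0" "b \<noteq> 0" using t notin_nz by auto
  have "v b = 0" using P_iff[of b] nonneg[of b] ab nz by auto
  then have "v a = 1" using div[OF nz] t ab by simp
  then show ?thesis using that ab nz by blast
qed

text \<open>If \<open>x\<close> has the smaller value, then \<open>y / x\<close> and hence
  \<open>1 + y / x\<close> lie in the valuation ring; multiply back by \<open>x\<close>.\<close>

lemma add_ge: "x \<noteq> 0 \<Longrightarrow> y \<noteq> 0 \<Longrightarrow> x + y \<noteq> 0 \<Longrightarrow> min (v x) (v y) \<le> v (x + y)"
proof (induction "v x" "v y" arbitrary: x y rule: linorder_wlog)
  case sym
  then show ?case by (metis add.commute min.commute)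
next
  case (le x y)
  have "y / x \<in> localization R P" using le div[of y x] by (simp add: loc_iff)
  then have "1 + y / x \<in> localization R P" by auto
  moreover have "1 + y / x = (x + y) / x" using le by (simp add: field_simps)
  ultimately have "(x + y) / x \<in> localization R P" by simp
  then show ?case using div[of "x + y" x] le by (auto simp: loc_iff)
qed

sublocale ultrametric_val v
  by unfold_locales (rule add_ge)

lemma units_eq: "Units (ring_on (localization R P)) = {x. x \<noteq> 0 \<and> v x = 0}"
  unfolding L.ring_on_Units using inv by (auto simp: loc_iff)

lemma generates_max_iff:
  assumes "t \<in> localization R P"
  shows "cgenideal (ring_on (localization R P)) t = local_max R P \<longleftrightarrow> t \<noteq> 0 \<and> v t = 1"
proof
  assume *: "cgenideal (ring_on (localization R P)) t = local_max R P"
  obtain s where s: "s \<noteq> 0" "v s = 1" by (rule uniformizer)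
  then have "s \<in> cgenideal (ring_on (localization R P)) t" by (simp add: * max_iff)
  then obtain x where x: "s = x * t" "x \<in> localization R P" by (auto simp: ring_on_cgenideal)
  then have "t \<noteq> 0" "x \<noteq> 0" using s by auto
  moreover have "t \<in> local_max R P"
    unfolding *[symmetric] ring_on_cgenideal by (auto intro!: exI[of _ 1])
  ultimately have "v t > 0" "v t \<le> 1" using x s mult[of x t] by (auto simp: max_iff loc_iff)
  then show "t \<noteq> 0 \<and> v t = 1" using \<open>t \<noteq> 0\<close> by auto
next
  assume t: "t \<noteq> 0 \<and> v t = 1"
  have "x \<in> {x * t |x. x \<in> localization R P}" if "x \<in> local_max R P" for x
    using that t by (cases "x = 0") (auto simp: max_iff loc_iff div intro!: exI[of _ "x / t"])
  moreover have "x * t \<in> local_max R P" if "x \<in> localization R P" for x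
    using that t by (cases "x = 0") (auto simp: max_iff loc_iff mult)
  ultimately show "cgenideal (ring_on (localization R P)) t = local_max R P"
    by (auto simp: ring_on_cgenideal)
qed

text \<open>Units have value 0 and generators of the maximal ideal have value 1, so the exponent in
  the definite description can only be \<open>v f\<close>.\<close>

lemma ord_at_eq:
  assumes f: "f \<noteq> 0"
  shows "ord_at R P f = v f"
  unfolding ord_at_def
proof (rule the_equality)
  obtain t where t: "t \<noteq> 0" "v t = 1" by (rule uniformizer)
  have tL: "t \<in> localization R P" using t by (simp add: loc_iff)
  have "v (f / t powi v f) = 0" using f t by (simp add: div powi)
  then show "\<exists>g t. g \<in> Units (ring_on (localization R P)) \<and> t \<in> localization R P \<and>
      cgenideal (ring_on (localization R P)) t = local_max R P \<and> f = g * t powi v f"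
    using t tL f generates_max_iff[OF tL]
    unfolding units_eq by (intro exI[of _ "f / t powi v f"] exI[of _ t] conjI) simp_all
next
  fix n assume "\<exists>g t. g \<in> Units (ring_on (localization R P)) \<and> t \<in> localization R P \<and>
      cgenideal (ring_on (localization R P)) t = local_max R P \<and> f = g * t powi n"
  then obtain g t where "g \<in> Units (ring_on (localization R P))" "t \<in> localization R P"
      "cgenideal (ring_on (localization R P)) t = local_max R P" "f = g * t powi n" by blast
  then show "n = v f" using generates_max_iff[of t] by (auto simp: units_eq mult powi)
qed

text \<open>Let Q be a nonzero prime inside P, \<open>x\<close> a nonzero element of Q and
  \<open>y\<close> one of P. A high power of \<open>y\<close> is divisible by \<open>x\<close> in
  the local ring; the denominator avoids P, hence Q, so that power of \<open>y\<close> and then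
  \<open>y\<close> itself lie in Q.\<close>

lemma prime_divisor: "P \<in> prime_divisors R"
  unfolding prime_divisors_iff
proof (intro conjI allI impI prime)
  show "P \<noteq> {0}" using uniformizer_in by blast
  fix Q assume Q: "primeideal Q (ring_on R)" "Q \<noteq> {0}" "Q \<subseteq> P"
  note QD = primeD[OF Q(1)]
  obtain x where x: "x \<in> Q" "x \<noteq> 0" using Q(2) QD(5) by auto
  have xR: "x \<in> R" using x QD(4) by auto
  have "y \<in> Q" if y: "y \<in> P" for y
  proof (cases "y = 0")
    case True then show ?thesis using QD by simp
  next
    case False
    have yR: "y \<in> R" using y P(4) by auto
    have vy: "v y \<ge> 1" using P_iff[OF yR] y False by auto
    define n where "n = nat (v x)"
    have "v (y ^ n) \<ge> v x"
      using pow[OF False, of n] vy nonneg[OF xR x(2)] mult_left_mono[of 1 "v y" "v x"] by (simp add: n_def)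
    then have "y ^ n / x \<in> localization R P" using div[of "y ^ n" x] x False by (simp add: loc_iff)
    then obtain a b where ab: "y ^ n / x = a / b" "a \<in> R" "b \<in> R" "b \<notin> P" by (auto simp: localization_def)
    then have "y ^ n * b = a * x" using x notin_nz[of b] by (auto simp: field_simps)
    then have "y ^ n * b \<in> Q" using QD(7) ab x by simp
    then have "y ^ n \<in> Q" using QD(3)[of "y ^ n" b] yR ab Q(3) by auto
    then show ?thesis using prime_power[OF Q(1) yR] by blast
  qed
  then show "Q = P" using Q(3) by auto
qed

end

text \<open>The substantial condition is \<open>frac\<close>: it makes the localization as large as
  the whole ring of the valuation. It will be checked for the monomial valuations on V.\<close>

lemma dvrI:
  assumes R: "field_subring R" and P: "P = {x \<in> R. x = 0 \<or> v x > 0}"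
    and mult: "\<And>x y. x \<noteq> 0 \<Longrightarrow> y \<noteq> 0 \<Longrightarrow> v (x * y) = v x + v y"
    and add: "\<And>x y. x \<noteq> 0 \<Longrightarrow> y \<noteq> 0 \<Longrightarrow> x + y \<noteq> 0 \<Longrightarrow> min (v x) (v y) \<le> v (x + y)"
    and nonneg: "\<And>x. x \<in> R \<Longrightarrow> x \<noteq> 0 \<Longrightarrow> v x \<ge> 0"
    and frac: "\<And>x. x \<noteq> 0 \<Longrightarrow> v x \<ge> 0 \<Longrightarrow> \<exists>a\<in>R. \<exists>b\<in>R. b \<notin> P \<and> x = a / b"
    and t: "t \<noteq> 0" "v t = 1"
  shows "dvr R P v"
proof -
  interpret field_subring R by (rule R)
  interpret multiplicative_val v by unfold_locales (rule mult)
  have nP: "x \<in> R - P \<longleftrightarrow> x \<in> R \<and> x \<noteq> 0 \<and> v x = 0" for x using nonneg[of x] P by auto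
  have "field_ideal R P"
    unfolding field_ideal_def
  proof (intro conjI ballI)
    fix x y assume "x \<in> P" "y \<in> P"
    then show "x + y \<in> P" using add[of x y] by (cases "x = 0"; cases "y = 0"; cases "x + y = 0") (auto simp: P)
  next
    fix r x assume "r \<in> R" "x \<in> P"
    then show "r * x \<in> P" using nonneg[of r] by (cases "r = 0"; cases "x = 0") (auto simp: P mult)
  qed (auto simp: P)
  then have pr: "primeideal P (ring_on R)"
    unfolding primeideal_ring_on_iff
  proof (intro conjI ballI impI)
    fix x y assume "x \<in> R" "y \<in> R" "x * y \<in> P"
    then show "x \<in> P \<or> y \<in> P"
      using nonneg[of x] nonneg[of y] by (cases "x = 0"; cases "y = 0") (auto simp: P mult)
  qed (auto simp: P)
  interpret loc_ring R P using R pr by (simp add: loc_ring_def loc_ring_axioms_def)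
  have "localization R P = {x. x = 0 \<or> v x \<ge> 0}"
  proof (rule equalityI; rule subsetI)
    fix x assume "x \<in> localization R P"
    then obtain a b where "x = a / b" "a \<in> R" "b \<in> R - P" by (auto simp: localization_def)
    then show "x \<in> {x. x = 0 \<or> v x \<ge> 0}" using nP[of b] nonneg[of a] div[of a b] by (cases "a = 0") auto
  next
    fix x assume "x \<in> {x. x = 0 \<or> v x \<ge> 0}"
    then consider "x = 0" | "x \<noteq> 0" "v x \<ge> 0" by auto
    then show "x \<in> localization R P"
    proof cases
      case 1 then show ?thesis using loc_incl by auto
    next
      case 2 then show ?thesis using frac[of x] in_locI by blast
    qed
  qed
  then have "dvr_axioms R P v" using mult t by (auto simp: dvr_axioms_def valuation_at_def)
  then show ?thesis by (intro dvr.intro loc_ring_axioms)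
qed

section \<open>Derivations and differential forms\<close>

locale deriv =
  fixes \<iota> :: "complex \<Rightarrow> 'f::field" and d :: "'f \<Rightarrow> 'f"
  assumes derivation: "derivation \<iota> d"
begin

lemma add: "d (x + y) = d x + d y" and mult: "d (x * y) = x * d y + y * d x" and scalar [simp]: "d (\<iota> z) = 0"
  using derivation by (auto simp: derivation_def)

lemma zero [simp]: "d 0 = 0" by (metis add add.right_neutral add_left_cancel)

lemma one [simp]: "d 1 = 0" by (metis mult mult_1 add.right_neutral add_left_cancel)

lemma uminus: "d (- x) = - d x" using add[of x "- x"] by (simp add: eq_neg_iff_add_eq_0 add.commute)

lemma diff: "d (x - y) = d x - d y" using add[of x "- y"] uminus[of y] by simp

lemma sum: "d (sum f I) = (\<Sum>i\<in>I. d (f i))"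
  by (induction I rule: infinite_finite_induct) (auto simp: add)

lemma inverse: "x \<noteq> 0 \<Longrightarrow> d (inverse x) = - d x * inverse x ^ 2"
proof -
  assume x: "x \<noteq> 0"
  have "x * d (inverse x) + inverse x * d x = 0" using mult[of x "inverse x"] x by simp
  then have "x * d (inverse x) = - (inverse x * d x)" by (simp add: eq_neg_iff_add_eq_0)
  then have "inverse x * (x * d (inverse x)) = inverse x * (- (inverse x * d x))" by simp
  then show ?thesis using x by (simp add: power2_eq_square field_simps)
qed

lemma div: "y \<noteq> 0 \<Longrightarrow> d (x / y) = d x / y - x * d y / y ^ 2"
  using mult[of x "inverse y"] inverse[of y] by (simp add: field_simps power2_eq_square)

lemma power: "d (x ^ n) = of_nat n * x ^ (n - 1) * d x"
proof (induction n)
  case (Suc n)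
  then show ?case by (cases n) (auto simp: mult algebra_simps)
qed simp

lemma powi: 
  assumes x: "x \<noteq> 0"
  shows "d (x powi n) = of_int n * x powi (n - 1) * d x"
proof (cases "n \<ge> 0")
  case True
  then obtain k where k: "n = int k" by (metis nonneg_int_cases)
  show ?thesis
  proof (cases k)
    case 0
    then show ?thesis using k by simp
  next
    case (Suc j)
    then have "x powi (n - 1) = x ^ j" using k by (simp add: power_int_def nat_diff_distrib)
    moreover have "x powi n = x ^ Suc j" using k Suc by (metis power_int_of_nat)
    ultimately show ?thesis using power[of x "Suc j"] k Suc by simp
  qed
next
  case False
  define k where "k = nat (- n)"
  have k: "n = - int k" "k > 0" using False by (auto simp: k_def)
  have "x powi n = inverse (x ^ k)" using k by (simp add: power_int_minus)
  moreover have "x powi (n - 1) = inverse (x ^ (k + 1))"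
    using k by (metis (no_types, lifting) add.commute add.inverse_inverse minus_add_distrib of_nat_1 of_nat_add power_int_minus power_int_of_nat uminus_add_conv_diff)
  moreover have "d (inverse (x ^ k)) = - (of_nat k * x ^ (k - 1) * d x) * inverse (x ^ k) ^ 2"
    using inverse[of "x ^ k"] power[of x k] x by simp
  moreover have "x ^ (k - 1) * inverse (x ^ k) ^ 2 = inverse (x ^ (k + 1))"
    using x k(2) by (cases k) (auto simp: field_simps power2_eq_square)
  ultimately show ?thesis using k by (simp add: mult.assoc mult.left_commute)
qed

end

lemma derivation_deriv: "derivation \<iota> d \<Longrightarrow> deriv \<iota> d"
  by unfold_locales

lemma derivation_lincomb:
  assumes "derivation \<iota> d" "derivation \<iota> d'"
  shows "derivation \<iota> (\<lambda>x. a * d x + b * d' x)"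
  using assms by (auto simp: derivation_def algebra_simps)

lemma wedge_1: "wedge \<iota> 1 x d = (if derivation \<iota> (d 0) then d 0 (x 0) else 0)"
proof -
  have "{p. p permutes {..<1::nat}} = {id}" by (auto simp: lessThan_Suc)
  then show ?thesis by (auto simp: wedge_def sign_id lessThan_Suc)
qed

lemma wedge_2: "wedge \<iota> 2 x d = (if derivation \<iota> (d 0) \<and> derivation \<iota> (d 1)
  then d 0 (x 0) * d 1 (x 1) - d 0 (x 1) * d 1 (x 0) else 0)"
proof -
  have l2: "{..<2::nat} = {0, 1}" by auto
  have "{p. p permutes {..<2::nat}} = {id, Transposition.transpose 0 1}"
  proof -
    have "p = id \<or> p = Transposition.transpose 0 1" if p: "p permutes {0, 1 :: nat}" for p
    proof -
      have o: "p x = x" if "x \<noteq> 0" "x \<noteq> 1" for x using p that by (auto simp: permutes_def)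
      have "p 0 \<in> {0, 1}" "p 1 \<in> {0, 1}" "p 0 \<noteq> p 1"
        using permutes_in_image[OF p] permutes_inj[OF p] by (auto dest: injD)
      then consider "p 0 = 0" "p 1 = 1" | "p 0 = 1" "p 1 = 0" by auto
      then show ?thesis
      proof cases
        case 1
        then have "p x = x" for x using o by (cases "x = 0"; cases "x = 1") auto
        then show ?thesis by auto
      next
        case 2
        then have "p x = Transposition.transpose 0 1 x" for x
          using o by (cases "x = 0"; cases "x = 1") (auto simp: Transposition.transpose_def)
        then show ?thesis by auto
      qed
    qed
    moreover have "Transposition.transpose 0 1 permutes {0, 1 :: nat}" by (rule permutes_swap_id) auto
    ultimately show ?thesis using permutes_id by (auto simp: l2)
  qed
  moreover have "id \<noteq> Transposition.transpose 0 (1::nat)"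
    by (metis id_apply transpose_apply_first zero_neq_one)
  ultimately have "(\<Sum>p | p permutes {..<2::nat}. of_int (sign p) * (\<Prod>i<2. d i (x (p i))))
    = (\<Prod>i<2. d i (x i)) - (\<Prod>i<2. d i (x (Transposition.transpose 0 1 i)))"
    by (simp add: sign_id sign_swap_id)
  moreover have "(\<forall>i<2. derivation \<iota> (d i)) \<longleftrightarrow> derivation \<iota> (d 0) \<and> derivation \<iota> (d 1)"
    by (auto simp: less_2_cases_iff)
  ultimately show ?thesis by (simp add: wedge_def l2)
qed

section \<open>Modules of differentials with one or two generators\<close>

definition pair :: "'a \<Rightarrow> 'a \<Rightarrow> nat \<Rightarrow> 'a" where
  "pair x y = (\<lambda>i. if i = 0 then x else y)"

text \<open>Expresses that dx lies in L dy + L dz, tested on all derivations of the field;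
  \<open>z = 0\<close> gives the case of a single generator. For elements of L this is preserved by
  ring operations and by inverses of units of L, so it need only be checked on generators.\<close>

definition diff_span :: "(complex \<Rightarrow> 'f::field) \<Rightarrow> 'f set \<Rightarrow> 'f \<Rightarrow> 'f \<Rightarrow> 'f set" where
  "diff_span \<iota> L y z =
     {x. \<exists>\<alpha>\<in>L. \<exists>\<beta>\<in>L. \<forall>d. derivation \<iota> d \<longrightarrow> d x = \<alpha> * d y + \<beta> * d z}"

context field_subring begin

lemma diff_spanI:
  assumes "\<alpha> \<in> R" "\<beta> \<in> R" "\<And>d. derivation \<iota> d \<Longrightarrow> d x = \<alpha> * d y + \<beta> * d z"
  shows "x \<in> diff_span \<iota> R y z"
  using assms unfolding diff_span_def by blast

lemma diff_spanE:
  assumes "x \<in> diff_span \<iota> R y z"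
  obtains \<alpha> \<beta> where "\<alpha> \<in> R" "\<beta> \<in> R" "\<And>d. derivation \<iota> d \<Longrightarrow> d x = \<alpha> * d y + \<beta> * d z"
  using assms unfolding diff_span_def by blast

lemma diff_span_gen: "y \<in> diff_span \<iota> R y z" "z \<in> diff_span \<iota> R y z"
  by (rule diff_spanI[of 1 0]; simp) (rule diff_spanI[of 0 1]; simp)

lemma diff_span_0: "0 \<in> diff_span \<iota> R y z" and diff_span_1: "1 \<in> diff_span \<iota> R y z"
  by (auto intro!: diff_spanI[of 0 0] simp: deriv.zero[OF derivation_deriv] deriv.one[OF derivation_deriv])

lemma diff_span_add:
  assumes "x \<in> diff_span \<iota> R y z" "x' \<in> diff_span \<iota> R y z"
  shows "x + x' \<in> diff_span \<iota> R y z"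
proof -
  obtain a b where ab: "a \<in> R" "b \<in> R" "\<And>d. derivation \<iota> d \<Longrightarrow> d x = a * d y + b * d z"
    using diff_spanE[OF assms(1)] by metis
  obtain a' b' where ab': "a' \<in> R" "b' \<in> R" "\<And>d. derivation \<iota> d \<Longrightarrow> d x' = a' * d y + b' * d z"
    using diff_spanE[OF assms(2)] by metis
  show ?thesis
  proof (rule diff_spanI[of "a + a'" "b + b'"])
    fix d assume d: "derivation \<iota> d"
    show "d (x + x') = (a + a') * d y + (b + b') * d z"
      unfolding deriv.add[OF derivation_deriv[OF d]] ab(3)[OF d] ab'(3)[OF d] by (simp add: algebra_simps)
  qed (use ab ab' in auto)
qed

lemma diff_span_mult:
  assumes "x \<in> diff_span \<iota> R y z" "x' \<in> diff_span \<iota> R y z" "x \<in> R" "x' \<in> R"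
  shows "x * x' \<in> diff_span \<iota> R y z"
proof -
  obtain a b where ab: "a \<in> R" "b \<in> R" "\<And>d. derivation \<iota> d \<Longrightarrow> d x = a * d y + b * d z"
    using diff_spanE[OF assms(1)] by metis
  obtain a' b' where ab': "a' \<in> R" "b' \<in> R" "\<And>d. derivation \<iota> d \<Longrightarrow> d x' = a' * d y + b' * d z"
    using diff_spanE[OF assms(2)] by metis
  show ?thesis
  proof (rule diff_spanI[of "x * a' + x' * a" "x * b' + x' * b"])
    fix d assume d: "derivation \<iota> d"
    show "d (x * x') = (x * a' + x' * a) * d y + (x * b' + x' * b) * d z"
      unfolding deriv.mult[OF derivation_deriv[OF d]] ab(3)[OF d] ab'(3)[OF d] by (simp add: algebra_simps)
  qed (use ab ab' assms in auto)
qed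

lemma diff_span_inverse:
  assumes "x \<in> diff_span \<iota> R y z" "inverse x \<in> R" "x \<noteq> 0"
  shows "inverse x \<in> diff_span \<iota> R y z"
proof -
  obtain a b where ab: "a \<in> R" "b \<in> R" "\<And>d. derivation \<iota> d \<Longrightarrow> d x = a * d y + b * d z"
    using diff_spanE[OF assms(1)] by metis
  show ?thesis
  proof (rule diff_spanI[of "- (inverse x ^ 2 * a)" "- (inverse x ^ 2 * b)"])
    fix d assume d: "derivation \<iota> d"
    show "d (inverse x) = - (inverse x ^ 2 * a) * d y + - (inverse x ^ 2 * b) * d z"
      unfolding deriv.inverse[OF derivation_deriv[OF d] assms(3)] ab(3)[OF d] by (simp add: algebra_simps)
  qed (use ab assms in auto)
qed

lemma diff_span_div:
  assumes "x \<in> diff_span \<iota> R y z" "x' \<in> diff_span \<iota> R y z" "x \<in> R" "inverse x' \<in> R" "x' \<noteq> 0"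
  shows "x / x' \<in> diff_span \<iota> R y z"
  using diff_span_mult[OF assms(1) diff_span_inverse[OF assms(2,4,5)] assms(3,4)] by (simp add: field_simps)

lemma diff_span_power:
  "x \<in> diff_span \<iota> R y z \<Longrightarrow> x \<in> R \<Longrightarrow> x ^ n \<in> diff_span \<iota> R y z"
  by (induction n) (auto intro: diff_span_mult diff_span_1)

lemma diff_span_powi:
  assumes "x \<in> diff_span \<iota> R y z" "x \<in> R" "inverse x \<in> R" "x \<noteq> 0"
  shows "x powi n \<in> diff_span \<iota> R y z"
  using diff_span_power[of x \<iota> y z "nat n"] diff_span_power[of "inverse x" \<iota> y z "nat (- n)"]
    diff_span_inverse[OF assms(1,3,4)] assms by (auto simp: power_int_def)

lemma diff_span_sum:
  "(\<And>i. i \<in> I \<Longrightarrow> f i \<in> diff_span \<iota> R y z) \<Longrightarrow> sum f I \<in> diff_span \<iota> R y z"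
  by (induction I rule: infinite_finite_induct) (auto intro: diff_span_add diff_span_0)

lemma forms_1_eq:
  assumes y: "y \<in> R" and span: "R \<subseteq> diff_span \<iota> R y 0"
  shows "forms \<iota> 1 R = {\<lambda>d. s * wedge \<iota> 1 (\<lambda>_. y) d |s. s \<in> R}"
proof (intro equalityI subsetI)
  fix \<omega> assume "\<omega> \<in> forms \<iota> 1 R"
  then obtain k :: nat and c x where w: "\<omega> = (\<lambda>d. \<Sum>j<k. c j * wedge \<iota> 1 (x j) d)"
    and R: "\<And>j. j < k \<Longrightarrow> c j \<in> R \<and> x j 0 \<in> R" unfolding forms_def by auto
  have "\<exists>a. \<forall>j<k. a j \<in> R \<and> (\<forall>d. derivation \<iota> d \<longrightarrow> d (x j 0) = a j * d y)"
  proof -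
    have "\<exists>a. j < k \<longrightarrow> a \<in> R \<and> (\<forall>d. derivation \<iota> d \<longrightarrow> d (x j 0) = a * d y)" for j
    proof (cases "j < k")
      case True
      then have "x j 0 \<in> diff_span \<iota> R y 0" using R span by blast
      then obtain a b where "a \<in> R" and ab: "\<And>d. derivation \<iota> d \<Longrightarrow> d (x j 0) = a * d y + b * d 0"
        by (metis diff_spanE)
      moreover have "d (x j 0) = a * d y" if d: "derivation \<iota> d" for d
        unfolding ab[OF d] deriv.zero[OF derivation_deriv[OF d]] by simp
      ultimately show ?thesis by blast
    qed auto
    then show ?thesis by metis
  qed
  then obtain a where a: "\<And>j. j < k \<Longrightarrow> a j \<in> R"
    "\<And>j d. j < k \<Longrightarrow> derivation \<iota> d \<Longrightarrow> d (x j 0) = a j * d y" by blast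
  have "\<omega> = (\<lambda>d. (\<Sum>j<k. c j * a j) * wedge \<iota> 1 (\<lambda>_. y) d)"
  proof -
    have "wedge \<iota> 1 (x j) d = a j * wedge \<iota> 1 (\<lambda>_. y) d" if "j < k" for j d
      unfolding wedge_1 using a(2)[OF that, of "d 0"] by simp
    then show ?thesis unfolding w sum_distrib_right by (intro ext sum.cong) (simp_all add: mult.assoc)
  qed
  moreover have "(\<Sum>j<k. c j * a j) \<in> R" using a R by (intro sum_in) auto
  ultimately show "\<omega> \<in> {\<lambda>d. s * wedge \<iota> 1 (\<lambda>_. y) d |s. s \<in> R}" by blast
next
  fix \<omega> assume "\<omega> \<in> {\<lambda>d. s * wedge \<iota> 1 (\<lambda>_. y) d |s. s \<in> R}"
  then obtain s where "s \<in> R" "\<omega> = (\<lambda>d. s * wedge \<iota> 1 (\<lambda>_. y) d)" by blast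
  then show "\<omega> \<in> forms \<iota> 1 R" unfolding forms_def mem_Collect_eq using y
    by (intro exI[of _ 1] exI[of _ "\<lambda>_. s"] exI[of _ "\<lambda>_ _. y"]) auto
qed

text \<open>Expanding both factors of a wedge product in dy and dz leaves the 2 by 2 determinant of
  the coefficients times the wedge of dy and dz.\<close>

lemma forms_2_eq:
  assumes y: "y \<in> R" "z \<in> R" and span: "R \<subseteq> diff_span \<iota> R y z"
  shows "forms \<iota> 2 R = {\<lambda>d. s * wedge \<iota> 2 (pair y z) d |s. s \<in> R}"
proof (intro equalityI subsetI)
  fix \<omega> assume "\<omega> \<in> forms \<iota> 2 R"
  then obtain k :: nat and c x where w: "\<omega> = (\<lambda>d. \<Sum>j<k. c j * wedge \<iota> 2 (x j) d)"
    and R: "\<And>j. j < k \<Longrightarrow> c j \<in> R \<and> x j 0 \<in> R \<and> x j 1 \<in> R" unfolding forms_def by force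
  have "\<exists>a. j < k \<longrightarrow> a \<in> R \<and> (\<forall>d. wedge \<iota> 2 (x j) d = a * wedge \<iota> 2 (pair y z) d)" for j
  proof (cases "j < k")
    case True
    then have "x j 0 \<in> diff_span \<iota> R y z" "x j 1 \<in> diff_span \<iota> R y z" using R span by blast+
    then obtain a b a' b' where R': "a \<in> R" "b \<in> R" "a' \<in> R" "b' \<in> R"
      and ab: "\<And>d. derivation \<iota> d \<Longrightarrow> d (x j 0) = a * d y + b * d z"
      and ab': "\<And>d. derivation \<iota> d \<Longrightarrow> d (x j 1) = a' * d y + b' * d z"
      by (metis diff_spanE)
    have "wedge \<iota> 2 (x j) d = (a * b' - b * a') * wedge \<iota> 2 (pair y z) d" for d
    proof (cases "derivation \<iota> (d 0) \<and> derivation \<iota> (d 1)")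
      case True
      then have "d 0 (x j 0) = a * d 0 y + b * d 0 z" "d 1 (x j 0) = a * d 1 y + b * d 1 z"
        "d 0 (x j 1) = a' * d 0 y + b' * d 0 z" "d 1 (x j 1) = a' * d 1 y + b' * d 1 z"
        using ab[of "d 0"] ab[of "d 1"] ab'[of "d 0"] ab'[of "d 1"] by blast+
      then show ?thesis unfolding wedge_2 using True by (simp add: pair_def algebra_simps)
    qed (auto simp: wedge_2)
    then show ?thesis using R' by (intro exI[of _ "a * b' - b * a'"]) auto
  qed auto
  then obtain a where a: "\<And>j. j < k \<Longrightarrow> a j \<in> R"
    "\<And>j d. j < k \<Longrightarrow> wedge \<iota> 2 (x j) d = a j * wedge \<iota> 2 (pair y z) d" by metis
  have "\<omega> = (\<lambda>d. (\<Sum>j<k. c j * a j) * wedge \<iota> 2 (pair y z) d)"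
    unfolding w sum_distrib_right by (intro ext sum.cong) (auto simp: a)
  moreover have "(\<Sum>j<k. c j * a j) \<in> R" using a R by (intro sum_in) auto
  ultimately show "\<omega> \<in> {\<lambda>d. s * wedge \<iota> 2 (pair y z) d |s. s \<in> R}" by blast
next
  fix \<omega> assume "\<omega> \<in> {\<lambda>d. s * wedge \<iota> 2 (pair y z) d |s. s \<in> R}"
  then obtain s where "s \<in> R" "\<omega> = (\<lambda>d. s * wedge \<iota> 2 (pair y z) d)" by blast
  then show "\<omega> \<in> forms \<iota> 2 R" unfolding forms_def mem_Collect_eq using y
    by (intro exI[of _ 1] exI[of _ "\<lambda>_. s"] exI[of _ "\<lambda>_. pair y z"]) (auto simp: pair_def)
qed

end

text \<open>Two generators of the module of regular forms differ by a unit, so the coefficient of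
  the form has the same order for both. The tuple \<open>d0\<close> with nonzero value allows
  cancelling the generator.\<close>

lemma (in dvr) ord_form_eq:
  assumes gen: "forms \<iota> n (localization R P) = {\<lambda>d. s * \<eta> d |s. s \<in> localization R P}"
    and nz: "\<eta> d0 \<noteq> 0" and g: "g \<noteq> 0"
  shows "ord_form \<iota> n R P (\<lambda>d. g * \<eta> d) = v g"
  unfolding ord_form_def
proof (rule the_equality)
  show "\<exists>h \<theta>. h \<noteq> 0 \<and> ord_at R P h = v g \<and> (\<lambda>d. g * \<eta> d) = (\<lambda>d. h * \<theta> d) \<and>
      forms \<iota> n (localization R P) = {\<lambda>d. s * \<theta> d |s. s \<in> localization R P}"
    using gen g ord_at_eq by (intro exI[of _ g] exI[of _ \<eta>]) auto
next
  fix k assume "\<exists>h \<theta>. h \<noteq> 0 \<and> ord_at R P h = k \<and> (\<lambda>d. g * \<eta> d) = (\<lambda>d. h * \<theta> d) \<and>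
      forms \<iota> n (localization R P) = {\<lambda>d. s * \<theta> d |s. s \<in> localization R P}"
  then obtain h \<theta> where h: "h \<noteq> 0" "ord_at R P h = k" "(\<lambda>d. g * \<eta> d) = (\<lambda>d. h * \<theta> d)"
    and gen': "forms \<iota> n (localization R P) = {\<lambda>d. s * \<theta> d |s. s \<in> localization R P}" by blast
  have "(\<lambda>d. 1 * \<theta> d) \<in> forms \<iota> n (localization R P)" unfolding gen' using L.one_in by blast
  then obtain s where s: "s \<in> localization R P" "(\<lambda>d. 1 * \<theta> d) = (\<lambda>d. s * \<eta> d)" unfolding gen by blast
  have "(\<lambda>d. 1 * \<eta> d) \<in> forms \<iota> n (localization R P)" unfolding gen using L.one_in by blast
  then obtain s' where s': "s' \<in> localization R P" "(\<lambda>d. 1 * \<eta> d) = (\<lambda>d. s' * \<theta> d)" unfolding gen' by blast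
  have e: "\<theta> d0 = s * \<eta> d0" "\<eta> d0 = s' * \<theta> d0" "g * \<eta> d0 = h * \<theta> d0"
    using fun_cong[OF s(2), of d0] fun_cong[OF s'(2), of d0] fun_cong[OF h(3), of d0] by auto
  then have "(s' * s) * \<eta> d0 = 1 * \<eta> d0" by (metis mult.assoc mult_1)
  then have "s' * s = 1" using nz by (simp only: mult_cancel_right simp_thms)
  then have s0: "s \<noteq> 0" "s' \<noteq> 0" by auto
  then have "v s' + v s = 0" using mult[of s' s] \<open>s' * s = 1\<close> by simp
  then have "v s = 0" using s(1) s'(1) s0 by (auto simp: loc_iff)
  moreover have "g * \<eta> d0 = (h * s) * \<eta> d0" using e by (metis mult.assoc)
  then have "g = h * s" using nz by (simp only: mult_cancel_right simp_thms)
  ultimately show "k = v g" using h s0 ord_at_eq[of h] mult[of h s] by auto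
qed

section \<open>Extension to fraction fields and polynomials\<close>

definition fract_val :: "('r::idom \<Rightarrow> int) \<Rightarrow> 'r fract \<Rightarrow> int" where
  "fract_val w x = (THE n. \<exists>a b. a \<noteq> 0 \<and> b \<noteq> 0 \<and> x = to_fract a / to_fract b \<and> n = w a - w b)"

lemma fract_cases:
  fixes x :: "'r::idom fract"
  obtains a b where "b \<noteq> 0" "x = to_fract a / to_fract b"
  by (metis Fract_cases Fract_conv_to_fract)

locale idom_val =
  fixes w :: "'r::idom \<Rightarrow> int"
  assumes w_mult: "a \<noteq> 0 \<Longrightarrow> b \<noteq> 0 \<Longrightarrow> w (a * b) = w a + w b"
    and w_add: "a \<noteq> 0 \<Longrightarrow> b \<noteq> 0 \<Longrightarrow> a + b \<noteq> 0 \<Longrightarrow> min (w a) (w b) \<le> w (a + b)"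
begin

lemma fract_val_eq:
  assumes "a \<noteq> 0" "b \<noteq> 0"
  shows "fract_val w (to_fract a / to_fract b) = w a - w b"
  unfolding fract_val_def
proof (rule the_equality)
  fix n assume "\<exists>a' b'. a' \<noteq> 0 \<and> b' \<noteq> 0 \<and> to_fract a / to_fract b = to_fract a' / to_fract b' \<and> n = w a' - w b'"
  then obtain a' b' where *: "a' \<noteq> 0" "b' \<noteq> 0" "to_fract a / to_fract b = to_fract a' / to_fract b'"
    "n = w a' - w b'" by blast
  then have "to_fract (a * b') = to_fract (a' * b)"
    using assms by (simp add: field_simps)
  then have "a * b' = a' * b" using to_fract_eq_iff by blast
  then show "n = w a - w b" using w_mult[of a b'] w_mult[of a' b] * assms by auto
qed (use assms in auto)

lemma w_1: "w 1 = 0" using w_mult[of 1 1] by simp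

lemma fract_val_to_fract: "a \<noteq> 0 \<Longrightarrow> fract_val w (to_fract a) = w a"
  using fract_val_eq[of a 1] w_1 by simp

sublocale fract: ultrametric_val "fract_val w"
proof
  fix x y :: "'r fract" assume xy: "x \<noteq> 0" "y \<noteq> 0"
  obtain a b c d where r: "x = to_fract a / to_fract b" "b \<noteq> 0" "y = to_fract c / to_fract d" "d \<noteq> 0"
    by (metis fract_cases)
  then have nz: "a \<noteq> 0" "c \<noteq> 0" using xy by auto
  have "x * y = to_fract (a * c) / to_fract (b * d)" using r by simp
  then have "fract_val w (x * y) = w (a * c) - w (b * d)"
    using fract_val_eq[of "a * c" "b * d"] nz r by simp
  then show "fract_val w (x * y) = fract_val w x + fract_val w y"
    using fract_val_eq r nz w_mult by simp
  assume s: "x + y \<noteq> 0"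
  have xy_eq: "x + y = to_fract (a * d + c * b) / to_fract (b * d)" using r by (simp add: field_simps)
  then have s': "a * d + c * b \<noteq> 0" using s by (metis div_0 to_fract_0)
  then have "fract_val w (x + y) = w (a * d + c * b) - w (b * d)"
    unfolding xy_eq using r by (intro fract_val_eq) auto
  moreover have "min (w (a * d)) (w (c * b)) \<le> w (a * d + c * b)" using w_add s' nz r by simp
  ultimately show "min (fract_val w x) (fract_val w y) \<le> fract_val w (x + y)"
    using fract_val_eq r nz w_mult by simp
qed

end

text \<open>Here \<open>da\<close>, \<open>db\<close> and so on stand for values of a derivation,
  and the second hypothesis is the derivative of the first. The conclusion compares the quotient
  rules for a/b and a'/b' after clearing denominators.\<close>

lemma quotient_rule_welldefined:
  fixes a :: "'a::comm_ring_1"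
  assumes "a * b' = a' * b" "a * db' + b' * da = a' * db + b * da'"
  shows "(da * b - a * db) * b' ^ 2 - (da' * b' - a' * db') * b ^ 2 = 0"
proof -
  have "(da * b - a * db) * b' ^ 2 - (da' * b' - a' * db') * b ^ 2 =
    b * b' * ((a * db' + b' * da) - (a' * db + b * da')) - (b' * db + b * db') * (a * b' - a' * b)"
    by (simp add: algebra_simps power2_eq_square)
  then show ?thesis using assms by simp
qed

lemma quotient_rule_add:
  fixes b d :: "'a::field"
  assumes "b \<noteq> 0" "d \<noteq> 0"
  shows "((a * dd + d * da + (c * db + b * dc)) * (b * d) - (a * d + c * b) * (b * dd + d * db)) / (b * d) ^ 2 =
    (da * b - a * db) / b ^ 2 + (dc * d - c * dd) / d ^ 2"
  using assms by (simp add: field_simps power2_eq_square)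

lemma quotient_rule_mult:
  fixes b d :: "'a::field"
  assumes "b \<noteq> 0" "d \<noteq> 0"
  shows "((a * dc + c * da) * (b * d) - a * c * (b * dd + d * db)) / (b * d) ^ 2 =
    a / b * ((dc * d - c * dd) / d ^ 2) + c / d * ((da * b - a * db) / b ^ 2)"
  using assms by (simp add: field_simps power2_eq_square)

text \<open>The quotient rule dictates the extension; independence of the representation comes from
  differentiating the cross-multiplied equation.\<close>

lemma fract_derivation_extend:
  fixes \<delta> :: "'r::idom \<Rightarrow> 'r fract"
  assumes add: "\<And>x y. \<delta> (x + y) = \<delta> x + \<delta> y"
    and mult: "\<And>x y. \<delta> (x * y) = to_fract x * \<delta> y + to_fract y * \<delta> x"
  obtains D where "\<And>x y. D (x + y) = D x + D y" "\<And>x y. D (x * y) = x * D y + y * D x"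
    "\<And>x. D (to_fract x) = \<delta> x"
proof -
  define Q where "Q a b = (\<delta> a * to_fract b - to_fract a * \<delta> b) / to_fract b ^ 2" for a b
  have wd: "Q a b = Q a' b'"
    if "b \<noteq> 0" "b' \<noteq> 0" "to_fract a / to_fract b = to_fract a' / to_fract b'" for a b a' b'
  proof -
    have nz: "to_fract b \<noteq> 0" "to_fract b' \<noteq> 0" using that by auto
    have e: "to_fract a * to_fract b' = to_fract a' * to_fract b" using that(3) nz by (simp add: field_simps)
    then have "to_fract (a * b') = to_fract (a' * b)" by simp
    then have "a * b' = a' * b" using to_fract_eq_iff by blast
    then have d: "to_fract a * \<delta> b' + to_fract b' * \<delta> a = to_fract a' * \<delta> b + to_fract b * \<delta> a'"
      using mult[of a b'] mult[of a' b] by simp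
    have "(\<delta> a * to_fract b - to_fract a * \<delta> b) * to_fract b' ^ 2 -
        (\<delta> a' * to_fract b' - to_fract a' * \<delta> b') * to_fract b ^ 2 = 0"
      by (rule quotient_rule_welldefined[OF e d])
    then show ?thesis using nz by (simp add: Q_def frac_eq_eq)
  qed
  define D where "D x = (SOME q. \<exists>a b. b \<noteq> 0 \<and> x = to_fract a / to_fract b \<and> q = Q a b)" for x
  have D: "D (to_fract a / to_fract b) = Q a b" if "b \<noteq> 0" for a b
  proof -
    have "\<exists>a' b'. b' \<noteq> 0 \<and> to_fract a / to_fract b = to_fract a' / to_fract b' \<and>
        D (to_fract a / to_fract b) = Q a' b'"
      unfolding D_def by (rule someI) (use that in blast)
    then show ?thesis using wd that by metis
  qed
  have one: "\<delta> 1 = 0" using mult[of 1 1] by (metis add.right_neutral add_left_cancel mult_1 to_fract_1)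
  show ?thesis
  proof (rule that[of D])
    fix x y :: "'r fract"
    obtain a b c d where r: "x = to_fract a / to_fract b" "b \<noteq> 0" "y = to_fract c / to_fract d" "d \<noteq> 0"
      by (metis fract_cases)
    then have nz: "to_fract b \<noteq> 0" "to_fract d \<noteq> 0" by auto
    have "x + y = to_fract (a * d + c * b) / to_fract (b * d)" using r by (simp add: field_simps)
    then have "D (x + y) = Q (a * d + c * b) (b * d)" using D[of "b * d" "a * d + c * b"] r(2,4) by (simp only: mult_eq_0_iff simp_thms)
    also have "\<dots> = Q a b + Q c d"
      unfolding Q_def add mult to_fract_add to_fract_mult by (rule quotient_rule_add[OF nz])
    finally show "D (x + y) = D x + D y" using D r by simp
    have "x * y = to_fract (a * c) / to_fract (b * d)" using r by simp
    then have "D (x * y) = Q (a * c) (b * d)" using D[of "b * d" "a * c"] r(2,4) by (simp only: mult_eq_0_iff simp_thms)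
    also have "\<dots> = x * Q c d + y * Q a b"
      unfolding Q_def r mult to_fract_mult by (rule quotient_rule_mult[OF nz])
    finally show "D (x * y) = x * D y + y * D x" using D r by simp
  next
    fix x :: 'r
    show "D (to_fract x) = \<delta> x" using D[of 1 x] one by (simp add: Q_def)
  qed
qed

text \<open>A weighted Gauss valuation: the variable has weight \<open>- e\<close> and coefficients
  are weighted by \<open>m * v\<close>. It is meaningful for nonzero \<open>p\<close> only.\<close>

definition gauss_val :: "('k::field \<Rightarrow> int) \<Rightarrow> int \<Rightarrow> int \<Rightarrow> 'k poly \<Rightarrow> int" where
  "gauss_val v m e p = Min ((\<lambda>i. m * v (Polynomial.coeff p i) - e * int i) ` {i. Polynomial.coeff p i \<noteq> 0})"

locale gauss = ultrametric_val v for v :: "'k::field \<Rightarrow> int" +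
  fixes m e :: int
  assumes m: "m > 0"
begin

text \<open>The weight of a term of degree \<open>i\<close>, with a zero coefficient counted as
  infinitely heavy. Zero terms can then be summed without case distinctions.\<close>

definition wge :: "int \<Rightarrow> nat \<Rightarrow> 'k \<Rightarrow> bool" where
  "wge N i c \<longleftrightarrow> c = 0 \<or> m * v c - e * int i \<ge> N"

lemma wge_add: "wge N i c \<Longrightarrow> wge N i c' \<Longrightarrow> wge N i (c + c')"
proof -
  assume *: "wge N i c" "wge N i c'"
  show ?thesis
  proof (cases "c = 0 \<or> c' = 0 \<or> c + c' = 0")
    case False
    then have "min (v c) (v c') \<le> v (c + c')" using add by blast
    then have "min (m * v c) (m * v c') \<le> m * v (c + c')"
      using m by (auto simp: min_def mult_le_cancel_left_pos split: if_splits)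
    then show ?thesis using * False by (auto simp: wge_def)
  qed (use * in \<open>auto simp: wge_def\<close>)
qed

lemma wge_sum: "(\<And>j. j \<in> J \<Longrightarrow> wge N i (f j)) \<Longrightarrow> wge N i (sum f J)"
  by (induction J rule: infinite_finite_induct) (auto intro: wge_add simp: wge_def[of _ _ 0])

lemma wge_mult: "wge N i c \<Longrightarrow> wge N' j c' \<Longrightarrow> wge (N + N') (i + j) (c * c')"
  by (cases "c = 0"; cases "c' = 0") (auto simp: wge_def mult algebra_simps)

lemma wge_uminus: "wge N i c \<Longrightarrow> wge N i (- c)"
  by (simp add: wge_def)

lemma wge_mono: "wge N i c \<Longrightarrow> N' \<le> N \<Longrightarrow> wge N' i c"
  by (auto simp: wge_def)

lemma fin: "finite {i. Polynomial.coeff p i \<noteq> 0}"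
  by (rule finite_subset[of _ "{..degree p}"]) (auto intro: le_degree)

lemma ne: "p \<noteq> 0 \<Longrightarrow> {i. Polynomial.coeff p i \<noteq> 0} \<noteq> {}"
  by (auto simp: poly_eq_iff)

lemma gauss_wge: "wge (gauss_val v m e p) i (Polynomial.coeff p i)"
  unfolding wge_def gauss_val_def using fin by (cases "Polynomial.coeff p i = 0") (auto intro!: Min_le)

lemma gauss_ge_iff: "p \<noteq> 0 \<Longrightarrow> N \<le> gauss_val v m e p \<longleftrightarrow> (\<forall>i. wge N i (Polynomial.coeff p i))"
  unfolding gauss_val_def using fin ne by (subst Min_ge_iff) (auto simp: wge_def)

lemma gauss_attained:
  assumes "p \<noteq> 0"
  obtains i where "Polynomial.coeff p i \<noteq> 0" "m * v (Polynomial.coeff p i) - e * int i = gauss_val v m e p"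
    "\<And>j. j < i \<Longrightarrow> wge (gauss_val v m e p + 1) j (Polynomial.coeff p j)"
proof -
  let ?Q = "\<lambda>i. Polynomial.coeff p i \<noteq> 0 \<and> m * v (Polynomial.coeff p i) - e * int i = gauss_val v m e p"
  have "gauss_val v m e p \<in> (\<lambda>i. m * v (Polynomial.coeff p i) - e * int i) ` {i. Polynomial.coeff p i \<noteq> 0}"
    unfolding gauss_val_def using fin ne assms by (intro Min_in) auto
  then have ex: "\<exists>i. ?Q i" by auto
  show ?thesis
  proof (rule that[of "LEAST i. ?Q i"])
    fix j assume "j < (LEAST i. ?Q i)"
    then have "\<not> ?Q j" by (rule not_less_Least)
    then show "wge (gauss_val v m e p + 1) j (Polynomial.coeff p j)"
      using gauss_wge[of p j] by (auto simp: wge_def)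
  qed (use LeastI_ex[OF ex] in auto)
qed

text \<open>The argument of the Gauss lemma: let \<open>i\<close> and \<open>j\<close> be the least
  degrees in which p and q attain their minimal weights. In degree \<open>i + j\<close> of the
  product, every other term has a factor of degree below \<open>i\<close> or \<open>j\<close> and is
  strictly heavier, so nothing cancels the term from \<open>i\<close> and \<open>j\<close>.\<close>

lemma gauss_mult:
  assumes p: "p \<noteq> 0" and q: "q \<noteq> 0"
  shows "gauss_val v m e (p * q) = gauss_val v m e p + gauss_val v m e q"
proof -
  define M N where "M = gauss_val v m e p" and "N = gauss_val v m e q"
  obtain i where i: "Polynomial.coeff p i \<noteq> 0" "m * v (Polynomial.coeff p i) - e * int i = M" "\<And>k. k < i \<Longrightarrow> wge (M + 1) k (Polynomial.coeff p k)"
    using gauss_attained[OF p] unfolding M_def by metis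
  obtain j where j: "Polynomial.coeff q j \<noteq> 0" "m * v (Polynomial.coeff q j) - e * int j = N" "\<And>k. k < j \<Longrightarrow> wge (N + 1) k (Polynomial.coeff q k)"
    using gauss_attained[OF q] unfolding N_def by metis
  have pq: "p * q \<noteq> 0" using p q by simp
  have "wge (M + N) k (Polynomial.coeff (p * q) k)" for k
    unfolding coeff_mult
  proof (rule wge_sum)
    fix l assume "l \<in> {..k}"
    then show "wge (M + N) k (Polynomial.coeff p l * Polynomial.coeff q (k - l))"
      using wge_mult[OF gauss_wge[of p l] gauss_wge[of q "k - l"]] by (simp add: M_def N_def)
  qed
  then have ge: "M + N \<le> gauss_val v m e (p * q)" using gauss_ge_iff[OF pq] by blast
  define t r where "t = Polynomial.coeff p i * Polynomial.coeff q j"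
    and "r = (\<Sum>l\<in>{..i+j} - {i}. Polynomial.coeff p l * Polynomial.coeff q (i + j - l))"
  have sum: "Polynomial.coeff (p * q) (i + j) = t + r"
    unfolding coeff_mult t_def r_def by (subst sum.remove[of _ i]) auto
  have "wge (M + N + 1) (i + j) r"
    unfolding r_def
  proof (rule wge_sum)
    fix l assume l: "l \<in> {..i+j} - {i}"
    show "wge (M + N + 1) (i + j) (Polynomial.coeff p l * Polynomial.coeff q (i + j - l))"
    proof (cases "l < i")
      case True
      then show ?thesis using wge_mult[OF i(3)[OF True] gauss_wge[of q "i + j - l"]]
        by (simp add: N_def algebra_simps)
    next
      case False
      then have "i + j - l < j" using l by auto
      then show ?thesis using wge_mult[OF gauss_wge[of p l] j(3), of "i + j - l"] l
        by (simp add: M_def algebra_simps)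
    qed
  qed
  moreover have "\<not> wge (M + N + 1) (i + j) t"
    using i j by (simp add: wge_def t_def mult algebra_simps)
  moreover have "t = Polynomial.coeff (p * q) (i + j) + (- r)" using sum by simp
  ultimately have "\<not> wge (M + N + 1) (i + j) (Polynomial.coeff (p * q) (i + j))"
    using wge_add wge_uminus by metis
  then have "\<not> M + N + 1 \<le> gauss_val v m e (p * q)" using gauss_ge_iff[OF pq] by blast
  then show ?thesis using ge by (simp add: M_def N_def)
qed

sublocale P: idom_val "gauss_val v m e"
proof
  fix p q :: "'k poly" assume nz: "p \<noteq> 0" "q \<noteq> 0"
  then show "gauss_val v m e (p * q) = gauss_val v m e p + gauss_val v m e q" by (rule gauss_mult)
  assume "p + q \<noteq> 0"
  then show "min (gauss_val v m e p) (gauss_val v m e q) \<le> gauss_val v m e (p + q)"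
    unfolding gauss_ge_iff[OF \<open>p + q \<noteq> 0\<close>]
    using wge_mono[OF gauss_wge[of p]] wge_mono[OF gauss_wge[of q]] by (auto intro!: wge_add)
qed

lemma gauss_monom: "c \<noteq> 0 \<Longrightarrow> gauss_val v m e (Polynomial.monom c n) = m * v c - e * int n"
proof -
  assume "c \<noteq> 0"
  then have "{i. Polynomial.coeff (Polynomial.monom c n) i \<noteq> 0} = {n}" by auto
  then show ?thesis by (simp add: gauss_val_def)
qed

end

section \<open>Smooth affine curves\<close>

lemma field_subring_UNIV: "field_subring UNIV"
  by unfold_locales auto

locale scalars =
  fixes \<iota> :: "complex \<Rightarrow> 'f::field"
  assumes hom: "\<iota> \<in> ring_hom (ring_on UNIV) (ring_on UNIV)"
begin

lemma \<iota>_add: "\<iota> (x + y) = \<iota> x + \<iota> y" and \<iota>_mult: "\<iota> (x * y) = \<iota> x * \<iota> y" and \<iota>_1 [simp]: "\<iota> 1 = 1"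
  using hom by (auto simp: ring_hom_def ring_on_def)

lemma \<iota>_0 [simp]: "\<iota> 0 = 0"
  by (metis \<iota>_add add.right_neutral add_left_cancel)

lemma \<iota>_uminus: "\<iota> (- x) = - \<iota> x"
  by (metis \<iota>_0 \<iota>_add add.right_inverse eq_neg_iff_add_eq_0 add.commute)

lemma \<iota>_diff: "\<iota> (x - y) = \<iota> x - \<iota> y"
  using \<iota>_add[of x "- y"] by (simp add: \<iota>_uminus)

lemma \<iota>_eq_0 [simp]: "\<iota> z = 0 \<longleftrightarrow> z = 0"
proof
  show "z = 0" if "\<iota> z = 0"
  proof (rule ccontr)
    assume "z \<noteq> 0"
    then have "\<iota> z * \<iota> (1 / z) = 1" by (simp flip: \<iota>_mult)
    then show False using that by simp
  qed
qed simp

lemma \<iota>_inverse: "\<iota> (inverse z) = inverse (\<iota> z)"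
proof (cases "z = 0")
  case False
  then have "\<iota> z * \<iota> (inverse z) = 1" by (simp flip: \<iota>_mult)
  then show ?thesis by (metis inverse_unique)
qed simp

lemma \<iota>_power: "\<iota> (z ^ n) = \<iota> z ^ n"
  by (induction n) (auto simp: \<iota>_mult)

lemma \<iota>_powi: "\<iota> (z powi n) = \<iota> z powi n"
  by (auto simp: power_int_def \<iota>_power \<iota>_inverse)

lemma vector_space: "vector_space (\<lambda>z x. \<iota> z * x)"
  by unfold_locales (auto simp: \<iota>_add \<iota>_mult algebra_simps)

definition ev :: "'f \<Rightarrow> complex poly \<Rightarrow> 'f" where
  "ev x p = poly (map_poly \<iota> p) x"

lemma ev_pCons: "ev x (pCons a p) = \<iota> a + x * ev x p"
  by (simp add: ev_def map_poly_pCons)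

lemma ev_0 [simp]: "ev x 0 = 0"
  by (simp add: ev_def)

lemma ev_add: "ev x (p + q) = ev x p + ev x q"
  by (induction p q rule: poly_induct2) (auto simp: ev_pCons \<iota>_add algebra_simps)

lemma ev_smult: "ev x (Polynomial.smult c p) = \<iota> c * ev x p"
  by (induction p) (auto simp: ev_pCons \<iota>_mult algebra_simps)

lemma ev_mult: "ev x (p * q) = ev x p * ev x q"
  by (induction p) (auto simp: ev_pCons ev_add ev_smult algebra_simps)

lemma ev_sum: "ev x (sum f I) = (\<Sum>i\<in>I. ev x (f i))"
  by (induction I rule: infinite_finite_induct) (auto simp: ev_add)

lemma ev_1 [simp]: "ev x 1 = 1"
  unfolding one_pCons ev_pCons by simp

lemma ev_prod: "ev x (prod f I) = (\<Prod>i\<in>I. ev x (f i))"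
  by (induction I rule: infinite_finite_induct) (auto simp: ev_mult)

lemma ev_linear: "ev x [:- r, 1:] = x - \<iota> r"
  by (simp add: ev_pCons \<iota>_uminus)

end

locale affine = scalars \<iota> for \<iota> :: "complex \<Rightarrow> 'k::field" +
  fixes A0 :: "'k set" and S :: "'k set"
  assumes finite_gens: "finite S"
    and gens: "A0 = generate_ring (ring_on UNIV) (range \<iota> \<union> S)"
begin

sublocale field_subring A0
proof
  show "1 \<in> A0" using generate_ring.one[of "ring_on UNIV" "range \<iota> \<union> S"] by (simp add: gens ring_on_def)
next
  fix x y assume "x \<in> A0" "y \<in> A0"
  then show "x + y \<in> A0" "x * y \<in> A0"
    using generate_ring.eng_add[of x "ring_on UNIV" "range \<iota> \<union> S" y]
      generate_ring.eng_mult[of x "ring_on UNIV" "range \<iota> \<union> S" y] by (auto simp: gens ring_on_def)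
next
  fix x assume "x \<in> A0"
  then show "- x \<in> A0"
    using generate_ring.a_inv[of x "ring_on UNIV" "range \<iota> \<union> S"]
    by (simp add: gens field_subring.a_inv_ring_on[OF field_subring_UNIV])
qed

lemma scalar_in [simp]: "\<iota> z \<in> A0" and gen_in: "s \<in> S \<Longrightarrow> s \<in> A0"
  unfolding gens by (auto intro: generate_ring.incl)

lemma A0_induct [consumes 1, case_names scalar gen uminus add mult]:
  assumes x: "x \<in> A0"
    and "\<And>z. X (\<iota> z)" "\<And>s. s \<in> S \<Longrightarrow> X s" "\<And>x. x \<in> A0 \<Longrightarrow> X x \<Longrightarrow> X (- x)"
    "\<And>x y. x \<in> A0 \<Longrightarrow> y \<in> A0 \<Longrightarrow> X x \<Longrightarrow> X y \<Longrightarrow> X (x + y)"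
    "\<And>x y. x \<in> A0 \<Longrightarrow> y \<in> A0 \<Longrightarrow> X x \<Longrightarrow> X y \<Longrightarrow> X (x * y)"
  shows "X x"
  using x unfolding gens
proof (induction rule: generate_ring.induct)
  case one
  then show ?case using assms(2)[of 1] unfolding \<iota>_1 by (simp add: ring_on_def)
next
  case (incl h)
  then show ?case using assms by auto
next
  case (a_inv h)
  then show ?case using assms(4)[of h] by (simp add: gens field_subring.a_inv_ring_on[OF field_subring_UNIV])
next
  case (eng_add h1 h2)
  then show ?case using assms(5)[of h1 h2] by (simp add: gens ring_on_def)
next
  case (eng_mult h1 h2)
  then show ?case using assms(6)[of h1 h2] by (simp add: gens ring_on_def)
qed

section \<open>Closed points and complex values of functions\<close>

lemma ev_in: "x \<in> A0 \<Longrightarrow> ev x p \<in> A0"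
  by (induction p) (auto simp: ev_pCons)

lemma scalar_notin_prime:
  assumes "primeideal M (ring_on A0)" "\<iota> z \<in> M"
  shows "z = 0"
proof (rule ccontr)
  assume "z \<noteq> 0"
  then have "\<iota> (1 / z) * \<iota> z = 1" by (simp flip: \<iota>_mult)
  then show False using primeD(2,7)[OF assms(1)] assms(2) scalar_in[of "1 / z"] by metis
qed

text \<open>Complex polynomials split into linear factors, and a prime ideal that contains the
  product contains one of them.\<close>

lemma ev_in_prime:
  assumes M: "primeideal M (ring_on A0)" and x: "x \<in> A0" and q: "q \<noteq> 0" "ev x q \<in> M"
  shows "\<exists>r. x - \<iota> r \<in> M"
  using q
proof (induction "degree q" arbitrary: q rule: less_induct)
  case less
  show ?case
  proof (cases "degree q = 0")
    case True
    then obtain c where c: "q = [:c:]" by (metis degree_eq_zeroE)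
    then have "\<iota> c \<in> M" using less.prems by (simp add: ev_pCons)
    then show ?thesis using scalar_notin_prime[OF M] c less.prems by simp
  next
    case False
    then have "\<not> constant (poly q)" by (simp add: constant_degree)
    then obtain r where "poly q r = 0" using fundamental_theorem_of_algebra by blast
    then have "[:- r, 1:] dvd q" by (simp only: poly_eq_0_iff_dvd)
    then obtain p where p: "q = [:- r, 1:] * p" by (rule dvdE)
    then have "(x - \<iota> r) * ev x p \<in> M" using less.prems by (simp only: ev_mult ev_linear)
    then consider "x - \<iota> r \<in> M" | "ev x p \<in> M"
      using primeD(3)[OF M diff_in[OF x scalar_in] ev_in[OF x]] by blast
    then show ?thesis
    proof cases
      case 2
      have "p \<noteq> 0" using p less.prems(1) by (intro notI) (simp only: mult_zero_right)
      then have "degree p < degree q" unfolding p by (subst degree_mult_eq) simp_all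
      then show ?thesis using less.hyps \<open>p \<noteq> 0\<close> 2 by blast
    qed blast
  qed
qed

text \<open>As \<open>A0\<close> has countable dimension and the complex numbers are uncountable, the inverses of the
  \<open>x - z\<close> modulo M cannot be linearly independent over the complex numbers.\<close>

lemma residue_field:
  assumes M: "M \<in> closed_points A0" and x: "x \<in> A0"
  shows "\<exists>z. x - \<iota> z \<in> M"
proof (rule ccontr)
  assume no: "\<not> ?thesis"
  note MP = closed_point_prime[OF M]
  note MD = primeD[OF MP]
  have "\<exists>y. y \<in> A0 \<and> 1 - y * (x - \<iota> z) \<in> M" for z
    using closed_point_inverse[OF M, of "x - \<iota> z"] no diff_in[OF x scalar_in] by blast
  then obtain y where y: "\<And>z. y z \<in> A0" "\<And>z. 1 - y z * (x - \<iota> z) \<in> M" by metis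
  interpret vs: vector_space "\<lambda>z x. \<iota> z * x" by (rule vector_space)
  \<comment> \<open>Monomials in the generators: a countable set that spans A0 over the complex
    numbers.\<close>
  define Mon where "Mon = prod_list ` lists S"
  have "countable Mon" unfolding Mon_def using countable_finite[OF finite_gens] by auto
  moreover have "Mon \<noteq> {}" unfolding Mon_def by auto
  ultimately obtain g :: "nat \<Rightarrow> 'k" where g: "range g = Mon" by (metis range_from_nat_into)
  have Mon_mult: "a * b \<in> Mon" if "a \<in> Mon" "b \<in> Mon" for a b
  proof -
    obtain as bs where "as \<in> lists S" "bs \<in> lists S" "a = prod_list as" "b = prod_list bs"
      using \<open>a \<in> Mon\<close> \<open>b \<in> Mon\<close> unfolding Mon_def by blast
    then show ?thesis unfolding Mon_def by (intro image_eqI[of _ _ "as @ bs"]) auto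
  qed
  have span_mult1: "a * b \<in> vs.span Mon" if "a \<in> Mon" "b \<in> vs.span Mon" for a b
    using \<open>b \<in> vs.span Mon\<close>
  proof (induction rule: vs.span_induct_alt)
    case (step c b b')
    have "a * (\<iota> c * b + b') = \<iota> c * (a * b) + a * b'" by (simp add: algebra_simps)
    then show ?case
      using step Mon_mult[OF \<open>a \<in> Mon\<close>] by (simp add: vs.span_add vs.span_base vs.span_scale)
  qed (simp add: vs.span_zero)
  have span_mult: "a * b \<in> vs.span Mon" if "a \<in> vs.span Mon" "b \<in> vs.span Mon" for a b
    using \<open>a \<in> vs.span Mon\<close>
  proof (induction rule: vs.span_induct_alt)
    case (step c a a')
    have "(\<iota> c * a + a') * b = \<iota> c * (a * b) + a' * b" by (simp add: algebra_simps)
    then show ?case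
      using step span_mult1[OF _ \<open>b \<in> vs.span Mon\<close>] by (simp add: vs.span_add vs.span_scale)
  qed (simp add: vs.span_zero)
  have span: "a \<in> vs.span Mon" if "a \<in> A0" for a
    using that
  proof (induction rule: A0_induct)
    case (scalar z)
    have "1 \<in> Mon" unfolding Mon_def by (intro image_eqI[of _ _ "[]"]) auto
    then show ?case using vs.span_scale[OF vs.span_base, of 1 Mon z] by simp
  next
    case (gen s)
    then have "s \<in> Mon" unfolding Mon_def by (intro image_eqI[of _ _ "[s]"]) auto
    then show ?case by (rule vs.span_base)
  qed (auto intro: vs.span_neg vs.span_add span_mult)
  have "\<exists>n. y z \<in> vs.span (g ` {..<n})" for z
  proof -
    obtain T r where T: "finite T" "T \<subseteq> Mon" "y z = (\<Sum>a\<in>T. \<iota> (r a) * a)"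
      using span[OF y(1)[of z]] unfolding vs.span_explicit by blast
    obtain C where C: "finite C" "T = g ` C"
      using finite_subset_image[of T g UNIV] T g by blast
    obtain n where "C \<subseteq> {..<n}" using C(1) by (metis finite_nat_iff_bounded)
    then have "T \<subseteq> g ` {..<n}" using C by auto
    moreover have "y z \<in> vs.span T" unfolding T(3) by (intro vs.span_sum vs.span_scale vs.span_base)
    ultimately show ?thesis using vs.span_mono by blast
  qed
  then obtain n where n: "\<And>z. y z \<in> vs.span (g ` {..<n z})" by metis
  \<comment> \<open>Each \<open>y z\<close> needs only finitely many monomials. If every bound
    \<open>k\<close> occurred for finitely many \<open>z\<close>, the complex numbers would be a
    countable union of finite sets.\<close>
  have "\<exists>k. infinite {z. n z = k}"
  proof (rule ccontr)
    assume "\<not> ?thesis"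
    then have "countable (\<Union>k. {z. n z = k})" by (auto intro: countable_finite)
    moreover have "(\<Union>k. {z. n z = k}) = UNIV" by auto
    ultimately show False using uncountable_UNIV_complex by simp
  qed
  then obtain k where k: "infinite {z. n z = k}" by blast
  define Z where "Z = {z. n z = k}"
  have inj: "inj y"
  proof (rule injI, rule ccontr)
    fix z w assume e: "y z = y w" and ne: "z \<noteq> w"
    have "(1 - y w * (x - \<iota> w)) - (1 - y z * (x - \<iota> z)) = y z * \<iota> (w - z)"
      unfolding e \<iota>_diff by (simp add: algebra_simps)
    then have "y z * \<iota> (w - z) \<in> M" using field_ideal_diff[OF MD(1) y(2)[of w] y(2)[of z]] by simp
    then have "y z \<in> M" using MD(3)[of "y z" "\<iota> (w - z)"] y(1)[of z] scalar_notin_prime[OF MP, of "w - z"] ne by auto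
    then have "y z * (x - \<iota> z) \<in> M" using MD(8)[OF diff_in[OF x scalar_in]] by blast
    then have "(1 - y z * (x - \<iota> z)) + y z * (x - \<iota> z) \<in> M" using MD(6) y(2) by blast
    then show False using MD(2) by simp
  qed
  have "infinite (y ` Z)" using k inj finite_imageD[of y Z] by (auto simp: Z_def intro: inj_on_subset)
  moreover have "y ` Z \<subseteq> vs.span (g ` {..<k})" using n by (auto simp: Z_def)
  ultimately have "vs.dependent (y ` Z)" using vs.independent_span_bound[of "g ` {..<k}" "y ` Z"] by auto
  then obtain t r where t: "finite t" "t \<subseteq> y ` Z" "(\<Sum>a\<in>t. \<iota> (r a) * a) = 0" "\<exists>a\<in>t. r a \<noteq> 0"
    unfolding vs.dependent_explicit by blast
  then obtain T where T: "finite T" "t = y ` T" by (metis finite_subset_image)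
  define c where "c z = r (y z)" for z
  have injT: "inj_on y T" using inj by (rule inj_on_subset) simp
  have c0: "(\<Sum>z\<in>T. \<iota> (c z) * y z) = 0"
    using t(3) unfolding T(2) sum.reindex[OF injT] by (simp add: c_def)
  obtain z0 where z0: "z0 \<in> T" "c z0 \<noteq> 0" using t(4) T by (auto simp: c_def)
  \<comment> \<open>The numerator of the partial fraction sum of c_z / (X - z) over T. At
    \<open>z0\<close> all summands but one vanish, so \<open>q\<close> is nonzero.\<close>
  define q where "q = (\<Sum>z\<in>T. Polynomial.smult (c z) (\<Prod>w\<in>T - {z}. [:- w, 1:]))"
  have "poly q z0 = (\<Sum>z\<in>T. c z * (\<Prod>w\<in>T - {z}. z0 - w))"
    by (simp add: q_def poly_sum poly_prod)
  also have "\<dots> = c z0 * (\<Prod>w\<in>T - {z0}. z0 - w)"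
    using T(1) z0 by (subst sum.remove[of _ z0]) (auto intro!: sum.neutral)
  also have "\<dots> \<noteq> 0" using z0 T(1) by auto
  finally have "q \<noteq> 0" by auto
  define PT where "PT = (\<Prod>w\<in>T. x - \<iota> w)"
  have "ev x q = (\<Sum>z\<in>T. \<iota> (c z) * (\<Prod>w\<in>T - {z}. x - \<iota> w))"
    by (simp add: q_def ev_sum ev_smult ev_prod ev_linear)
  moreover have "(\<Sum>z\<in>T. \<iota> (c z) * (\<Prod>w\<in>T - {z}. x - \<iota> w) * (y z * (x - \<iota> z))) = PT * (\<Sum>z\<in>T. \<iota> (c z) * y z)"
    unfolding sum_distrib_left
  proof (rule sum.cong)
    fix z assume "z \<in> T"
    then have "PT = (x - \<iota> z) * (\<Prod>w\<in>T - {z}. x - \<iota> w)" unfolding PT_def using T(1) by (rule prod.remove[rotated])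
    then show "\<iota> (c z) * (\<Prod>w\<in>T - {z}. x - \<iota> w) * (y z * (x - \<iota> z)) = PT * (\<iota> (c z) * y z)"
      by (simp only: mult_ac)
  qed simp
  \<comment> \<open>Subtracting \<open>PT\<close> times the linear relation changes nothing and
    turns each summand into a multiple of an element of M.\<close>
  ultimately have "ev x q = (\<Sum>z\<in>T. \<iota> (c z) * (\<Prod>w\<in>T - {z}. x - \<iota> w) * (1 - y z * (x - \<iota> z)))"
    unfolding right_diff_distrib sum_subtractf c0 by simp
  also have "\<dots> \<in> M"
    by (intro field_ideal_sum[OF MD(1)] MD(7)[OF mult_in y(2)] prod_in diff_in x scalar_in)
  finally show False using ev_in_prime[OF MP x \<open>q \<noteq> 0\<close>] no by blast
qed

definition residue :: "'k set \<Rightarrow> 'k \<Rightarrow> complex" where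
  "residue M x = (SOME z. x - \<iota> z \<in> M)"

lemma residue: "M \<in> closed_points A0 \<Longrightarrow> x \<in> A0 \<Longrightarrow> x - \<iota> (residue M x) \<in> M"
  unfolding residue_def using residue_field by (rule someI_ex)

text \<open>If the generators have the same residues at M and N, so has every function, by induction
  over the ring generated. A function in M then has residue 0 at N as well.\<close>

lemma closed_point_eqI:
  assumes M: "M \<in> closed_points A0" and N: "N \<in> closed_points A0"
    and gens: "\<And>s. s \<in> S \<Longrightarrow> s - \<iota> (residue M s) \<in> N"
  shows "N = M"
proof -
  note MD = primeD[OF closed_point_prime[OF M]] and ND = primeD[OF closed_point_prime[OF N]]
  have *: "\<exists>z. f - \<iota> z \<in> M \<inter> N" if "f \<in> A0" for f
    using that
  proof (induction rule: A0_induct)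
    case (scalar z)
    then show ?case using MD(5) ND(5) by (intro exI[of _ z]) auto
  next
    case (gen s)
    then show ?case using gens residue[OF M gen_in] by blast
  next
    case (uminus x)
    then obtain z where "x - \<iota> z \<in> M \<inter> N" by blast
    then have "- (x - \<iota> z) \<in> M \<inter> N" using field_ideal_uminus MD(1) ND(1) by blast
    then show ?case by (intro exI[of _ "- z"]) (simp add: \<iota>_uminus)
  next
    case (add x y)
    then obtain z w where "x - \<iota> z \<in> M \<inter> N" "y - \<iota> w \<in> M \<inter> N" by blast
    then have "(x - \<iota> z) + (y - \<iota> w) \<in> M \<inter> N" using MD(6) ND(6) by blast
    then show ?case by (intro exI[of _ "z + w"]) (simp add: \<iota>_add algebra_simps)
  next
    case (mult x y)
    then obtain z w where "x - \<iota> z \<in> M \<inter> N" "y - \<iota> w \<in> M \<inter> N" by blast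
    then have "y * (x - \<iota> z) + \<iota> z * (y - \<iota> w) \<in> M \<inter> N"
      using MD(6)[OF MD(7)[OF mult.hyps(2)] MD(7)[OF scalar_in]]
        ND(6)[OF ND(7)[OF mult.hyps(2)] ND(7)[OF scalar_in]] by blast
    then show ?case by (intro exI[of _ "z * w"]) (simp add: \<iota>_mult algebra_simps)
  qed
  have "M \<subseteq> N"
  proof
    fix f assume f: "f \<in> M"
    then obtain z where z: "f - \<iota> z \<in> M \<inter> N" using * MD(4) by blast
    then have "f - (f - \<iota> z) \<in> M" using field_ideal_diff[OF MD(1) f] by blast
    then have "z = 0" using scalar_notin_prime[OF closed_point_prime[OF M]] by simp
    then show "f \<in> N" using z by simp
  qed
  then show ?thesis using closed_pointD[OF M ND(1) _ ND(2)] by blast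
qed

end

context ultrametric_val begin

definition ge :: "int \<Rightarrow> 'f \<Rightarrow> bool" where
  "ge N x \<longleftrightarrow> x = 0 \<or> v x \<ge> N"

lemma ge_0 [simp]: "ge N 0"
  by (simp add: ge_def)

lemma ge_add: "ge N x \<Longrightarrow> ge N y \<Longrightarrow> ge N (x + y)"
  using add[of x y] by (cases "x = 0 \<or> y = 0 \<or> x + y = 0") (auto simp: ge_def)

lemma ge_uminus: "ge N x \<Longrightarrow> ge N (- x)"
  by (simp add: ge_def)

lemma ge_diff: "ge N x \<Longrightarrow> ge N y \<Longrightarrow> ge N (x - y)"
  using ge_add[of N x "- y"] ge_uminus[of N y] by simp

lemma ge_mult: "ge M x \<Longrightarrow> ge N y \<Longrightarrow> ge (M + N) (x * y)"
  by (cases "x = 0 \<or> y = 0") (auto simp: ge_def mult)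

end

text \<open>As \<open>t\<close> is no unit, no nonzero power of it is one. So the exponent of
  \<open>t\<close> in a decomposition into a unit and a power of \<open>t\<close> is unique, and it
  is the valuation.\<close>

lemma (in loc_ring) dvr_of_uniformizer:
  assumes tL: "t \<in> localization R P" and t0: "t \<noteq> 0" and tn: "1 / t \<notin> localization R P"
    and decomp': "\<And>f. f \<noteq> 0 \<Longrightarrow> \<exists>n. \<exists>g\<in>{x. x \<noteq> 0 \<and> x \<in> localization R P \<and> 1 / x \<in> localization R P}. f = g * t powi n"
  shows "dvr R P (ord_at R P)"
proof -
  interpret L: field_subring "localization R P" by (rule field_subring_localization)
  let ?L = "localization R P"
  define U where "U = {x. x \<noteq> 0 \<and> x \<in> ?L \<and> 1 / x \<in> ?L}"
  have decomp: "\<exists>n. \<exists>g\<in>U. f = g * t powi n" if "f \<noteq> 0" for f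
    unfolding U_def using that by (rule decomp')
  have U_mult: "x * y \<in> U" if "x \<in> U" "y \<in> U" for x y
  proof -
    have "1 / (x * y) = (1 / x) * (1 / y)" by simp
    then show ?thesis using that L.mult_in[of x y] L.mult_in[of "1 / x" "1 / y"] by (simp add: U_def)
  qed
  have U_inv: "1 / x \<in> U" if "x \<in> U" for x using that by (auto simp: U_def)
  have not_t: "x * t \<notin> U" if "x \<in> ?L" for x
  proof
    assume "x * t \<in> U"
    then have "x * (1 / (x * t)) \<in> ?L" "x \<noteq> 0" using L.mult_in[OF that, of "1 / (x * t)"] by (auto simp: U_def)
    then show False using tn by simp
  qed
  have "1 \<in> U" using L.one_in by (simp add: U_def)
  have U_powi: "k = 0" if "t powi k \<in> U" for k
  proof -
    have "t powi k \<notin> U" if "k > 0" for k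
    proof -
      have "t powi k = t ^ (nat k - 1) * t"
        using that t0 by (simp add: power_int_def flip: power_Suc2)
      then show ?thesis using not_t[of "t ^ (nat k - 1)"] tL by auto
    qed
    moreover have "t powi (- k) \<in> U" using U_inv[OF that] by (simp add: power_int_minus inverse_eq_divide)
    ultimately show ?thesis using that by (metis linorder_neqE_linordered_idom neg_0_less_iff_less)
  qed
  have unique: "n = n'" if "g \<in> U" "g' \<in> U" "g * t powi n = g' * t powi n'" for n n' g g'
  proof -
    have "g' \<noteq> 0" using that by (auto simp: U_def)
    then have "t powi (n' - n) = g * (1 / g')" using that(3) t0 by (simp add: power_int_diff field_simps)
    then have "t powi (n' - n) \<in> U" using U_mult[OF that(1) U_inv[OF that(2)]] by simp
    then show ?thesis using U_powi by fastforce
  qed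
  define v where "v f = (THE n. \<exists>g\<in>U. f = g * t powi n)" for f
  have v: "v (g * t powi n) = n" if "g \<in> U" for g n
    unfolding v_def by (rule the_equality) (use that unique in blast)+
  have "valuation_at R P v"
    unfolding valuation_at_def
  proof (intro conjI allI impI)
    fix x y :: 'f assume "x \<noteq> 0" "y \<noteq> 0"
    then obtain n g m h where gh: "g \<in> U" "x = g * t powi n" "h \<in> U" "y = h * t powi m"
      using decomp by metis
    have "x * y = (g * h) * t powi (n + m)" using gh t0 by (simp add: power_int_add)
    then have "v (x * y) = n + m" using v[OF U_mult[OF gh(1,3)], of "n + m"] by (simp only:)
    then show "v (x * y) = v x + v y" using v[OF gh(1), of n] v[OF gh(3), of m] gh(2,4) by (simp only:)
  next
    show "?L = {x. x = 0 \<or> v x \<ge> 0}"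
    proof (rule equalityI; rule subsetI)
      fix x assume x: "x \<in> ?L"
      show "x \<in> {x. x = 0 \<or> v x \<ge> 0}"
      proof (cases "x = 0")
        case False
        then obtain n g where gn: "g \<in> U" "x = g * t powi n" using decomp by blast
        have "n \<ge> 0"
        proof (rule ccontr)
          assume "\<not> n \<ge> 0"
          define k where "k = nat (- n) - 1"
          have k: "n = - int k - 1" using \<open>\<not> n \<ge> 0\<close> by (simp add: k_def)
          have "t powi n = 1 / (t ^ k * t)"
            using t0 by (simp add: k power_int_diff power_int_minus field_simps)
          then have "x * t ^ k * t = g" using gn t0 by simp
          then show False using not_t[OF L.mult_in[OF x L.power_in[OF tL, of k]]] gn(1) by (simp only: simp_thms)
        qed
        then show ?thesis using v gn by simp
      qed simp
    next
      fix x assume x: "x \<in> {x. x = 0 \<or> v x \<ge> 0}"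
      show "x \<in> ?L"
      proof (cases "x = 0")
        case False
        then obtain n g where gn: "g \<in> U" "x = g * t powi n" using decomp by blast
        then have "n \<ge> 0" using v[OF gn(1), of n] x False gn(2) t0 by auto
        then have "x = g * t ^ nat n" using gn by (simp add: power_int_def)
        then show ?thesis using gn tL by (auto simp: U_def)
      qed auto
    qed
  next
    show "\<exists>t. t \<noteq> 0 \<and> v t = 1" using v[OF \<open>1 \<in> U\<close>, of 1] t0 by auto
  qed
  then interpret d: dvr R P v by unfold_locales
  have "valuation_at R P (ord_at R P)"
    unfolding valuation_at_def
  proof (intro conjI allI impI)
    show "?L = {x. x = 0 \<or> ord_at R P x \<ge> 0}" using d.ord_at_eq unfolding d.loc_eq by (intro Collect_cong) metis
    show "\<exists>t. t \<noteq> 0 \<and> ord_at R P t = 1" using d.ord_at_eq d.uniformizer by metis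
  qed (simp add: d.ord_at_eq d.mult)
  then have "dvr_axioms R P (ord_at R P)" by (simp add: dvr_axioms_def)
  then show ?thesis by (intro dvr.intro loc_ring_axioms)
qed

context loc_ring begin

lemma local_max_add:
  assumes "x \<in> local_max R P" "y \<in> local_max R P"
  shows "x + y \<in> local_max R P"
proof -
  obtain a b where ab: "x = a / b" "a \<in> P" "b \<in> R" "b \<notin> P" using assms(1) unfolding local_max_def by blast
  obtain c d where cd: "y = c / d" "c \<in> P" "d \<in> R" "d \<notin> P" using assms(2) unfolding local_max_def by blast
  have "x + y = (a * d + c * b) / (b * d)" using ab cd notin_nz by (simp add: field_simps)
  moreover have "a * d + c * b \<in> P" using P(6)[OF P(8)[OF cd(3) ab(2)] P(8)[OF ab(3) cd(2)]] .
  ultimately show ?thesis unfolding local_max_def using mult_in[OF ab(3) cd(3)] prod_notin ab cd by blast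
qed

lemma local_max_mult:
  assumes "r \<in> localization R P" "x \<in> local_max R P"
  shows "r * x \<in> local_max R P"
proof -
  obtain a b where ab: "r = a / b" "a \<in> R" "b \<in> R" "b \<notin> P" using assms(1) unfolding localization_def by blast
  obtain c d where cd: "x = c / d" "c \<in> P" "d \<in> R" "d \<notin> P" using assms(2) unfolding local_max_def by blast
  have "r * x = (a * c) / (b * d)" using ab cd by simp
  moreover have "a * c \<in> P" using P(7)[OF ab(2) cd(2)] .
  ultimately show ?thesis unfolding local_max_def using mult_in[OF ab(3) cd(3)] prod_notin ab cd by blast
qed

end

lemma (in dvr) ge_loc: "ge 0 x \<longleftrightarrow> x \<in> localization R P"
  by (simp add: ge_def loc_iff)

lemma (in dvr) ge_mem: "x \<in> R \<Longrightarrow> ge 0 x"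
  using loc_incl ge_loc by blast

locale curve = affine \<iota> A0 S for \<iota> :: "complex \<Rightarrow> 'k::field" and A0 :: "'k set" and S +
  assumes frac: "\<exists>a\<in>A0. \<exists>b\<in>A0. b \<noteq> 0 \<and> x = a / b"
    and dim: "krull_dim A0 = 1" and smooth: "smooth A0"
begin

lemma prime_divisors_eq: "prime_divisors A0 = closed_points A0"
  and nonzero_prime_closed: "primeideal P (ring_on A0) \<Longrightarrow> P \<noteq> {0} \<Longrightarrow> P \<in> closed_points A0"
  using krull_dim_1[OF dim] by auto

lemma ex_closed_point: "\<exists>a. a \<in> closed_points A0"
  using krull_dim_1(2,3)[OF dim] by blast

lemma loc_ring: "a \<in> closed_points A0 \<Longrightarrow> loc_ring A0 a"
  using closed_point_prime field_subring_axioms by (simp add: loc_ring_def loc_ring_axioms_def)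

text \<open>Closed points of the curve have height one, so smoothness provides a single generator of
  the maximal ideal of the local ring. Multiplying by its denominator, a unit, brings it into
  \<open>a\<close>.\<close>

lemma local_generator:
  assumes a: "a \<in> closed_points A0"
  obtains t where "t \<in> a" "t \<noteq> 0" "\<And>h. h \<in> local_max A0 a \<Longrightarrow> \<exists>y\<in>localization A0 a. h = y * t"
proof -
  interpret loc_ring A0 a by (rule loc_ring[OF a])
  interpret L: field_subring "localization A0 a" by (rule field_subring_localization)
  have pd: "a \<in> prime_divisors A0" using a prime_divisors_eq by simp
  then have "height A0 a = 1" by (simp add: prime_divisors_def)
  then obtain T where T: "T \<subseteq> localization A0 a" "finite T" "enat (card T) = 1"
      "genideal (ring_on (localization A0 a)) T = local_max A0 a"
    using smooth a unfolding smooth_def by metis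
  then have "card T = 1" by (simp add: one_enat_def)
  then obtain x where x: "T = {x}" by (auto simp: card_1_singleton_iff)
  have "cgenideal (ring_on (localization A0 a)) x = local_max A0 a"
    using T(1,4) cring.cgenideal_eq_genideal[OF L.cring, of x] x by (simp add: ring_on_def)
  then have lm: "local_max A0 a = {y * x |y. y \<in> localization A0 a}" by (simp add: ring_on_cgenideal)
  then have "1 * x \<in> local_max A0 a" by blast
  then obtain p b where pb: "1 * x = p / b" "p \<in> a" "b \<in> A0" "b \<notin> a" unfolding local_max_def by blast
  have b0: "b \<noteq> 0" using notin_nz pb by auto
  show ?thesis
  proof (rule that[OF pb(2)])
    obtain h where h: "h \<in> a" "h \<noteq> 0" using pd P(5) by (auto simp: prime_divisors_iff)
    have "h / 1 \<in> local_max A0 a" unfolding local_max_def using h P(2) by blast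
    then obtain y where "h = y * x" unfolding lm by auto
    then show "p \<noteq> 0" using h pb by auto
  next
    fix h assume "h \<in> local_max A0 a"
    then obtain y where y: "h = y * x" "y \<in> localization A0 a" unfolding lm by auto
    have "1 / b \<in> localization A0 a" using in_locI pb by auto
    then have "y * (1 / b) \<in> localization A0 a" using y by blast
    moreover have "h = y * (1 / b) * p" using y pb by simp
    ultimately show "\<exists>y\<in>localization A0 a. h = y * p" by blast
  qed
qed

text \<open>The intersection of the powers of the maximal ideal of the local ring contracts to a prime that
  does not contain the uniformizer, hence to zero as the height is one; Krull's intersection theorem
  is not needed.\<close>

lemma dvr_ord:
  assumes a: "a \<in> closed_points A0"
  shows "dvr A0 a (ord_at A0 a)"
proof -
  interpret loc_ring A0 a by (rule loc_ring[OF a])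
  interpret L: field_subring "localization A0 a" by (rule field_subring_localization)
  have "a \<in> prime_divisors A0" using a prime_divisors_eq by simp
  let ?L = "localization A0 a"
  obtain t where t: "t \<in> a" "t \<noteq> 0" "\<And>h. h \<in> local_max A0 a \<Longrightarrow> \<exists>y\<in>?L. h = y * t"
    using local_generator[OF a] by metis
  have tA: "t \<in> A0" using t P(4) by auto
  have tL: "t \<in> ?L" using tA loc_incl by auto
  have "t / 1 \<in> local_max A0 a" unfolding local_max_def using t(1) P(2) by blast
  then have tn: "1 / t \<notin> ?L" using t(2) by (simp add: local_max_eq)
  define U where "U = {x. x \<noteq> 0 \<and> x \<in> ?L \<and> 1 / x \<in> ?L}"
  have U_mult: "x * y \<in> U" if "x \<in> U" "y \<in> U" for x y
  proof -
    have "1 / (x * y) = (1 / x) * (1 / y)" by simp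
    then show ?thesis using that L.mult_in[of x y] L.mult_in[of "1 / x" "1 / y"] by (simp add: U_def)
  qed
  have U_inv: "1 / x \<in> U" if "x \<in> U" for x using that by (auto simp: U_def)
  have not_t: "x * t \<notin> U" if "x \<in> ?L" for x
  proof
    assume "x * t \<in> U"
    then have "x * (1 / (x * t)) \<in> ?L" "x \<noteq> 0" using L.mult_in[OF that, of "1 / (x * t)"] by (auto simp: U_def)
    then show False using tn by simp
  qed
  have notU: "\<exists>y\<in>?L. x = y * t" if "x \<in> ?L" "x \<notin> U" for x
    by (rule t(3)) (use that in \<open>auto simp: local_max_eq U_def\<close>)
  define Q where "Q = {h \<in> A0. \<forall>n. \<exists>y\<in>?L. h = y * t ^ n}"
  \<comment> \<open>Take the largest \<open>n\<close> such that t^n divides \<open>h\<close> in the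
    local ring; the quotient is a unit, since a nonunit would contain a further factor
    \<open>t\<close>.\<close>
  have decomp: "\<exists>n g. g \<in> U \<and> h = g * t ^ n" if h: "h \<in> A0" "h \<notin> Q" for h
  proof -
    obtain n0 where "\<not> (\<exists>y\<in>?L. h = y * t ^ n0)" using h by (auto simp: Q_def)
    moreover have "\<exists>y\<in>?L. h = y * t ^ 0" using loc_incl[OF h(1)] by simp
    ultimately obtain n where n: "\<exists>y\<in>?L. h = y * t ^ n" "\<not> (\<exists>y\<in>?L. h = y * t ^ Suc n)"
      using ex_least_nat_less[of "\<lambda>n. \<not> (\<exists>y\<in>?L. h = y * t ^ n)" n0] by blast
    then obtain y where y: "y \<in> ?L" "h = y * t ^ n" by blast
    have "y \<in> U"
    proof (rule ccontr)
      assume "y \<notin> U"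
      then obtain z where "z \<in> ?L" "y = z * t" using notU y by blast
      then have "h = z * t ^ Suc n" using y by simp
      then show False using n(2) \<open>z \<in> ?L\<close> by blast
    qed
    then show ?thesis using y by blast
  qed
  have "field_ideal A0 Q"
    unfolding field_ideal_def
  proof (intro conjI ballI)
    show "Q \<subseteq> A0" by (auto simp: Q_def)
    show "0 \<in> Q" using L.zero_in by (auto simp: Q_def)
  next
    fix x y assume xy: "x \<in> Q" "y \<in> Q"
    have "\<exists>z\<in>?L. x + y = z * t ^ n" for n
    proof -
      obtain z where z: "z \<in> ?L" "x = z * t ^ n" using xy(1) unfolding Q_def by blast
      obtain w where w: "w \<in> ?L" "y = w * t ^ n" using xy(2) unfolding Q_def by blast
      have "x + y = (z + w) * t ^ n" unfolding z(2) w(2) by (simp only: distrib_right)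
      then show ?thesis using L.add_in[OF z(1) w(1)] by blast
    qed
    moreover have "x \<in> A0" "y \<in> A0" using xy unfolding Q_def by blast+
    ultimately show "x + y \<in> Q" unfolding Q_def by blast
  next
    fix r x assume rx: "r \<in> A0" "x \<in> Q"
    have "\<exists>z\<in>?L. r * x = z * t ^ n" for n
    proof -
      obtain z where z: "z \<in> ?L" "x = z * t ^ n" using rx(2) unfolding Q_def by blast
      have "r * x = (r * z) * t ^ n" unfolding z(2) by (simp only: mult.assoc)
      then show ?thesis using L.mult_in[OF loc_incl[OF rx(1)] z(1)] by blast
    qed
    moreover have "x \<in> A0" using rx unfolding Q_def by blast
    ultimately show "r * x \<in> Q" unfolding Q_def using mult_in[OF rx(1)] by blast
  qed
  moreover have U_notin: "g * t ^ n \<notin> Q" if g: "g \<in> U" for g n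
  proof
    assume "g * t ^ n \<in> Q"
    then obtain y where y: "y \<in> ?L" "g * t ^ n = y * t ^ Suc n" unfolding Q_def by blast
    then have "g = y * t" using t(2) by simp
    then show False using not_t[OF y(1)] g by simp
  qed
  moreover have "1 \<in> U" using L.one_in by (simp add: U_def)
  ultimately have Q: "primeideal Q (ring_on A0)"
    unfolding primeideal_ring_on_iff
  proof (intro conjI ballI impI)
    show "1 \<notin> Q" using U_notin[OF \<open>1 \<in> U\<close>, of 0] by simp
    fix x y assume xy: "x \<in> A0" "y \<in> A0" "x * y \<in> Q"
    show "x \<in> Q \<or> y \<in> Q"
    proof (rule ccontr)
      assume "\<not> ?thesis"
      then have nQ: "x \<notin> Q" "y \<notin> Q" by blast+
      obtain n g where g: "g \<in> U" "x = g * t ^ n" using decomp[OF xy(1) nQ(1)] by blast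
      obtain m h where h: "h \<in> U" "y = h * t ^ m" using decomp[OF xy(2) nQ(2)] by blast
      have "x * y = (g * h) * t ^ (n + m)" unfolding g(2) h(2) by (simp add: power_add mult_ac)
      then have "(g * h) * t ^ (n + m) \<in> Q" "g * h \<in> U" using xy(3) U_mult[OF g(1) h(1)] by simp_all
      then show False using U_notin by blast
    qed
  qed
  have "Q \<subseteq> a"
  proof
    fix h assume h: "h \<in> Q"
    show "h \<in> a"
    proof (rule ccontr)
      assume "h \<notin> a"
      moreover have "h \<in> A0" using h by (auto simp: Q_def)
      ultimately have "h \<in> U" using in_locI[of 1 h] loc_incl[of h] notin_nz by (auto simp: U_def)
      then show False using U_notin[of h 0] h by simp
    qed
  qed
  moreover have "t \<notin> Q" using U_notin[OF \<open>1 \<in> U\<close>, of 1] by simp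
  ultimately have Q0: "Q = {0}"
    using Q t(1) \<open>a \<in> prime_divisors A0\<close>[unfolded prime_divisors_iff] by metis
  have decomp': "\<exists>n. \<exists>g\<in>U. f = g * t powi n" if "f \<noteq> 0" for f
  proof -
    obtain p q where pq: "p \<in> A0" "q \<in> A0" "q \<noteq> 0" "f = p / q" using frac by blast
    then have "p \<noteq> 0" using that by auto
    then have nQ: "p \<notin> Q" "q \<notin> Q" using pq Q0 by simp_all
    obtain n g m h where gh: "g \<in> U" "p = g * t ^ n" "h \<in> U" "q = h * t ^ m"
      using decomp[OF pq(1) nQ(1)] decomp[OF pq(2) nQ(2)] by blast
    have "h \<noteq> 0" using gh(3) unfolding U_def by blast
    then have "f = (g * (1 / h)) * t powi (int n - int m)"
      using t(2) pq gh by (simp add: power_int_diff)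
    then show ?thesis using U_mult[OF gh(1) U_inv[OF gh(3)]] by blast
  qed
  show ?thesis by (rule dvr_of_uniformizer[OF tL t(2) tn]) (rule decomp'[unfolded U_def])
qed

text \<open>Zeros of \<open>y\<close> are isolated: each closed point a has a basic open
  neighbourhood, the nonvanishing of \<open>g a\<close>, that contains no zero of \<open>y\<close>
  other than possibly a. The spectrum is quasi-compact, so finitely many neighbourhoods cover
  it.\<close>

lemma finite_zeros:
  assumes y: "y \<in> A0" "y \<noteq> 0"
  shows "finite {a \<in> closed_points A0. y \<in> a}"
proof -
  have "\<exists>g. g \<in> A0 \<and> g \<notin> a \<and> (\<forall>b\<in>closed_points A0. y \<in> b \<longrightarrow> g \<notin> b \<longrightarrow> b = a)"
    if a: "a \<in> closed_points A0" for a
  proof -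
    interpret d: dvr A0 a "ord_at A0 a" by (rule dvr_ord[OF a])
    obtain t where t: "t \<in> a" "t \<noteq> 0" "ord_at A0 a t = 1" by (rule d.uniformizer_in)
    have tA: "t \<in> A0" using t d.P(4) by auto
    \<comment> \<open>The uniformizer generates the local maximal ideal, so it divides every centred
      generator \<open>s - \<iota> (residue a s)\<close> up to a denominator that is nonzero at
      \<open>a\<close>.\<close>
    have "\<exists>p q. p \<in> A0 \<and> q \<in> A0 \<and> q \<notin> a \<and> q * (s - \<iota> (residue a s)) = p * t" if s: "s \<in> S" for s
    proof -
      let ?x = "s - \<iota> (residue a s)"
      have x: "?x \<in> a" using residue[OF a gen_in[OF s]] .
      have "?x / t \<in> localization A0 a"
        using x t d.P_iff[of ?x] d.P(4) d.div[of ?x t] by (cases "?x = 0") (auto simp: d.loc_iff)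
      then obtain p q where "?x / t = p / q" "p \<in> A0" "q \<in> A0" "q \<notin> a" unfolding localization_def by blast
      then show ?thesis using t(2) d.notin_nz[of q] by (intro exI[of _ p] exI[of _ q]) (auto simp: field_simps)
    qed
    then obtain p q where pq: "\<And>s. s \<in> S \<Longrightarrow> p s \<in> A0 \<and> q s \<in> A0 \<and> q s \<notin> a \<and>
        q s * (s - \<iota> (residue a s)) = p s * t" by metis
    define n where "n = nat (ord_at A0 a y)"
    have "ord_at A0 a (y / t ^ n) = 0"
      using d.div[of y "t ^ n"] d.pow[OF t(2), of n] t d.nonneg[OF y] y by (simp add: n_def)
    then have "y / t ^ n \<in> localization A0 a" by (simp add: d.loc_iff)
    then obtain r w where rw: "y / t ^ n = r / w" "r \<in> A0" "w \<in> A0" "w \<notin> a" unfolding localization_def by blast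
    have w0: "w \<noteq> 0" using d.notin_nz rw by auto
    have wy: "w * y = t ^ n * r" using rw(1) w0 t(2) by (simp add: field_simps)
    have r: "r \<notin> a"
    proof
      assume "r \<in> a"
      then have "r / w \<in> local_max A0 a" unfolding local_max_def using rw by blast
      then have "y / t ^ n = 0 \<or> ord_at A0 a (y / t ^ n) > 0" using rw(1) d.max_iff by simp
      then show False using \<open>ord_at A0 a (y / t ^ n) = 0\<close> y t(2) by simp
    qed
    \<comment> \<open>Where \<open>g\<close> does not vanish, \<open>y = 0\<close> forces
      \<open>t = 0\<close> by \<open>wy\<close>, and then all generators take their values at
      \<open>a\<close>; that leaves only the point \<open>a\<close>.\<close>
    define g where "g = r * (\<Prod>s\<in>S. q s)"
    have g1: "g \<in> A0" unfolding g_def using rw pq by (intro mult_in prod_in) auto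
    have g2: "g \<notin> a"
    proof
      assume "g \<in> a"
      then have "(\<Prod>s\<in>S. q s) \<in> a" using d.P(3)[of r "\<Prod>s\<in>S. q s"] r rw pq prod_in[of S q] by (auto simp: g_def)
      then show False using prime_prod[OF closed_point_prime[OF a] finite_gens, of q] pq by blast
    qed
    have "b = a" if b: "b \<in> closed_points A0" "y \<in> b" "g \<notin> b" for b
    proof -
      note bP = closed_point_prime[OF b(1)]
      note bD = primeD[OF bP]
      have rb: "r \<notin> b" using b(3) bD(8)[of "\<Prod>s\<in>S. q s" r] pq prod_in[of S q] by (auto simp: g_def)
      have qb: "q s \<notin> b" if "s \<in> S" for s
      proof
        assume "q s \<in> b"
        moreover have "g = (r * (\<Prod>s\<in>S - {s}. q s)) * q s"
          unfolding g_def using that finite_gens by (subst prod.remove[of _ s]) (auto simp: mult_ac)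
        moreover have "r * (\<Prod>s\<in>S - {s}. q s) \<in> A0" using rw pq by (intro mult_in prod_in) auto
        ultimately show False using b(3) bD(7) by simp
      qed
      have "t ^ n * r \<in> b" using wy bD(7)[OF rw(3) b(2)] by simp
      then have "t ^ n \<in> b" using bD(3)[OF power_in[OF tA] rw(2)] rb by blast
      then have tb: "t \<in> b" using prime_power[OF bP tA] by blast
      show "b = a"
      proof (rule closed_point_eqI[OF a b(1)])
        fix s assume s: "s \<in> S"
        have "q s * (s - \<iota> (residue a s)) \<in> b" using pq[OF s] bD(7)[of "p s" t] tb by simp
        then show "s - \<iota> (residue a s) \<in> b"
          using bD(3)[of "q s", OF _ diff_in[OF gen_in[OF s] scalar_in]] qb[OF s] pq[OF s] by blast
      qed
    qed
    then show ?thesis using g1 g2 by blast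
  qed
  then obtain g where g: "\<And>a. a \<in> closed_points A0 \<Longrightarrow> g a \<in> A0 \<and> g a \<notin> a \<and>
      (\<forall>b\<in>closed_points A0. y \<in> b \<longrightarrow> g a \<notin> b \<longrightarrow> b = a)" by metis
  \<comment> \<open>The ideal generated by all \<open>g a\<close>. No closed point a contains it,
    because \<open>g a\<close> is not in a; so it contains 1, and finitely many \<open>g a\<close>
    already generate it.\<close>
  define J where "J = {\<Sum>a\<in>F. c a * g a |F c. finite F \<and> F \<subseteq> closed_points A0 \<and> (\<forall>a\<in>F. c a \<in> A0)}"
  have "field_ideal A0 J"
    unfolding field_ideal_def
  proof (intro conjI ballI)
    show "J \<subseteq> A0" unfolding J_def using g by (auto intro!: sum_in mult_in)
    show "0 \<in> J" unfolding J_def by (auto intro!: exI[of _ "{}"])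
  next
    fix x z assume "x \<in> J" "z \<in> J"
    then obtain F c F' c' where *: "x = (\<Sum>a\<in>F. c a * g a)" "finite F" "F \<subseteq> closed_points A0" "\<forall>a\<in>F. c a \<in> A0"
      "z = (\<Sum>a\<in>F'. c' a * g a)" "finite F'" "F' \<subseteq> closed_points A0" "\<forall>a\<in>F'. c' a \<in> A0"
      unfolding J_def by blast
    let ?c = "\<lambda>a. (if a \<in> F then c a else 0) + (if a \<in> F' then c' a else 0)"
    have "x = (\<Sum>a\<in>F \<union> F'. (if a \<in> F then c a else 0) * g a)"
      unfolding *(1) using * by (intro sum.mono_neutral_cong_left) auto
    moreover have "z = (\<Sum>a\<in>F \<union> F'. (if a \<in> F' then c' a else 0) * g a)"
      unfolding *(5) using * by (intro sum.mono_neutral_cong_left) auto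
    ultimately have "x + z = (\<Sum>a\<in>F \<union> F'. ?c a * g a)"
      by (simp add: distrib_right sum.distrib)
    then show "x + z \<in> J" unfolding J_def mem_Collect_eq using *
      by (intro exI[of _ "F \<union> F'"] exI[of _ ?c]) auto
  next
    fix s x assume "s \<in> A0" "x \<in> J"
    then obtain F c where *: "x = (\<Sum>a\<in>F. c a * g a)" "finite F" "F \<subseteq> closed_points A0" "\<forall>a\<in>F. c a \<in> A0"
      unfolding J_def by blast
    then show "s * x \<in> J" unfolding J_def mem_Collect_eq using \<open>s \<in> A0\<close>
      by (intro exI[of _ F] exI[of _ "\<lambda>a. s * c a"]) (auto simp: sum_distrib_left mult.assoc)
  qed
  moreover have "g a \<in> J" if "a \<in> closed_points A0" for a
    unfolding J_def mem_Collect_eq using that by (intro exI[of _ "{a}"] exI[of _ "\<lambda>_. 1"]) auto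
  ultimately have "1 \<in> J" using exists_closed_point[of J] g by blast
  then obtain F c where F: "1 = (\<Sum>a\<in>F. c a * g a)" "finite F" "F \<subseteq> closed_points A0" "\<forall>a\<in>F. c a \<in> A0"
    unfolding J_def by blast
  have "{a \<in> closed_points A0. y \<in> a} \<subseteq> F"
  proof
    fix b assume b: "b \<in> {a \<in> closed_points A0. y \<in> a}"
    note bD = primeD[OF closed_point_prime[of b]]
    have "\<exists>a\<in>F. g a \<notin> b"
    proof (rule ccontr)
      assume "\<not> ?thesis"
      then have "(\<Sum>a\<in>F. c a * g a) \<in> b" using bD b F by (intro field_ideal_sum) auto
      then show False using F(1) bD(2) b by simp
    qed
    then show "b \<in> F" using g F(3) b by blast
  qed
  then show ?thesis using F(2) finite_subset by blast
qed

lemma finite_ord_nonzero: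
  assumes f: "f \<noteq> 0"
  shows "finite {a \<in> closed_points A0. ord_at A0 a f \<noteq> 0}"
proof -
  obtain p q where pq: "p \<in> A0" "q \<in> A0" "q \<noteq> 0" "f = p / q" using frac by blast
  have p: "p \<noteq> 0" using pq f by auto
  have "ord_at A0 a f = 0" if a: "a \<in> closed_points A0" "p \<notin> a" "q \<notin> a" for a
  proof -
    interpret d: dvr A0 a "ord_at A0 a" by (rule dvr_ord[OF a(1)])
    show ?thesis using d.div[OF p pq(3)] d.P_iff[of p] d.P_iff[of q] d.nonneg[of p] d.nonneg[of q] p pq a by simp
  qed
  then have "{a \<in> closed_points A0. ord_at A0 a f \<noteq> 0} \<subseteq>
      {a \<in> closed_points A0. p \<in> a} \<union> {a \<in> closed_points A0. q \<in> a}" by blast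
  then show ?thesis using finite_zeros pq p by (meson finite_Un finite_subset)
qed

text \<open>Being regular is local: if all orders are nonnegative, the ideal of denominators of
  \<open>f\<close> is contained in no closed point, hence contains 1.\<close>

lemma A0_iff: "f \<in> A0 \<longleftrightarrow> f = 0 \<or> (\<forall>a\<in>closed_points A0. ord_at A0 a f \<ge> 0)"
proof
  assume "f \<in> A0"
  then show "f = 0 \<or> (\<forall>a\<in>closed_points A0. ord_at A0 a f \<ge> 0)"
    using dvr.nonneg[OF dvr_ord] by blast
next
  assume f: "f = 0 \<or> (\<forall>a\<in>closed_points A0. ord_at A0 a f \<ge> 0)"
  define J where "J = {h \<in> A0. h * f \<in> A0}"
  have J: "field_ideal A0 J"
    unfolding field_ideal_def J_def by (auto simp: distrib_right mult.assoc)
  have "1 \<in> J"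
  proof (rule ccontr)
    assume "1 \<notin> J"
    then obtain M where M: "M \<in> closed_points A0" "J \<subseteq> M" using exists_closed_point[OF J] by blast
    interpret d: dvr A0 M "ord_at A0 M" by (rule dvr_ord[OF M(1)])
    have "f \<in> localization A0 M" using f M(1) by (auto simp: d.loc_iff)
    then obtain p q where "f = p / q" "p \<in> A0" "q \<in> A0" "q \<notin> M" unfolding localization_def by blast
    then show False using M(2) d.notin_nz[of q] by (auto simp: J_def)
  qed
  then show "f \<in> A0" by (simp add: J_def)
qed

text \<open>A weak form of approximation. Distinct maximal ideals are incomparable, so each b in F
  has an element outside \<open>a\<close>; high powers of these are multiplied.\<close>

lemma avoid_and_vanish:
  assumes a: "a \<in> closed_points A0" and F: "finite F" "F \<subseteq> closed_points A0" "a \<notin> F"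
  shows "\<exists>h\<in>A0. h \<notin> a \<and> (\<forall>b\<in>F. ord_at A0 b h \<ge> int (N b))"
  using F
proof (induction F rule: finite_induct)
  case empty
  then show ?case using primeD(2)[OF closed_point_prime[OF a]] by auto
next
  case (insert b F)
  then obtain h where h: "h \<in> A0" "h \<notin> a" "\<And>c. c \<in> F \<Longrightarrow> ord_at A0 c h \<ge> int (N c)" by auto
  have b: "b \<in> closed_points A0" "b \<noteq> a" using insert by auto
  note aD = primeD[OF closed_point_prime[OF a]]
  have "\<not> b \<subseteq> a" using closed_pointD[OF b(1) aD(1) _ aD(2)] b(2) by auto
  then obtain g where g: "g \<in> b" "g \<notin> a" by blast
  have gA: "g \<in> A0" using g(1) primeD(4)[OF closed_point_prime[OF b(1)]] by auto
  have nz: "h \<noteq> 0" "g \<noteq> 0" using h g aD(5) by auto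
  have gn: "g ^ N b \<in> A0" "g ^ N b \<noteq> 0" using gA nz by auto
  have "g ^ N b * h \<notin> a"
    using aD(3)[OF gn(1) h(1)] prime_power_notin[OF closed_point_prime[OF a] gA g(2)] h(2) by blast
  moreover have "ord_at A0 c (g ^ N b * h) \<ge> int (N c)" if c: "c \<in> insert b F" for c
  proof -
    have cc: "c \<in> closed_points A0" using c insert by auto
    interpret d: dvr A0 c "ord_at A0 c" by (rule dvr_ord[OF cc])
    have e: "ord_at A0 c (g ^ N b * h) = ord_at A0 c (g ^ N b) + ord_at A0 c h" using d.mult gn nz by blast
    show ?thesis
    proof (cases "c = b")
      case True
      then have "ord_at A0 c g \<ge> 1" using d.P_iff[OF gA] g nz by auto
      then have "ord_at A0 c (g ^ N b) \<ge> int (N b)"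
        using d.pow[OF nz(2), of "N b"] mult_left_mono[of 1 "ord_at A0 c g" "int (N b)"] by simp
      then show ?thesis using e d.nonneg[OF h(1) nz(1)] True by simp
    next
      case False
      then show ?thesis using e h(3)[of c] c d.nonneg[OF gn] by auto
    qed
  qed
  ultimately show ?case using gn h by blast
qed

text \<open>A0 is finitely generated, so the order of D f for f in the local ring is bounded below
  by the minimum \<mu> over the generators, attained at some \<open>s\<close>. Up to a constant,
  \<open>s = t * y\<close>, and in D s the term with D y has order above \<mu>; hence the order of D
  t is at most \<mu>.\<close>

lemma derivation_uniformizer:
  assumes D: "derivation \<iota> D" "D x \<noteq> 0"
    and a: "a \<in> closed_points A0" and t: "t \<noteq> 0" "ord_at A0 a t = 1"
  shows "D t \<noteq> 0" and "f \<in> localization A0 a \<Longrightarrow> D f / D t \<in> localization A0 a"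
proof -
  interpret d: dvr A0 a "ord_at A0 a" by (rule dvr_ord[OF a])
  interpret D: deriv \<iota> D using D(1) by unfold_locales
  have nz: "\<exists>s\<in>S. D s \<noteq> 0"
  proof (rule ccontr)
    assume "\<not> ?thesis"
    then have D0: "s \<in> S \<Longrightarrow> D s = 0" for s by blast
    have "D f = 0" if "f \<in> A0" for f
      using that by (induction rule: A0_induct) (simp_all add: D.uminus D.add D.mult D0)
    moreover obtain p q where "p \<in> A0" "q \<in> A0" "q \<noteq> 0" "x = p / q" using frac by blast
    ultimately have "D x = 0" by (simp add: D.div)
    then show False using D(2) by simp
  qed
  define W where "W = (\<lambda>s. ord_at A0 a (D s)) ` {s \<in> S. D s \<noteq> 0}"
  have W: "finite W" "W \<noteq> {}" using finite_gens nz by (auto simp: W_def)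
  define \<mu> where "\<mu> = Min W"
  have "\<mu> \<in> W" unfolding \<mu>_def using W by (rule Min_in)
  then obtain s where s: "s \<in> S" "D s \<noteq> 0" "ord_at A0 a (D s) = \<mu>" by (auto simp: W_def)
  have mu: "d.ge \<mu> (D f)" if "f \<in> A0" for f
    using that
  proof (induction rule: A0_induct)
    case (gen r)
    then show ?case using Min_le[OF W(1), of "ord_at A0 a (D r)"] by (auto simp: d.ge_def \<mu>_def W_def)
  next
    case (mult f g)
    then have "d.ge \<mu> (f * D g)" "d.ge \<mu> (g * D f)"
      using d.ge_mult[of 0 f \<mu> "D g"] d.ge_mult[of 0 g \<mu> "D f"] d.ge_mem by auto
    then show ?case by (auto simp: D.mult intro: d.ge_add)
  qed (auto simp: D.uminus D.add intro: d.ge_add d.ge_uminus)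
  have muL: "d.ge \<mu> (D f)" if f: "f \<in> localization A0 a" for f
  proof -
    obtain p q where pq: "f = p / q" "p \<in> A0" "q \<in> A0" "q \<notin> a" using f unfolding localization_def by blast
    have q0: "q \<noteq> 0" using d.notin_nz pq by auto
    have "D f = (q * D p - p * D q) * (1 / q ^ 2)"
      unfolding pq(1) D.div[OF q0] using q0 by (simp add: field_simps power2_eq_square)
    moreover have "d.ge \<mu> (q * D p - p * D q)"
      using d.ge_mult[of 0 q \<mu> "D p"] d.ge_mult[of 0 p \<mu> "D q"] d.ge_mem mu pq by (auto intro: d.ge_diff)
    moreover have "ord_at A0 a q = 0" using d.P_iff[of q] d.nonneg[of q] pq q0 by auto
    then have "d.ge 0 (1 / q ^ 2)" using d.inv[of "q ^ 2"] d.pow[OF q0, of 2] q0 by (simp add: d.ge_def)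
    ultimately show ?thesis using d.ge_mult[of \<mu> "q * D p - p * D q" 0 "1 / q ^ 2"] by simp
  qed
  \<comment> \<open>Subtracting the residue leaves D s unchanged and makes \<open>s\<close>
    divisible by \<open>t\<close> in the local ring.\<close>
  define y where "y = (s - \<iota> (residue a s)) / t"
  have yL: "y \<in> localization A0 a"
    using residue[OF a gen_in[OF s(1)]] d.P_iff[OF diff_in[OF gen_in[OF s(1)] scalar_in], of "residue a s"]
      d.div[of "s - \<iota> (residue a s)" t] t
    by (cases "s - \<iota> (residue a s) = 0") (auto simp: d.loc_iff y_def)
  have "t * y = s - \<iota> (residue a s)" using t by (simp add: y_def)
  then have "D (t * y) = D s" by (simp add: D.diff)
  then have Ds: "D s = t * D y + y * D t" by (simp add: D.mult)
  have 1: "d.ge (\<mu> + 1) (t * D y)" using d.ge_mult[of 1 t \<mu> "D y"] muL[OF yL] t by (simp add: d.ge_def add.commute)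
  have n: "\<not> d.ge (\<mu> + 1) (D t)"
  proof
    assume "d.ge (\<mu> + 1) (D t)"
    then have "d.ge (\<mu> + 1) (y * D t)" using d.ge_mult[of 0 y "\<mu> + 1" "D t"] yL d.ge_loc by simp
    then have "d.ge (\<mu> + 1) (D s)" unfolding Ds using 1 by (rule d.ge_add[rotated])
    then show False using s by (simp add: d.ge_def)
  qed
  then show "D t \<noteq> 0" by auto
  show "D f / D t \<in> localization A0 a" if "f \<in> localization A0 a"
    using muL[OF that] n d.div[of "D f" "D t"] by (cases "D f = 0") (auto simp: d.ge_def d.loc_iff)
qed

text \<open>The combination of D and E that kills a uniformizer is a derivation, hence zero by
  \<open>derivation_uniformizer\<close>.\<close>

lemma derivations_proportional:
  assumes D: "derivation \<iota> D" and E: "derivation \<iota> E"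
  shows "D x * E y = D y * E x"
proof -
  obtain a where a: "a \<in> closed_points A0" using ex_closed_point by blast
  interpret d: dvr A0 a "ord_at A0 a" by (rule dvr_ord[OF a])
  obtain t where t: "t \<noteq> 0" "ord_at A0 a t = 1" by (rule d.uniformizer)
  define F where "F z = E t * D z + (- D t) * E z" for z
  have F: "derivation \<iota> F" unfolding F_def by (rule derivation_lincomb[OF D E])
  have "F t = 0" by (simp add: F_def mult.commute)
  then have "F z = 0" for z using derivation_uniformizer(1)[OF F _ a t] by blast
  then have "E t * D z - D t * E z = 0" for z by (simp add: F_def)
  then have *: "E t * D z = D t * E z" for z by (simp only: right_minus_eq)
  show ?thesis
  proof (cases "\<exists>z. D z \<noteq> 0")
    case False
    then show ?thesis by simp
  next
    case True
    then have "D t \<noteq> 0" using derivation_uniformizer(1)[OF D _ a t] by blast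
    have "D t * (D x * E y) = D x * (D t * E y)" by (simp only: mult_ac)
    also have "\<dots> = (E t * D x) * D y" unfolding *[of y, symmetric] by (simp only: mult_ac)
    also have "\<dots> = D t * (D y * E x)" unfolding *[of x] by (simp only: mult_ac)
    finally show ?thesis using \<open>D t \<noteq> 0\<close> by simp
  qed
qed

end

section \<open>Laurent polynomials over the function field\<close>

lemma emb_0 [simp]: "emb 0 = 0" and emb_1 [simp]: "emb 1 = 1"
  by (simp_all add: emb_def flip: one_pCons)

lemma emb_add: "emb (x + y) = emb x + emb y" and emb_uminus: "emb (- x) = - emb x"
  and emb_diff: "emb (x - y) = emb x - emb y" and emb_mult: "emb (x * y) = emb x * emb y"
  by (simp_all add: emb_def flip: to_fract_add to_fract_uminus to_fract_diff to_fract_mult)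

lemma emb_eq_iff [simp]: "emb x = emb y \<longleftrightarrow> x = y"
  by (simp add: emb_def)

lemma emb_eq_0 [simp]: "emb x = 0 \<longleftrightarrow> x = 0"
  using emb_eq_iff[of x 0] by simp

lemma emb_divide: "emb (x / y) = emb x / emb y"
proof (cases "y = 0")
  case False
  have "emb (x / y) * emb y = emb x" using False by (simp flip: emb_mult)
  then show ?thesis using False by (simp add: field_simps)
qed simp

lemma emb_power: "emb (x ^ n) = emb x ^ n"
  by (induction n) (auto simp: emb_mult)

lemma emb_inverse: "emb (inverse x) = inverse (emb x)"
  using emb_divide[of 1 x] by (simp add: inverse_eq_divide)

lemma emb_powi: "emb (x powi n) = emb x powi n"
  by (auto simp: power_int_def emb_power emb_inverse)

lemma emb_sum: "emb (sum f I) = (\<Sum>i\<in>I. emb (f i))"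
  by (induction I rule: infinite_finite_induct) (auto simp: emb_add)

lemma u_nonzero [simp]: "u \<noteq> 0"
  by (simp add: u_def)

definition mon :: "'k::field \<Rightarrow> int \<Rightarrow> 'k poly fract" where
  "mon c n = emb c * u powi n"

lemma mon_0 [simp]: "mon 0 n = 0"
  by (simp add: mon_def)

lemma mon_eq_0 [simp]: "mon c n = 0 \<longleftrightarrow> c = 0"
  by (simp add: mon_def)

lemma mon_degree_0: "mon c 0 = emb c"
  by (simp add: mon_def)

lemma mon_add: "mon (c + c') n = mon c n + mon c' n" and mon_uminus: "mon (- c) n = - mon c n"
  and mon_diff: "mon (c - c') n = mon c n - mon c' n"
  by (simp_all add: mon_def emb_add emb_uminus emb_diff algebra_simps)

lemma mon_mult: "mon c n * mon c' n' = mon (c * c') (n + n')"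
  by (simp add: mon_def emb_mult power_int_add)

lemma emb_mult_mon: "emb c * mon c' n = mon (c * c') n"
  by (simp add: mon_def emb_mult)

lemma mon_power: "mon c n ^ k = mon (c ^ k) (int k * n)"
  by (induction k) (auto simp: mon_mult mon_degree_0 algebra_simps)

lemma laurent_eq_sum:
  assumes "finite N" "\<And>n. c n \<noteq> 0 \<Longrightarrow> n \<in> N"
  shows "laurent c = (\<Sum>n\<in>N. mon (c n) n)"
  unfolding laurent_def mon_def using assms by (intro sum.mono_neutral_left) auto

lemma laurent_add:
  assumes "finite {n. c n \<noteq> 0}" "finite {n. c' n \<noteq> 0}"
  shows "laurent (\<lambda>n. c n + c' n) = laurent c + laurent c'" "finite {n. c n + c' n \<noteq> 0}"
proof -
  let ?N = "{n. c n \<noteq> 0} \<union> {n. c' n \<noteq> 0}"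
  have N: "finite ?N" using assms by simp
  show "finite {n. c n + c' n \<noteq> 0}" using N by (rule rev_finite_subset) auto
  have "laurent (\<lambda>n. c n + c' n) = (\<Sum>n\<in>?N. mon (c n + c' n) n)" "laurent c = (\<Sum>n\<in>?N. mon (c n) n)"
    "laurent c' = (\<Sum>n\<in>?N. mon (c' n) n)"
    by (rule laurent_eq_sum[OF N]; auto)+
  then show "laurent (\<lambda>n. c n + c' n) = laurent c + laurent c'" by (simp add: mon_add sum.distrib)
qed

lemma laurent_uminus: "laurent (\<lambda>n. - c n) = - laurent c"
  by (simp add: laurent_def emb_uminus sum_negf)

lemma laurent_scale:
  assumes "finite {n. c n \<noteq> 0}"
  shows "laurent (\<lambda>n. a n * c n) = (\<Sum>n | c n \<noteq> 0. mon (a n * c n) n)"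
  by (rule laurent_eq_sum[OF assms]) auto

lemma laurent_single: "laurent (\<lambda>k. if k = n then c else 0) = mon c n"
  by (subst laurent_eq_sum[of "{n}"]) (auto split: if_splits)

lemma finite_single: "finite {k. (if k = n then c else (0::'a::zero)) \<noteq> 0}"
  by (rule finite_subset[of _ "{n}"]) (auto split: if_splits)

lemma to_fract_power: "to_fract (p ^ n) = to_fract p ^ n"
  by (induction n) auto

lemma to_fract_monom: "to_fract (Polynomial.monom c i) = mon c (int i)"
proof -
  have "Polynomial.monom c i = [:c:] * [:0, 1:] ^ i"
    by (simp add: monom_altdef)
  then show ?thesis by (simp only: to_fract_mult to_fract_power mon_def emb_def u_def power_int_of_nat)
qed

lemma to_fract_eq_sum: "to_fract p = (\<Sum>i\<le>degree p. mon (Polynomial.coeff p i) (int i))"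
proof -
  have "to_fract p = to_fract (\<Sum>i\<le>degree p. Polynomial.monom (Polynomial.coeff p i) i)"
    by (simp only: poly_as_sum_of_monoms)
  then show ?thesis by (simp add: to_fract_monom)
qed

lemma to_fract_laurent:
  obtains c where "finite {n. c n \<noteq> 0}" "to_fract p = laurent c"
proof
  define c where "c n = (if n \<ge> 0 then Polynomial.coeff p (nat n) else 0)" for n
  have sub: "n \<in> int ` {..degree p}" if "c n \<noteq> 0" for n
    using that le_degree[of p "nat n"] by (auto simp: c_def image_iff split: if_splits intro!: bexI[of _ "nat n"])
  then show "finite {n. c n \<noteq> 0}" by (intro finite_subset[OF _ finite_imageI[OF finite_atMost]]) auto
  have "laurent c = (\<Sum>n\<in>int ` {..degree p}. mon (c n) n)" by (rule laurent_eq_sum) (use sub in auto)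
  also have "\<dots> = to_fract p" unfolding to_fract_eq_sum by (subst sum.reindex) (auto simp: c_def)
  finally show "to_fract p = laurent c" by simp
qed

lemma laurent_poly:
  assumes fin: "finite {n. c n \<noteq> 0}"
  obtains N P where "laurent c = u powi (- int N) * to_fract P"
    "\<And>i. Polynomial.coeff P i = c (int i - int N)" "\<And>n. c n \<noteq> 0 \<Longrightarrow> - int N \<le> n"
proof -
  obtain b where b: "\<And>n. c n \<noteq> 0 \<Longrightarrow> \<bar>n\<bar> \<le> b"
  proof (cases "{n. c n \<noteq> 0} = {}")
    case False
    then show ?thesis using fin by (intro that[of "Max (abs ` {n. c n \<noteq> 0})"]) auto
  qed (use that in auto)
  define N where "N = nat b"
  have N: "- int N \<le> n" if "c n \<noteq> 0" for n using b[OF that] by (auto simp: N_def)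
  define P where "P = (\<Sum>n | c n \<noteq> 0. Polynomial.monom (c n) (nat (n + int N)))"
  have "u powi (- int N) * to_fract P = (\<Sum>n | c n \<noteq> 0. u powi (- int N) * mon (c n) (n + int N))"
    unfolding P_def to_fract_sum sum_distrib_left
  proof (intro sum.cong refl)
    fix n assume "n \<in> {n. c n \<noteq> 0}"
    then have "0 \<le> n + int N" using N[of n] by simp
    then show "u powi (- int N) * to_fract (Polynomial.monom (c n) (nat (n + int N))) = u powi (- int N) * mon (c n) (n + int N)"
      by (simp add: to_fract_monom)
  qed
  also have "\<dots> = (\<Sum>n | c n \<noteq> 0. mon (c n) n)"
    by (intro sum.cong) (auto simp: mon_def power_int_add power_int_minus)
  also have "\<dots> = laurent c" by (simp add: laurent_def mon_def)
  finally have 1: "laurent c = u powi (- int N) * to_fract P" by simp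
  have "Polynomial.coeff P i = c (int i - int N)" for i
  proof -
    have "Polynomial.coeff P i = (\<Sum>n | c n \<noteq> 0. if n = int i - int N then c n else 0)"
      unfolding P_def coeff_sum
    proof (intro sum.cong refl)
      fix n assume "n \<in> {n. c n \<noteq> 0}"
      then have "0 \<le> n + int N" using N[of n] by simp
      then have "nat (n + int N) = i \<longleftrightarrow> n = int i - int N" by auto
      then show "Polynomial.coeff (Polynomial.monom (c n) (nat (n + int N))) i = (if n = int i - int N then c n else 0)"
        by simp
    qed
    then show ?thesis using fin by simp
  qed
  then show ?thesis using that 1 N by blast
qed

lemma laurent_eq_0:
  assumes "finite {n. c n \<noteq> 0}" "laurent c = 0"
  shows "c n = 0"
proof (rule ccontr)
  assume n: "c n \<noteq> 0"
  obtain N P where P: "laurent c = u powi (- int N) * to_fract P"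
    "\<And>i. Polynomial.coeff P i = c (int i - int N)" "\<And>n. c n \<noteq> 0 \<Longrightarrow> - int N \<le> n"
    using laurent_poly[OF assms(1)] by metis
  have "P = 0" using P(1) assms(2) by simp
  then have "c (int (nat (n + int N)) - int N) = 0" using P(2)[of "nat (n + int N)"] by simp
  then show False using n P(3)[OF n] by simp
qed

lemma laurent_inj:
  assumes "finite {n. c n \<noteq> 0}" "finite {n. c' n \<noteq> 0}" "laurent c = laurent c'"
  shows "c = c'"
proof
  fix n
  have f: "finite {n. - c' n \<noteq> 0}" using assms(2) by simp
  have "laurent (\<lambda>n. c n + - c' n) = 0" using laurent_add(1)[OF assms(1) f] assms(3) by (simp add: laurent_uminus)
  then have "c n + - c' n = 0" using laurent_eq_0[OF laurent_add(2)[OF assms(1) f]] by blast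
  then show "c n = c' n" by simp
qed

context gauss begin

abbreviation W :: "'k poly fract \<Rightarrow> int" where
  "W \<equiv> fract_val (gauss_val v m e)"

lemma W_emb: "c \<noteq> 0 \<Longrightarrow> W (emb c) = m * v c"
  using P.fract_val_to_fract[of "[:c:]"] gauss_monom[of c 0] by (simp add: emb_def monom_0)

lemma W_u: "W u = - e"
  using P.fract_val_to_fract[of "[:0, 1:]"] gauss_monom[of 1 1] by (simp add: u_def monom_altdef)

lemma W_mon: "c \<noteq> 0 \<Longrightarrow> W (mon c n) = m * v c - e * n"
  by (simp add: mon_def P.fract.mult P.fract.powi W_emb W_u)

text \<open>Terms of different degrees cannot cancel in value. Multiplication by a power of u
  reduces this to the coefficientwise definition for polynomials and shifts all values by the same
  amount.\<close>

lemma W_laurent_ge: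
  assumes fin: "finite {n. c n \<noteq> 0}" and nz: "laurent c \<noteq> 0"
  shows "N \<le> W (laurent c) \<longleftrightarrow> (\<forall>n. c n \<noteq> 0 \<longrightarrow> N \<le> W (mon (c n) n))"
proof -
  obtain B P where P: "laurent c = u powi (- int B) * to_fract P"
    "\<And>i. Polynomial.coeff P i = c (int i - int B)" "\<And>n. c n \<noteq> 0 \<Longrightarrow> - int B \<le> n"
    using laurent_poly[OF fin] by metis
  have P0: "P \<noteq> 0" using P(1) nz by auto
  have "W (laurent c) = int B * e + gauss_val v m e P"
    unfolding P(1) using P0 by (simp add: P.fract.mult P.fract.powi W_u P.fract_val_to_fract)
  then have "N \<le> W (laurent c) \<longleftrightarrow> N - int B * e \<le> gauss_val v m e P" by auto
  also have "\<dots> \<longleftrightarrow> (\<forall>i. wge (N - int B * e) i (c (int i - int B)))"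
    unfolding gauss_ge_iff[OF P0] P(2) by simp
  also have "\<dots> \<longleftrightarrow> (\<forall>n. c n \<noteq> 0 \<longrightarrow> N \<le> W (mon (c n) n))"
  proof (intro iffI allI impI)
    fix n assume *: "\<forall>i. wge (N - int B * e) i (c (int i - int B))" and n: "c n \<noteq> 0"
    have "wge (N - int B * e) (nat (n + int B)) (c n)"
      using *[rule_format, of "nat (n + int B)"] P(3)[OF n] by simp
    then show "N \<le> W (mon (c n) n)" using n P(3)[OF n] by (simp add: wge_def W_mon algebra_simps)
  next
    fix i assume *: "\<forall>n. c n \<noteq> 0 \<longrightarrow> N \<le> W (mon (c n) n)"
    then show "wge (N - int B * e) i (c (int i - int B))"
      using W_mon[of "c (int i - int B)" "int i - int B"] *[rule_format, of "int i - int B"]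
      by (cases "c (int i - int B) = 0") (auto simp: wge_def algebra_simps)
  qed
  finally show ?thesis .
qed

end

section \<open>Derivations of the field of rational functions\<close>

lemma coefficient_derivation:
  assumes "derivation \<iota> (d :: 'k::field \<Rightarrow> 'k)"
  obtains D where "derivation (emb \<circ> \<iota>) D" "\<And>x. D (emb x) = emb (d x)" "D u = 0"
proof -
  interpret d: deriv \<iota> d using assms by unfold_locales
  have add: "map_poly d (p + q) = map_poly d p + map_poly d q" for p q
    by (rule poly_eqI) (simp add: coeff_map_poly d.add)
  have mult: "map_poly d (p * q) = p * map_poly d q + q * map_poly d p" for p q
  proof (rule poly_eqI)
    fix n
    have "Polynomial.coeff (q * map_poly d p) n = Polynomial.coeff (map_poly d p * q) n" by (simp only: mult.commute)
    also have "\<dots> = (\<Sum>i\<le>n. Polynomial.coeff q (n - i) * d (Polynomial.coeff p i))"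
      unfolding coeff_mult by (intro sum.cong refl) (simp add: coeff_map_poly mult.commute)
    finally show "Polynomial.coeff (map_poly d (p * q)) n = Polynomial.coeff (p * map_poly d q + q * map_poly d p) n"
      unfolding coeff_add by (simp add: coeff_map_poly coeff_mult d.sum d.mult sum.distrib)
  qed
  obtain D where D: "\<And>x y. D (x + y) = D x + D y" "\<And>x y. D (x * y) = x * D y + y * D x"
    "\<And>p. D (to_fract p) = to_fract (map_poly d p)"
  proof (rule fract_derivation_extend[of "\<lambda>p. to_fract (map_poly d p)"])
    show "to_fract (map_poly d (p + q)) = to_fract (map_poly d p) + to_fract (map_poly d q)" for p q
      by (simp only: add to_fract_add)
    show "to_fract (map_poly d (p * q)) = to_fract p * to_fract (map_poly d q) + to_fract q * to_fract (map_poly d p)" for p q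
      by (simp only: mult to_fract_add to_fract_mult)
  qed blast
  have e: "D (emb x) = emb (d x)" for x by (simp add: emb_def D map_poly_pCons)
  show ?thesis
  proof (rule that[of D])
    show "derivation (emb \<circ> \<iota>) D" using D e by (auto simp: derivation_def)
    show "D u = 0" by (simp add: u_def D map_poly_pCons)
  qed (rule e)
qed

text \<open>The partial derivative in u. Together with the coefficientwise extension of a derivation
  of K it gives a pair of derivations on which the 2-forms considered do not vanish.\<close>

lemma u_derivation:
  obtains D where "derivation (emb \<circ> \<iota>) D" "\<And>x. D (emb x) = 0" "D u = 1"
proof -
  obtain D :: "'a poly fract \<Rightarrow> 'a poly fract" where D: "\<And>x y. D (x + y) = D x + D y" "\<And>x y. D (x * y) = x * D y + y * D x"
    "\<And>p. D (to_fract p) = to_fract (pderiv p)"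
  proof (rule fract_derivation_extend[of "\<lambda>p. to_fract (pderiv p)"])
    show "to_fract (pderiv (p + q)) = to_fract (pderiv p) + to_fract (pderiv q)" for p q :: "'a poly"
      by (simp only: pderiv_add to_fract_add)
    show "to_fract (pderiv (p * q)) = to_fract p * to_fract (pderiv q) + to_fract q * to_fract (pderiv p)" for p q :: "'a poly"
      by (simp only: pderiv_mult to_fract_add to_fract_mult)
  qed blast
  have e: "D (emb x) = 0" for x by (simp add: emb_def D)
  show ?thesis
  proof (rule that[of D])
    show "derivation (emb \<circ> \<iota>) D" using D e by (auto simp: derivation_def)
    show "D u = 1" by (simp add: u_def D pderiv_pCons flip: one_pCons)
  qed (rule e)
qed

text \<open>A linear functional turns a derivation with values in K(u) into one with values in K.\<close>

lemma (in curve) derivations_proportional_emb: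
  assumes D: "derivation \<iota> D" and E: "derivation (emb \<circ> \<iota>) E"
  shows "emb (D x) * E (emb y) = emb (D y) * E (emb x)"
proof (rule ccontr)
  define Y where "Y = emb (D x) * E (emb y) - emb (D y) * E (emb x)"
  assume "\<not> ?thesis"
  then have Y: "Y \<noteq> 0" by (simp add: Y_def)
  interpret E: deriv "emb \<circ> \<iota>" E using E by unfold_locales
  interpret vp: vector_space_pair "\<lambda>(c::'k) x. emb c * x" "\<lambda>(c::'k) x. c * x"
    by unfold_locales (auto simp: emb_add emb_mult algebra_simps)
  \<comment> \<open>A K-linear functional \<open>g\<close> with \<open>g Y = 1\<close> keeps the
    assumed discrepancy \<open>Y\<close> alive after composing E with it.\<close>
  have "vp.vs1.independent {Y}" using Y by simp
  then obtain g where g: "Vector_Spaces.linear (\<lambda>c x. emb c * x) (\<lambda>c x. c * x) g" "g Y = (1::'k)"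
    using vp.linear_independent_extend[of "{Y}" "\<lambda>_. 1"] by blast
  interpret g: Vector_Spaces.linear "\<lambda>(c::'k) x. emb c * x" "\<lambda>c x. c * x" g by (rule g(1))
  have dF: "derivation \<iota> (\<lambda>z. g (E (emb z)))"
    unfolding derivation_def
  proof (intro conjI allI)
    fix x y z
    show "g (E (emb (x + y))) = g (E (emb x)) + g (E (emb y))" by (simp add: emb_add E.add g.add)
    show "g (E (emb (x * y))) = x * g (E (emb y)) + y * g (E (emb x))"
      by (simp add: emb_mult E.mult g.add g.scale)
    show "g (E (emb (\<iota> z))) = 0" using E.scalar[of z] by simp
  qed
  have "g Y = D x * g (E (emb y)) - D y * g (E (emb x))"
    by (simp add: Y_def g.diff g.scale)
  then show False using derivations_proportional[OF D dF, of x y] g(2) by simp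
qed

section \<open>The graded algebra\<close>

text \<open>The pair \<open>D0\<close>, \<open>x0\<close> witnesses that d x0 is nonzero, so it is a
  basis of the rational 1-forms on the curve. It will be read off from the nonzero form behind
  \<open>KC\<close>.\<close>

locale dpd = curve \<iota> A0 S for \<iota> :: "complex \<Rightarrow> 'k::field" and A0 :: "'k set" and S +
  fixes Dp Dm :: "'k set \<Rightarrow> rat" and D0 :: "'k \<Rightarrow> 'k" and x0 :: 'k
  assumes Dp: "Q_divisor A0 Dp" and Dm: "Q_divisor A0 Dm"
    and Dp_Dm: "Dp a + Dm a \<le> 0"
    and D0: "derivation \<iota> D0" and x0: "D0 x0 \<noteq> 0"
begin

abbreviation A :: "'k poly fract set" where
  "A \<equiv> dpd_algebra A0 Dp Dm"

abbreviation ord :: "'k set \<Rightarrow> 'k \<Rightarrow> int" where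
  "ord \<equiv> ord_at A0"

text \<open>As D_+ + D_- is nonpositive, the condition with D_+ implies the one with D_- for n >= 0,
  and conversely for n < 0. Imposing both in every degree gives inequalities linear in n, so
  products need no distinction of signs.\<close>

lemma piece_iff:
  "f \<in> piece A0 Dp Dm n \<longleftrightarrow> f = 0 \<or> (\<forall>a\<in>closed_points A0.
     0 \<le> of_int (ord a f) + of_int n * Dp a \<and> 0 \<le> of_int (ord a f) - of_int n * Dm a)"
proof -
  have fl: "0 \<le> z + \<lfloor>r\<rfloor> \<longleftrightarrow> 0 \<le> of_int z + r" for z :: int and r :: rat
    using le_floor_iff[of "- z" r] by (auto simp: algebra_simps)
  have "0 \<le> ord a f + (if n \<ge> 0 then \<lfloor>of_int n * Dp a\<rfloor> else \<lfloor>of_int (- n) * Dm a\<rfloor>) \<longleftrightarrow>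
     0 \<le> of_int (ord a f) + of_int n * Dp a \<and> 0 \<le> of_int (ord a f) - of_int n * Dm a" for a
  proof (cases "n \<ge> 0")
    case True
    have "of_int n * (Dp a + Dm a) \<le> 0" using True Dp_Dm[of a] by (simp add: mult_nonneg_nonpos)
    then have "of_int n * Dm a \<le> - (of_int n * Dp a)" by (simp add: algebra_simps)
    then show ?thesis using True fl by auto
  next
    case False
    have "0 \<le> of_int n * (Dp a + Dm a)" using False Dp_Dm[of a] by (simp add: mult_nonpos_nonpos)
    then have "- (of_int n * Dm a) \<le> of_int n * Dp a" by (simp add: algebra_simps)
    then show ?thesis using False fl[of "ord a f" "of_int (- n) * Dm a"] by auto
  qed
  then show ?thesis by (auto simp: piece_def rr_space_def prime_divisors_eq)
qed

lemma piece_0 [simp]: "0 \<in> piece A0 Dp Dm n"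
  by (simp add: piece_iff)

lemma piece_degree_0: "piece A0 Dp Dm 0 = A0"
  by (auto simp: piece_iff A0_iff)

lemma piece_uminus: "f \<in> piece A0 Dp Dm n \<Longrightarrow> - f \<in> piece A0 Dp Dm n"
proof -
  have "ord a (- f) = ord a f" if "a \<in> closed_points A0" for a
  proof -
    interpret d: dvr A0 a "ord_at A0 a" by (rule dvr_ord[OF that])
    show ?thesis by (rule d.uminus)
  qed
  then show "f \<in> piece A0 Dp Dm n \<Longrightarrow> - f \<in> piece A0 Dp Dm n" by (simp add: piece_iff)
qed

lemma piece_add:
  assumes f: "f \<in> piece A0 Dp Dm n" and g: "g \<in> piece A0 Dp Dm n"
  shows "f + g \<in> piece A0 Dp Dm n"
proof (cases "f = 0 \<or> g = 0 \<or> f + g = 0")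
  case False
  have "min (ord a f) (ord a g) \<le> ord a (f + g)" if "a \<in> closed_points A0" for a
    using dvr.add_ge[OF dvr_ord[OF that]] False by blast
  then have "ord a f \<le> ord a (f + g) \<or> ord a g \<le> ord a (f + g)" if "a \<in> closed_points A0" for a
    using that by (force simp: min_def split: if_splits)
  then have "of_int (ord a f) \<le> (of_int (ord a (f + g)) :: rat) \<or> of_int (ord a g) \<le> (of_int (ord a (f + g)) :: rat)"
    if "a \<in> closed_points A0" for a using that by simp
  then show ?thesis using f g False unfolding piece_iff by fastforce
qed (use assms in auto)

lemma piece_mult:
  assumes f: "f \<in> piece A0 Dp Dm n" and g: "g \<in> piece A0 Dp Dm n'"
  shows "f * g \<in> piece A0 Dp Dm (n + n')"
proof (cases "f = 0 \<or> g = 0")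
  case False
  have ord_fg: "of_int (ord a (f * g)) = (of_int (ord a f) + of_int (ord a g) :: rat)" if "a \<in> closed_points A0" for a
  proof -
    interpret d: dvr A0 a "ord_at A0 a" by (rule dvr_ord[OF that])
    show ?thesis using d.mult[of f g] False by simp
  qed
  have "0 \<le> of_int (ord a (f * g)) + of_int (n + n') * Dp a \<and> 0 \<le> of_int (ord a (f * g)) - of_int (n + n') * Dm a"
    if a: "a \<in> closed_points A0" for a
  proof -
    have 1: "0 \<le> of_int (ord a f) + of_int n * Dp a" "0 \<le> of_int (ord a f) - of_int n * Dm a"
      "0 \<le> of_int (ord a g) + of_int n' * Dp a" "0 \<le> of_int (ord a g) - of_int n' * Dm a"
      using f g False a unfolding piece_iff by blast+
    have 2: "of_int (n + n') * Dp a = of_int n * Dp a + of_int n' * Dp a"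
      "of_int (n + n') * Dm a = of_int n * Dm a + of_int n' * Dm a" by (simp_all add: distrib_right)
    show ?thesis unfolding 2 using 1 ord_fg[OF a] by linarith
  qed
  then show ?thesis unfolding piece_iff by blast
qed auto

lemma A_cases:
  assumes "x \<in> A"
  obtains c where "finite {n. c n \<noteq> 0}" "\<And>n. c n \<in> piece A0 Dp Dm n" "x = laurent c"
  using assms unfolding dpd_algebra_def by blast

lemma laurent_in_A: "finite {n. c n \<noteq> 0} \<Longrightarrow> (\<And>n. c n \<in> piece A0 Dp Dm n) \<Longrightarrow> laurent c \<in> A"
  unfolding dpd_algebra_def by blast

lemma mon_in_A: "c \<in> piece A0 Dp Dm n \<Longrightarrow> mon c n \<in> A"
  unfolding laurent_single[symmetric] by (rule laurent_in_A[OF finite_single]) auto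

lemma laurent_in_A_iff:
  assumes "finite {n. c n \<noteq> 0}"
  shows "laurent c \<in> A \<longleftrightarrow> (\<forall>n. c n \<in> piece A0 Dp Dm n)"
  using laurent_inj[OF assms] laurent_in_A[OF assms] A_cases by metis

lemma mon_in_A_iff: "mon c n \<in> A \<longleftrightarrow> c \<in> piece A0 Dp Dm n"
  using mon_in_A laurent_in_A_iff[OF finite_single, of n c] unfolding laurent_single by metis

lemma emb_in_A_iff: "emb c \<in> A \<longleftrightarrow> c \<in> A0"
  using mon_in_A_iff[of c 0] by (simp add: piece_degree_0 mon_degree_0)

lemma A_add: "x \<in> A \<Longrightarrow> y \<in> A \<Longrightarrow> x + y \<in> A"
proof -
  assume "x \<in> A" "y \<in> A"
  then obtain c c' where c: "finite {n. c n \<noteq> 0}" "\<And>n. c n \<in> piece A0 Dp Dm n" "x = laurent c"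
    "finite {n. c' n \<noteq> 0}" "\<And>n. c' n \<in> piece A0 Dp Dm n" "y = laurent c'" by (metis A_cases)
  then show "x + y \<in> A"
    using laurent_in_A[OF laurent_add(2)[OF c(1,4)]] piece_add laurent_add(1)[OF c(1,4)] by simp
qed

lemma A_sum: "(\<And>i. i \<in> I \<Longrightarrow> f i \<in> A) \<Longrightarrow> sum f I \<in> A"
  using mon_in_A[OF piece_0, of 0] by (induction I rule: infinite_finite_induct) (auto intro: A_add)

sublocale A: field_subring A
proof
  show "1 \<in> A" using emb_in_A_iff[of 1] by simp
  show "x + y \<in> A" if "x \<in> A" "y \<in> A" for x y using A_add that .
next
  fix x assume "x \<in> A"
  then obtain c where c: "finite {n. c n \<noteq> 0}" "\<And>n. c n \<in> piece A0 Dp Dm n" "x = laurent c" by (metis A_cases)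
  then show "- x \<in> A" using laurent_in_A[of "\<lambda>n. - c n"] piece_uminus by (simp add: laurent_uminus)
next
  fix x y assume "x \<in> A" "y \<in> A"
  then obtain c c' where c: "finite {n. c n \<noteq> 0}" "\<And>n. c n \<in> piece A0 Dp Dm n" "x = laurent c"
    "finite {n. c' n \<noteq> 0}" "\<And>n. c' n \<in> piece A0 Dp Dm n" "y = laurent c'" by (metis A_cases)
  have "x * y = (\<Sum>n | c n \<noteq> 0. \<Sum>n' | c' n' \<noteq> 0. mon (c n * c' n') (n + n'))"
    by (simp add: c(3,6) laurent_def sum_product flip: mon_def) (simp add: mon_mult)
  then show "x * y \<in> A" using c piece_mult by (auto intro!: A_sum mon_in_A)
qed

lemma prime_proj:
  assumes "primeideal P (ring_on A)"
  shows "primeideal (proj A0 P) (ring_on A0)"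
proof -
  note PD = A.primeD[OF assms]
  show ?thesis
    unfolding primeideal_ring_on_iff field_ideal_def proj_def
    using PD(2,3,5,6,7) by (auto simp: emb_add emb_mult emb_in_A_iff)
qed

text \<open>Combining the translates by 2z and z removes one chosen component \<open>n0\<close> and
  scales every other one by a nonzero number. Induction on the number of components isolates all
  components but n, and subtracting them from the sum isolates that of degree n.\<close>

lemma torus_core:
  assumes M: "field_ideal A M" and fin: "finite {n. c n \<noteq> 0}"
    and all: "\<And>z. z \<noteq> 0 \<Longrightarrow> laurent (\<lambda>n. \<iota> z powi n * c n) \<in> M"
  shows "mon (c n) n \<in> M"
  using fin all
proof (induction "card {n. c n \<noteq> 0}" arbitrary: c n rule: less_induct)
  case less
  note MD = field_idealD[OF M]
  have scal: "emb (\<iota> z) * x \<in> M" if "x \<in> M" for x z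
    using MD(4)[of "emb (\<iota> z)" x] that by (simp add: emb_in_A_iff)
  have other: "mon (c k) k \<in> M" if k: "c n0 \<noteq> 0" "k \<noteq> n0" for k n0
  proof -
    \<comment> \<open>The number 2 serves because its integer powers are distinct, which is seen
      from their norms.\<close>
    define b where "b k = (2::complex) powi k - 2 powi n0" for k
    have b0: "b k = 0 \<longleftrightarrow> k = n0" for k
    proof
      assume "b k = 0"
      then have "(2::complex) powi k = 2 powi n0" by (simp add: b_def)
      then have "norm ((2::complex) powi k) = norm ((2::complex) powi n0)" by simp
      then have "(2::real) powi k = 2 powi n0" by (simp add: norm_power_int)
      then show "k = n0"
        using power_int_strict_increasing[of k n0 "2::real"] power_int_strict_increasing[of n0 k "2::real"]
        by (cases k n0 rule: linorder_cases) simp_all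
    qed (simp add: b_def)
    define c' where "c' k = \<iota> (b k) * c k" for k
    have supp: "{k. c' k \<noteq> 0} = {k. c k \<noteq> 0} - {n0}" using b0 by (auto simp: c'_def)
    have "card {k. c' k \<noteq> 0} < card {k. c k \<noteq> 0}"
      unfolding supp using less.prems(1) k(1) by (intro psubset_card_mono) auto
    moreover have fin': "finite {k. c' k \<noteq> 0}" unfolding supp using less.prems(1) by simp
    moreover have "laurent (\<lambda>k. \<iota> z powi k * c' k) \<in> M" if z: "z \<noteq> 0" for z
    proof -
      let ?N = "{k. c k \<noteq> 0}"
      have l: "laurent (\<lambda>n. f n * c n) = (\<Sum>n\<in>?N. mon (f n * c n) n)" for f
        by (rule laurent_scale[OF less.prems(1)])
      have "laurent (\<lambda>k. \<iota> z powi k * c' k) = laurent (\<lambda>k. (\<iota> z powi k * \<iota> (b k)) * c k)"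
        by (simp add: c'_def mult.assoc)
      also have "\<dots> = (\<Sum>n\<in>?N. mon (\<iota> (2 * z) powi n * c n) n) - emb (\<iota> (2 powi n0)) * (\<Sum>n\<in>?N. mon (\<iota> z powi n * c n) n)"
        unfolding l sum_distrib_left sum_subtractf[symmetric]
        by (intro sum.cong refl)
          (simp add: emb_mult_mon b_def \<iota>_diff \<iota>_mult \<iota>_powi power_int_mult_distrib algebra_simps flip: mon_diff)
      also have "\<dots> \<in> M"
        using less.prems(2)[of "2 * z"] less.prems(2)[of z] z scal unfolding l
        by (intro A.field_ideal_diff[OF M]) auto
      finally show ?thesis .
    qed
    ultimately have "mon (c' k) k \<in> M" using less.hyps[of c' k] by blast
    then have "emb (\<iota> (1 / b k)) * mon (c' k) k \<in> M" by (rule scal)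
    moreover have "emb (\<iota> (1 / b k)) * mon (c' k) k = mon (c k) k"
    proof -
      have "\<iota> (1 / b k) * \<iota> (b k) = 1" using b0[of k] k by (simp flip: \<iota>_mult)
      then show ?thesis by (simp add: emb_mult_mon c'_def flip: mult.assoc)
    qed
    ultimately show ?thesis by simp
  qed
  show ?case
  proof (cases "c n = 0")
    case True
    then show ?thesis using MD(2) by simp
  next
    case False
    have "laurent c = mon (c n) n + (\<Sum>k\<in>{k. c k \<noteq> 0} - {n}. mon (c k) k)"
      unfolding laurent_def mon_def[symmetric] using less.prems(1) False by (subst sum.remove[of _ n]) auto
    moreover have "laurent c \<in> M" using less.prems(2)[of 1] by simp
    moreover have "(\<Sum>k\<in>{k. c k \<noteq> 0} - {n}. mon (c k) k) \<in> M"
      using other[OF False] by (intro A.field_ideal_sum[OF M]) auto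
    ultimately show ?thesis using A.field_ideal_diff[OF M] by (metis add_diff_cancel_right')
  qed
qed

section \<open>The torus action on ideals of A\<close>

definition twist :: "complex \<Rightarrow> (int \<Rightarrow> 'k) \<Rightarrow> int \<Rightarrow> 'k" where
  "twist z c = (\<lambda>n. \<iota> z powi n * c n)"

lemma twist_twist: "z \<noteq> 0 \<Longrightarrow> twist z (twist (1 / z) c) = c"
proof -
  assume z: "z \<noteq> 0"
  have "\<iota> z powi n * \<iota> (1 / z) powi n = 1" for n
  proof -
    have "\<iota> z * \<iota> (1 / z) = 1" using z by (simp flip: \<iota>_mult)
    then show ?thesis by (metis power_int_mult_distrib power_int_1_left)
  qed
  then show ?thesis by (simp add: twist_def flip: mult.assoc)
qed

lemma finite_twist: "z \<noteq> 0 \<Longrightarrow> {n. twist z c n \<noteq> 0} = {n. c n \<noteq> 0}"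
  by (auto simp: twist_def)

lemma torus_act_iff:
  assumes z: "z \<noteq> 0" and fin: "finite {n. c n \<noteq> 0}"
  shows "laurent c \<in> torus_act \<iota> z M \<longleftrightarrow> laurent (twist (1 / z) c) \<in> M"
proof
  assume "laurent c \<in> torus_act \<iota> z M"
  then obtain c' where c': "laurent c = laurent (twist z c')" "finite {n. c' n \<noteq> 0}" "laurent c' \<in> M"
    unfolding torus_act_def twist_def by blast
  have "c = twist z c'" using laurent_inj[OF fin _ c'(1)] c'(2) z by (simp add: finite_twist)
  then have "twist (1 / z) c = c'" using twist_twist[of "1 / z" c'] z by simp
  then show "laurent (twist (1 / z) c) \<in> M" using c'(3) by simp
next
  assume *: "laurent (twist (1 / z) c) \<in> M"
  have "laurent c = laurent (\<lambda>n. \<iota> z powi n * twist (1 / z) c n)"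
    using twist_twist[OF z, of c] by (simp add: twist_def)
  moreover have "finite {n. twist (1 / z) c n \<noteq> 0}" using fin finite_twist[of "1 / z" c] z by simp
  ultimately show "laurent c \<in> torus_act \<iota> z M" unfolding torus_act_def using * by blast
qed

lemma torus_act_1: "M \<subseteq> A \<Longrightarrow> torus_act \<iota> 1 M = M"
proof -
  assume M: "M \<subseteq> A"
  have t1: "(\<lambda>n. \<iota> 1 powi n * c n) = c" for c by simp
  show ?thesis
  proof (rule equalityI; rule subsetI)
    fix x assume "x \<in> torus_act \<iota> 1 M"
    then show "x \<in> M" unfolding torus_act_def t1 by blast
  next
    fix x assume x: "x \<in> M"
    then obtain c where "finite {n. c n \<noteq> 0}" "x = laurent c" using M by (metis A_cases subsetD)
    then show "x \<in> torus_act \<iota> 1 M" unfolding torus_act_def t1 using x by blast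
  qed
qed

lemma torus_act_subset:
  assumes "z \<noteq> 0" "M \<subseteq> A"
  shows "torus_act \<iota> z M \<subseteq> A"
proof
  fix x assume "x \<in> torus_act \<iota> z M"
  then obtain c where c: "x = laurent (\<lambda>n. \<iota> z powi n * c n)" "finite {n. c n \<noteq> 0}" "laurent c \<in> M"
    unfolding torus_act_def by blast
  have "c n \<in> piece A0 Dp Dm n" for n using c assms(2) laurent_in_A_iff by blast
  moreover have "\<iota> z powi n \<in> A0" for n by (simp flip: \<iota>_powi)
  ultimately have "\<iota> z powi n * c n \<in> piece A0 Dp Dm n" for n
    using piece_mult[of "\<iota> z powi n" 0 "c n" n] by (simp add: piece_degree_0)
  moreover have "finite {n. \<iota> z powi n * c n \<noteq> 0}" using c(2) assms(1) by simp
  ultimately show "x \<in> A" unfolding c(1) by (intro laurent_in_A) auto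
qed

text \<open>Scaling degree n by z^n is multiplicative. The family \<open>e\<close> is the
  convolution of \<open>c\<close> and \<open>c'\<close>; the weight \<open>f\<close> in
  \<open>gen\<close> yields both product formulas at once.\<close>

lemma twist_mult:
  assumes "finite {n. c n \<noteq> 0}" "finite {n. c' n \<noteq> 0}" "z \<noteq> 0"
  obtains e where "finite {n. e n \<noteq> 0}" "laurent e = laurent c * laurent c'"
    "laurent (twist z e) = laurent (twist z c) * laurent (twist z c')"
proof -
  let ?N = "{n. c n \<noteq> 0}" and ?N' = "{n. c' n \<noteq> 0}"
  define e where "e k = (\<Sum>n\<in>?N. \<Sum>n'\<in>?N'. if n + n' = k then c n * c' n' else 0)" for k
  define K where "K = (\<lambda>(n, n'). n + n') ` (?N \<times> ?N')"
  have K: "finite K" using assms by (simp add: K_def)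
  have eK: "k \<in> K" if "e k \<noteq> 0" for k
  proof (rule ccontr)
    assume "k \<notin> K"
    then have "e k = 0" unfolding e_def by (intro sum.neutral ballI) (auto simp: K_def)
    then show False using that by simp
  qed
  have gen: "laurent (\<lambda>k. f k * e k) = (\<Sum>n\<in>?N. \<Sum>n'\<in>?N'. mon (f (n + n') * (c n * c' n')) (n + n'))" for f
  proof -
    have "laurent (\<lambda>k. f k * e k) = (\<Sum>k\<in>K. mon (f k * e k) k)"
      by (rule laurent_eq_sum[OF K]) (use eK in auto)
    also have "\<dots> = (\<Sum>k\<in>K. \<Sum>n\<in>?N. \<Sum>n'\<in>?N'. if n + n' = k then mon (f k * (c n * c' n')) k else 0)"
      unfolding e_def mon_def emb_mult emb_sum sum_distrib_left sum_distrib_right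
      by (intro sum.cong refl) (auto simp: emb_mult)
    also have "\<dots> = (\<Sum>n\<in>?N. \<Sum>n'\<in>?N'. \<Sum>k\<in>K. if n + n' = k then mon (f k * (c n * c' n')) k else 0)"
      by (subst sum.swap) (intro sum.cong refl sum.swap)
    also have "\<dots> = (\<Sum>n\<in>?N. \<Sum>n'\<in>?N'. mon (f (n + n') * (c n * c' n')) (n + n'))"
    proof (intro sum.cong refl)
      fix n n' assume "n \<in> ?N" "n' \<in> ?N'"
      then have "n + n' \<in> K" by (auto simp: K_def)
      then show "(\<Sum>k\<in>K. if n + n' = k then mon (f k * (c n * c' n')) k else 0) = mon (f (n + n') * (c n * c' n')) (n + n')"
        using K by simp
    qed
    finally show ?thesis .
  qed
  have fin: "finite {n. e n \<noteq> 0}" using K by (rule rev_finite_subset) (use eK in auto)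
  moreover have "laurent e = laurent c * laurent c'"
    using gen[of "\<lambda>_. 1"] by (simp add: laurent_def sum_product flip: mon_def) (simp add: mon_mult)
  moreover have "laurent (twist z e) = laurent (twist z c) * laurent (twist z c')"
  proof -
    have "\<iota> z \<noteq> 0" using assms by simp
    then have "laurent (twist z e) = (\<Sum>n\<in>?N. \<Sum>n'\<in>?N'. mon (twist z c n) n * mon (twist z c' n') n')"
      using gen[of "\<lambda>n. \<iota> z powi n"] by (simp add: twist_def mon_mult power_int_add mult_ac)
    then show ?thesis unfolding laurent_def mon_def[symmetric] sum_product finite_twist[OF assms(3)] .
  qed
  ultimately show ?thesis by (rule that)
qed

text \<open>The action is by automorphisms of A, so inverses modulo M are carried to inverses modulo
  the translate.\<close>

lemma torus_act_closed_point:
  assumes M: "M \<in> closed_points A" and z: "z \<noteq> 0"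
  shows "torus_act \<iota> z M \<in> closed_points A"
proof -
  note MD = A.primeD[OF A.closed_point_prime[OF M]]
  let ?w = "1 / z"
  have w: "?w \<noteq> 0" using z by simp
  have one: "laurent (\<lambda>k. if k = 0 then 1 else (0::'k)) = 1" by (simp add: laurent_single mon_degree_0)
  have tw_in: "laurent (twist y c) \<in> A" if "laurent c \<in> A" "finite {n. c n \<noteq> 0}" "y \<noteq> 0" for y c
  proof -
    have "laurent (twist y c) \<in> torus_act \<iota> y A" unfolding torus_act_def twist_def using that by blast
    then show ?thesis using torus_act_subset[OF that(3)] by blast
  qed
  show ?thesis
  proof (rule A.closed_pointI)
    show "1 \<notin> torus_act \<iota> z M"
    proof
      assume "1 \<in> torus_act \<iota> z M"
      then have "laurent (\<lambda>k. if k = 0 then 1 else 0) \<in> torus_act \<iota> z M" by (simp only: one)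
      then have "laurent (twist ?w (\<lambda>k. if k = 0 then 1 else 0)) \<in> M"
        using torus_act_iff[OF z finite_single, of 0 1 M] by blast
      moreover have "twist ?w (\<lambda>k. if k = 0 then 1 else 0) = (\<lambda>k. if k = 0 then 1 else 0)" by (auto simp: twist_def)
      ultimately show False using one MD(2) by (simp only: simp_thms)
    qed
    show "field_ideal A (torus_act \<iota> z M)"
      unfolding field_ideal_def
    proof (intro conjI ballI)
      show "torus_act \<iota> z M \<subseteq> A" using torus_act_subset[OF z MD(4)] .
      have "laurent (\<lambda>_. 0) \<in> torus_act \<iota> z M"
        using torus_act_iff[OF z, of "\<lambda>_. 0"] MD(5) by (simp add: twist_def laurent_def)
      then show "0 \<in> torus_act \<iota> z M" by (simp add: laurent_def)
    next
      fix x y assume xy: "x \<in> torus_act \<iota> z M" "y \<in> torus_act \<iota> z M"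
      have "x \<in> A" "y \<in> A" using xy torus_act_subset[OF z MD(4)] by auto
      then obtain c c' where c: "finite {n. c n \<noteq> 0}" "x = laurent c" "finite {n. c' n \<noteq> 0}" "y = laurent c'"
        by (metis A_cases)
      have "laurent (twist ?w c) \<in> M" "laurent (twist ?w c') \<in> M"
        using xy torus_act_iff[OF z c(1)] torus_act_iff[OF z c(3)] c(2,4) by auto
      then have "laurent (twist ?w c) + laurent (twist ?w c') \<in> M" using MD(6) by blast
      moreover have "laurent (twist ?w c) + laurent (twist ?w c') = laurent (\<lambda>n. twist ?w c n + twist ?w c' n)"
        by (rule laurent_add(1)[symmetric]) (use c finite_twist[OF w] in auto)
      moreover have "(\<lambda>n. twist ?w c n + twist ?w c' n) = twist ?w (\<lambda>n. c n + c' n)"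
        by (simp add: twist_def distrib_left)
      ultimately show "x + y \<in> torus_act \<iota> z M"
        using torus_act_iff[OF z laurent_add(2)[OF c(1,3)]] laurent_add(1)[OF c(1,3)] c(2,4) by simp
    next
      fix r x assume rx: "r \<in> A" "x \<in> torus_act \<iota> z M"
      have "x \<in> A" using rx torus_act_subset[OF z MD(4)] by auto
      then obtain c c' where c: "finite {n. c n \<noteq> 0}" "x = laurent c" "finite {n. c' n \<noteq> 0}" "r = laurent c'"
        using rx(1) by (metis A_cases)
      obtain e where e: "finite {n. e n \<noteq> 0}" "laurent e = laurent c' * laurent c"
        "laurent (twist ?w e) = laurent (twist ?w c') * laurent (twist ?w c)" using twist_mult[OF c(3,1) w] by metis
      have "laurent (twist ?w c) \<in> M" using rx torus_act_iff[OF z c(1)] c(2) by auto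
      then have "laurent (twist ?w e) \<in> M" unfolding e(3) using MD(7) tw_in[OF _ c(3) w] rx(1) c(4) by blast
      then show "r * x \<in> torus_act \<iota> z M" using torus_act_iff[OF z e(1)] e(2) c by simp
    qed
    fix x assume x: "x \<in> A" "x \<notin> torus_act \<iota> z M"
    then obtain c where c: "finite {n. c n \<noteq> 0}" "x = laurent c" by (metis A_cases)
    have "laurent (twist ?w c) \<notin> M" using x torus_act_iff[OF z c(1)] c(2) by auto
    then obtain y where y: "y \<in> A" "1 - y * laurent (twist ?w c) \<in> M"
      using A.closed_point_inverse[OF M] tw_in[OF _ c(1) w] x(1) c(2) by blast
    then obtain d where d: "finite {n. d n \<noteq> 0}" "y = laurent d" by (metis A_cases)
    let ?d = "twist z d"
    have fd: "finite {n. ?d n \<noteq> 0}" using d finite_twist[OF z] by simp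
    have dd: "twist ?w ?d = d" using twist_twist[OF w, of d] z by simp
    obtain e where e: "finite {n. e n \<noteq> 0}" "laurent e = laurent ?d * laurent c"
        "laurent (twist ?w e) = laurent (twist ?w ?d) * laurent (twist ?w c)" using twist_mult[OF fd c(1) w] by metis
    let ?o = "\<lambda>k::int. if k = 0 then 1 else (0::'k)"
    have fe: "finite {n. - e n \<noteq> 0}" using e(1) by simp
    have fo: "finite {n. ?o n \<noteq> 0}" by (rule finite_single)
    have l1: "laurent (\<lambda>n. ?o n + - e n) = 1 - laurent ?d * laurent c"
      using laurent_add(1)[OF fo fe] one e(2) by (simp add: laurent_uminus)
    have "twist ?w (\<lambda>n. ?o n + - e n) = (\<lambda>n. ?o n + - twist ?w e n)" by (auto simp: twist_def algebra_simps)
    moreover have "laurent (\<lambda>n. ?o n + - twist ?w e n) = 1 - y * laurent (twist ?w c)"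
    proof -
      have f: "finite {n. - twist ?w e n \<noteq> 0}" using e(1) finite_twist[OF w] by simp
      show ?thesis unfolding laurent_add(1)[OF fo f] using one e(3) dd d(2) by (simp add: laurent_uminus)
    qed
    ultimately have "laurent (\<lambda>n. ?o n + - e n) \<in> torus_act \<iota> z M"
      using torus_act_iff[OF z laurent_add(2)[OF fo fe]] y(2) by simp
    then have "1 - laurent ?d * x \<in> torus_act \<iota> z M" unfolding l1 c(2) .
    moreover have "laurent ?d \<in> A" using tw_in[OF _ d(1) z] y(1) d(2) by simp
    ultimately show "\<exists>y\<in>A. 1 - y * x \<in> torus_act \<iota> z M" by blast
  qed
qed

lemma mon_torus_act: "z \<noteq> 0 \<Longrightarrow> field_ideal A M \<Longrightarrow> mon c n \<in> torus_act \<iota> z M \<longleftrightarrow> mon c n \<in> M"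
proof -
  assume z: "z \<noteq> 0" and M: "field_ideal A M"
  have "mon c n \<in> torus_act \<iota> z M \<longleftrightarrow> laurent (twist (1 / z) (\<lambda>k. if k = n then c else 0)) \<in> M"
    using torus_act_iff[OF z finite_single, of n c] by (simp add: laurent_single)
  also have "twist (1 / z) (\<lambda>k. if k = n then c else 0) = (\<lambda>k. if k = n then \<iota> (1 / z) powi n * c else 0)"
    by (auto simp: twist_def)
  also have "laurent \<dots> = emb (\<iota> ((1 / z) powi n)) * mon c n" by (simp add: laurent_single emb_mult_mon \<iota>_powi)
  also have "\<dots> \<in> M \<longleftrightarrow> mon c n \<in> M"
  proof
    assume "emb (\<iota> ((1 / z) powi n)) * mon c n \<in> M"
    then have "emb (\<iota> (z powi n)) * (emb (\<iota> ((1 / z) powi n)) * mon c n) \<in> M"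
      using field_idealD(4)[OF M, of "emb (\<iota> (z powi n))"] by (simp add: emb_in_A_iff)
    moreover have "z powi n * (1 / z) powi n = 1" using z by (simp flip: power_int_mult_distrib)
    then have "emb (\<iota> (z powi n)) * emb (\<iota> ((1 / z) powi n)) = 1" by (simp flip: emb_mult \<iota>_mult)
    then have "emb (\<iota> (z powi n)) * (emb (\<iota> ((1 / z) powi n)) * mon c n) = mon c n" by (metis mult.assoc mult_1)
    ultimately show "mon c n \<in> M" by (simp only:)
  qed (auto intro!: field_idealD(4)[OF M] simp: emb_in_A_iff)
  finally show ?thesis .
qed

text \<open>Hence the ideal of an orbit closure is the largest homogeneous ideal inside the ideal of any of
  the points of the orbit.\<close>

lemma orbit_core:
  assumes M: "field_ideal A M" and x: "x = laurent c" "finite {n. c n \<noteq> 0}"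
    and all: "\<And>z. z \<noteq> 0 \<Longrightarrow> x \<in> torus_act \<iota> z M"
  shows "mon (c n) n \<in> M"
proof (rule torus_core[OF M x(2)])
  fix z :: complex assume z: "z \<noteq> 0"
  then show "laurent (\<lambda>n. \<iota> z powi n * c n) \<in> M"
    using all[of "1 / z"] torus_act_iff[of "1 / z" c M] x by (simp add: twist_def)
qed

end

section \<open>Prime divisors over a point of the curve\<close>

text \<open>The monomial valuation with value m on a uniformizer at a and -e on u. With sign 1 it belongs to
  the slope \<open>Dp a\<close>, with sign -1 to the slope \<open>- Dm a\<close>.\<close>

locale vertical = dpd \<iota> A0 S Dp Dm D0 x0 for \<iota> :: "complex \<Rightarrow> 'k::field" and A0 S Dp Dm D0 x0 +
  fixes a :: "'k set" and m e \<sigma> :: int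
  assumes a: "a \<in> closed_points A0" and m_pos: "m > 0" and gcd_em: "gcd e m = 1"
    and slope: "(\<sigma> = 1 \<and> Dp a = - (of_int e / of_int m)) \<or> (\<sigma> = - 1 \<and> Dm a = of_int e / of_int m)"
begin

sublocale V: dvr A0 a "ord_at A0 a"
  by (rule dvr_ord[OF a])

sublocale G: gauss "ord_at A0 a" m e
  by unfold_locales (rule m_pos)

lemma aD: "a \<subseteq> A0" "1 \<notin> a" "0 \<in> a"
  using primeD[OF closed_point_prime[OF a]] by auto

lemma sigma: "\<sigma> = 1 \<or> \<sigma> = - 1"
  using slope by auto

text \<open>One of the two inequalities at \<open>a\<close> in \<open>piece_iff\<close> is that of
  the present slope; multiplied by m it says that the value is nonnegative.\<close>

lemma piece_nonneg:
  assumes c: "c \<in> piece A0 Dp Dm n" "c \<noteq> 0"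
  shows "0 \<le> G.W (mon c n)"
proof -
  have *: "0 \<le> of_int (ord a c) + of_int n * Dp a" "0 \<le> of_int (ord a c) - of_int n * Dm a"
    using c a unfolding piece_iff by auto
  then have "0 \<le> (of_int (ord a c) - of_int n * (of_int e / of_int m) :: rat)"
    using slope by auto
  then have "0 \<le> of_int m * (of_int (ord a c) - of_int n * (of_int e / of_int m) :: rat)"
    using m_pos by simp
  also have "\<dots> = of_int (m * ord a c - e * n)" using m_pos by (simp add: field_simps)
  finally have "0 \<le> m * ord a c - e * n" by (simp only: of_int_0_le_iff)
  then show ?thesis using c(2) by (simp add: G.W_mon)
qed

lemma W_emb_notin: "h \<in> A0 \<Longrightarrow> h \<notin> a \<Longrightarrow> G.W (emb h) = 0"
  using V.P_iff[of h] V.nonneg[of h] aD(3) by (auto simp: G.W_emb)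

text \<open>In degrees on the side of \<sigma>, the inequality for the present slope is the stricter
  one at \<open>a\<close>, so there nothing is left to correct. At the finitely many other points
  concerned, \<open>h\<close> vanishes to high order.\<close>

lemma clear_denominator:
  assumes c: "c \<noteq> 0" "0 \<le> G.W (mon c n)" and n: "0 \<le> \<sigma> * n"
  shows "\<exists>h\<in>A0. h \<notin> a \<and> h * c \<in> piece A0 Dp Dm n"
proof -
  define B where "B = {b \<in> closed_points A0. ord b c \<noteq> 0} \<union> {b. Dp b \<noteq> 0} \<union> {b. Dm b \<noteq> 0} - {a}"
  have B: "finite B" "B \<subseteq> closed_points A0" "a \<notin> B"
    using finite_ord_nonzero[OF c(1)] Dp Dm by (auto simp: B_def Q_divisor_def)
  \<comment> \<open>Large enough to outweigh a pole of \<open>c\<close> and both divisors in degree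
    n.\<close>
  define N where "N b = nat \<lceil>\<bar>of_int (ord b c)\<bar> + \<bar>of_int n * Dp b\<bar> + \<bar>of_int n * Dm b\<bar>\<rceil>" for b
  obtain h where h: "h \<in> A0" "h \<notin> a" "\<And>b. b \<in> B \<Longrightarrow> int (N b) \<le> ord b h"
    using avoid_and_vanish[OF a B, of N] by blast
  have h0: "h \<noteq> 0" using h(2) aD(3) by auto
  have "0 \<le> of_int (ord b (h * c)) + of_int n * Dp b \<and> 0 \<le> of_int (ord b (h * c)) - of_int n * Dm b"
    if b: "b \<in> closed_points A0" for b
  proof -
    interpret d: dvr A0 b "ord_at A0 b" by (rule dvr_ord[OF b])
    have hc: "ord b (h * c) = ord b h + ord b c" using d.mult h0 c(1) by blast
    consider "b = a" | "b \<in> B" | "b \<noteq> a" "b \<notin> B" by blast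
    then show ?thesis
    proof cases
      case 1
      have "ord a h = 0" using V.P_iff[OF h(1)] V.nonneg[OF h(1) h0] h(2) h0 by auto
      then have e1: "ord b (h * c) = ord a c" using hc 1 by simp
      have "0 \<le> m * ord a c - e * n" using c by (simp add: G.W_mon)
      then have "(0::rat) \<le> of_int (m * ord a c - e * n)" by (simp only: of_int_0_le_iff)
      then have "(0::rat) \<le> of_int (m * ord a c - e * n) / of_int m" using m_pos by (intro divide_nonneg_nonneg) auto
      also have "\<dots> = of_int (ord a c) - of_int n * (of_int e / of_int m)" using m_pos by (simp add: field_simps)
      finally have ge: "0 \<le> (of_int (ord a c) :: rat) - of_int n * (of_int e / of_int m)" .
      have "0 \<le> (of_int (\<sigma> * n) :: rat)" using n by (simp only: of_int_0_le_iff)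
      then have "0 \<le> of_int (\<sigma> * n) * - (Dp a + Dm a)" using Dp_Dm[of a] by (intro mult_nonneg_nonneg) auto
      then show ?thesis using slope ge unfolding 1 e1[unfolded 1] by (auto simp: algebra_simps)
    next
      case 2
      define q where "q = \<bar>of_int (ord b c)\<bar> + \<bar>of_int n * Dp b\<bar> + \<bar>of_int n * Dm b\<bar>"
      have "q \<le> of_int \<lceil>q\<rceil>" by simp
      also have "\<dots> \<le> of_int (int (N b))" unfolding N_def q_def[symmetric] by simp
      also have "\<dots> \<le> of_int (ord b h)" using h(3)[OF 2] by simp
      finally have "\<bar>of_int (ord b c)\<bar> + \<bar>of_int n * Dp b\<bar> + \<bar>of_int n * Dm b\<bar> \<le> of_int (ord b h)" by (simp add: q_def)
      then show ?thesis unfolding hc by (auto simp: abs_if split: if_splits)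
    next
      case 3
      then have "ord b c = 0" "Dp b = 0" "Dm b = 0" using b by (auto simp: B_def)
      then show ?thesis using hc d.nonneg[OF h(1) h0] by simp
    qed
  qed
  then show ?thesis using h unfolding piece_iff by blast
qed

lemma clear_denominators:
  assumes fin: "finite {n. c n \<noteq> 0}"
    and ge: "\<And>n. c n \<noteq> 0 \<Longrightarrow> 0 \<le> G.W (mon (c n) n) \<and> 0 \<le> \<sigma> * n"
  shows "\<exists>h\<in>A0. h \<notin> a \<and> emb h * laurent c \<in> A"
proof -
  have "\<exists>h. h \<in> A0 \<and> h \<notin> a \<and> h * c n \<in> piece A0 Dp Dm n" for n
    using clear_denominator[of "c n" n] ge[of n] aD by (cases "c n = 0") auto
  then obtain h where h: "\<And>n. h n \<in> A0 \<and> h n \<notin> a \<and> h n * c n \<in> piece A0 Dp Dm n" by metis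
  define H where "H = (\<Prod>n | c n \<noteq> 0. h n)"
  have H: "H \<in> A0" unfolding H_def using h by (intro prod_in) auto
  have "H \<notin> a" using prime_prod[OF closed_point_prime[OF a] fin, of h] h by (auto simp: H_def)
  moreover have "emb H * laurent c \<in> A"
  proof -
    have "emb H * laurent c = (\<Sum>n | c n \<noteq> 0. mon (H * c n) n)"
      by (simp add: laurent_def sum_distrib_left emb_mult_mon flip: mon_def)
    moreover have "H * c n \<in> piece A0 Dp Dm n" if n: "c n \<noteq> 0" for n
    proof -
      have "H = (\<Prod>k\<in>{k. c k \<noteq> 0} - {n}. h k) * h n"
        unfolding H_def using fin n by (subst prod.remove[of _ n]) (auto simp: mult.commute)
      moreover have "(\<Prod>k\<in>{k. c k \<noteq> 0} - {n}. h k) \<in> piece A0 Dp Dm 0"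
        unfolding piece_degree_0 using h by (intro prod_in) auto
      ultimately show ?thesis using piece_mult[of _ 0 "h n * c n" n] h by (simp add: mult.assoc)
    qed
    ultimately show ?thesis by (auto intro!: A_sum mon_in_A)
  qed
  ultimately show ?thesis using H by blast
qed

lemma bezout: obtains x y where "m * x + e * y = 1"
  using bezout_int[of m e] gcd_em by (metis gcd.commute mult.commute)

text \<open>Bezout coefficients give a monomial of value 1, and t^e u^m has value 0; multiplying by
  powers of the latter moves the degree arbitrarily far towards the side of \<sigma> at constant
  value.\<close>

lemma ex_mon:
  obtains c N where "c \<noteq> 0" "G.W (mon c N) = k" "B \<le> \<sigma> * N"
proof -
  obtain x y where xy: "m * x + e * y = 1" by (rule bezout)
  obtain t where t: "t \<noteq> 0" "ord a t = 1" by (rule V.uniformizer)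
  \<comment> \<open>The monomial is (t^x u^-y)^k (t^e u^m)^L. The two absolute values absorb the
    shift \<open>k * y\<close> and the bound \<open>B\<close>.\<close>
  define L where "L = \<sigma> * (\<bar>k * y\<bar> + \<bar>B\<bar>)"
  define N where "N = m * L - k * y"
  have "m * (k * x + e * L) - e * N = k * (m * x + e * y)" by (simp add: N_def algebra_simps)
  then have "G.W (mon (t powi (k * x + e * L)) N) = k"
    using t xy by (simp add: G.W_mon V.powi)
  moreover have "B \<le> \<sigma> * N"
  proof -
    have ss: "\<sigma> * \<sigma> = 1" using sigma by auto
    have "\<sigma> * N = m * ((\<sigma> * \<sigma>) * (\<bar>k * y\<bar> + \<bar>B\<bar>)) - \<sigma> * (k * y)"
      by (simp add: N_def L_def algebra_simps)
    also have "\<dots> = m * (\<bar>k * y\<bar> + \<bar>B\<bar>) - \<sigma> * (k * y)" by (simp add: ss)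
    also have "\<dots> \<ge> (\<bar>k * y\<bar> + \<bar>B\<bar>) - \<bar>k * y\<bar>"
    proof -
      have "\<bar>k * y\<bar> + \<bar>B\<bar> \<le> m * (\<bar>k * y\<bar> + \<bar>B\<bar>)"
        using m_pos mult_right_mono[of 1 m "\<bar>k * y\<bar> + \<bar>B\<bar>"] by simp
      moreover have "\<sigma> * (k * y) \<le> \<bar>k * y\<bar>" using sigma by auto
      ultimately show ?thesis by linarith
    qed
    finally show ?thesis by linarith
  qed
  moreover have "t powi (k * x + e * L) \<noteq> 0" using t by simp
  ultimately show ?thesis using that by blast
qed

lemma mon_mult_laurent:
  assumes "finite {n. c n \<noteq> 0}"
  shows "mon f N * laurent c = laurent (\<lambda>n. f * c (n - N))" "finite {n. f * c (n - N) \<noteq> 0}"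
proof -
  have sub: "{n. f * c (n - N) \<noteq> 0} \<subseteq> (\<lambda>n. n + N) ` {n. c n \<noteq> 0}"
  proof
    fix n assume "n \<in> {n. f * c (n - N) \<noteq> 0}"
    then show "n \<in> (\<lambda>n. n + N) ` {n. c n \<noteq> 0}" by (intro image_eqI[of _ _ "n - N"]) auto
  qed
  then show "finite {n. f * c (n - N) \<noteq> 0}" using assms by (meson finite_imageI finite_subset)
  have "laurent (\<lambda>n. f * c (n - N)) = (\<Sum>n\<in>(\<lambda>n. n + N) ` {n. c n \<noteq> 0}. mon (f * c (n - N)) n)"
    by (rule laurent_eq_sum) (use assms sub in auto)
  also have "\<dots> = (\<Sum>n | c n \<noteq> 0. mon (f * c n) (n + N))" by (subst sum.reindex) (auto simp: inj_on_def)
  also have "\<dots> = mon f N * laurent c"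
    by (simp add: laurent_def sum_distrib_left flip: mon_def) (simp add: mon_mult add.commute)
  finally show "mon f N * laurent c = laurent (\<lambda>n. f * c (n - N))" by simp
qed

text \<open>The factor \<open>mon f N\<close> moves all degrees to the side of \<sigma>, where
  denominators away from \<open>a\<close> can be cleared term by term.\<close>

lemma clear_laurent:
  assumes fin: "finite {n. c n \<noteq> 0}" and f: "f \<noteq> 0"
    and ge: "laurent c = 0 \<or> 0 \<le> G.W (mon f N) + G.W (laurent c)"
    and N: "\<And>n. c n \<noteq> 0 \<Longrightarrow> \<bar>n\<bar> \<le> \<sigma> * N"
  shows "\<exists>h\<in>A0. h \<notin> a \<and> emb h * (mon f N * laurent c) \<in> A"
  unfolding mon_mult_laurent(1)[OF fin]
proof (rule clear_denominators[OF mon_mult_laurent(2)[OF fin]])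
  fix n assume n: "f * c (n - N) \<noteq> 0"
  then have c: "c (n - N) \<noteq> 0" by auto
  then have nz: "laurent c \<noteq> 0" using laurent_eq_0[OF fin] by blast
  then have "G.W (laurent c) \<le> G.W (mon (c (n - N)) (n - N))" using G.W_laurent_ge[OF fin nz] c by blast
  moreover have "mon (f * c (n - N)) n = mon f N * mon (c (n - N)) (n - N)" by (simp add: mon_mult)
  then have "G.W (mon (f * c (n - N)) n) = G.W (mon f N) + G.W (mon (c (n - N)) (n - N))"
    using G.P.fract.mult[of "mon f N" "mon (c (n - N)) (n - N)"] f c by simp
  ultimately have "0 \<le> G.W (mon (f * c (n - N)) n)" using ge nz by auto
  moreover have "0 \<le> \<sigma> * n" using N[OF c] sigma by (auto simp: abs_if split: if_splits)
  ultimately show "0 \<le> G.W (mon (f * c (n - N)) n) \<and> 0 \<le> \<sigma> * n" by blast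
qed

text \<open>The centre on V of the monomial valuation; it will be the prime of one component of the
  fiber over \<open>a\<close>.\<close>

definition PV :: "'k poly fract set" where
  "PV = {x \<in> A. x = 0 \<or> 0 < G.W x}"

lemma A_nonneg:
  assumes "x \<in> A" "x \<noteq> 0"
  shows "0 \<le> G.W x"
proof -
  obtain c where c: "finite {n. c n \<noteq> 0}" "\<And>n. c n \<in> piece A0 Dp Dm n" "x = laurent c"
    using A_cases[OF assms(1)] by metis
  then show ?thesis using G.W_laurent_ge[OF c(1), of 0] piece_nonneg assms(2) by simp
qed

lemma PV_iff:
  assumes "finite {n. c n \<noteq> 0}"
  shows "laurent c \<in> PV \<longleftrightarrow> (\<forall>n. mon (c n) n \<in> PV)"
proof -
  have "laurent c \<in> PV \<longleftrightarrow> (\<forall>n. c n \<in> piece A0 Dp Dm n) \<and> (\<forall>n. c n \<noteq> 0 \<longrightarrow> 0 < G.W (mon (c n) n))"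
  proof (cases "laurent c = 0")
    case True
    then have "\<And>n. c n = 0" using laurent_eq_0[OF assms] by blast
    then show ?thesis using True laurent_in_A_iff[OF assms] by (auto simp: PV_def)
  next
    case False
    then show ?thesis using G.W_laurent_ge[OF assms False, of 1] laurent_in_A_iff[OF assms]
      by (auto simp: PV_def)
  qed
  then show ?thesis by (auto simp: PV_def mon_in_A_iff)
qed

text \<open>Write \<open>x\<close> as a quotient of Laurent polynomials. A common monomial factor
  gives the denominator value 0, so that it stays outside \<open>PV\<close>, and shifts all degrees
  to the side of \<sigma>; then functions that do not vanish at \<open>a\<close> bring both into
  A.\<close>

lemma fraction:
  assumes x: "x \<noteq> 0" "0 \<le> G.W x"
  shows "\<exists>p\<in>A. \<exists>q\<in>A. q \<notin> PV \<and> x = p / q"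
proof -
  obtain p' q' where pq': "q' \<noteq> 0" "x = to_fract p' / to_fract q'" by (metis fract_cases)
  obtain c where c: "finite {n. c n \<noteq> 0}" "to_fract p' = laurent c" by (metis to_fract_laurent)
  obtain d where d: "finite {n. d n \<noteq> 0}" "to_fract q' = laurent d" by (metis to_fract_laurent)
  have nz: "laurent d \<noteq> 0" "laurent c \<noteq> 0" using pq' d(2) c(2) x by (metis to_fract_eq_0_iff, metis div_0)
  have xcd: "x = laurent c / laurent d" using pq' c d by simp
  then have Wx: "G.W x = G.W (laurent c) - G.W (laurent d)" using G.P.fract.div nz by blast
  have fin: "finite (abs ` ({n. c n \<noteq> 0} \<union> {n. d n \<noteq> 0}))" using c d by simp
  define B where "B = Max (insert 0 (abs ` ({n. c n \<noteq> 0} \<union> {n. d n \<noteq> 0})))"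
  have B: "\<bar>n\<bar> \<le> B" if "c n \<noteq> 0 \<or> d n \<noteq> 0" for n
    unfolding B_def using fin that by (intro Max_ge) auto
  obtain f N where f: "f \<noteq> 0" "G.W (mon f N) = - G.W (laurent d)" "B \<le> \<sigma> * N" by (rule ex_mon)
  obtain h where h: "h \<in> A0" "h \<notin> a" "emb h * (mon f N * laurent c) \<in> A"
    using clear_laurent[OF c(1) f(1), of N] f(2,3) B Wx x(2) by force
  obtain g where g: "g \<in> A0" "g \<notin> a" "emb g * (mon f N * laurent d) \<in> A"
    using clear_laurent[OF d(1) f(1), of N] f(2,3) B by force
  have hg: "h \<noteq> 0" "g \<noteq> 0" using h g aD by auto
  define q where "q = emb h * (emb g * (mon f N * laurent d))"
  have "G.W q = 0"
    using hg nz f W_emb_notin h g by (simp add: q_def G.P.fract.mult)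
  moreover have "q \<noteq> 0" using hg nz f by (simp add: q_def)
  ultimately have "q \<notin> PV" by (simp add: PV_def)
  moreover have "q \<in> A" unfolding q_def using g h by (auto simp: emb_in_A_iff)
  moreover have "emb g * (emb h * (mon f N * laurent c)) \<in> A" using g h by (auto simp: emb_in_A_iff)
  moreover have "x = (emb g * (emb h * (mon f N * laurent c))) / q"
    using hg nz f unfolding xcd q_def by simp
  ultimately show ?thesis by blast
qed

sublocale PV: dvr A PV G.W
proof -
  obtain c N where t: "c \<noteq> 0" "G.W (mon c N) = 1" by (rule ex_mon)
  show "dvr A PV G.W"
  proof (rule dvrI[where t = "mon c N"])
    show "field_subring A" by (rule A.field_subring_axioms)
    show "PV = {x \<in> A. x = 0 \<or> 0 < G.W x}" by (rule PV_def)
  qed (use t G.P.fract.mult G.P.fract.add A_nonneg fraction in auto)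
qed

lemma PV_prime_divisor: "PV \<in> prime_divisors A"
  by (rule PV.prime_divisor)

lemma proj_PV: "proj A0 PV = a"
proof (rule equalityI; rule subsetI)
  fix f assume "f \<in> proj A0 PV"
  then have f: "f \<in> A0" "f = 0 \<or> 0 < G.W (emb f)" by (auto simp: proj_def PV_def)
  show "f \<in> a" using f V.P_iff[OF f(1)] m_pos by (cases "f = 0") (auto simp: G.W_emb zero_less_mult_iff)
next
  fix f assume f: "f \<in> a"
  then have "f \<in> A0" using aD by auto
  then show "f \<in> proj A0 PV"
    using f V.P_iff[of f] m_pos by (cases "f = 0") (auto simp: proj_def PV_def emb_in_A_iff G.W_emb)
qed

section \<open>Primes of A over the point and their homogeneous elements\<close>

lemma mon_in_PV_iff: "mon c n \<in> PV \<longleftrightarrow> c \<in> piece A0 Dp Dm n \<and> (c = 0 \<or> 0 < G.W (mon c n))"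
  by (auto simp: PV_def mon_in_A_iff)

lemma degree_0_in:
  assumes P': "primeideal P' (ring_on A)" "proj A0 P' = a" and x: "mon c 0 \<in> PV"
  shows "mon c 0 \<in> P'"
proof -
  have "c \<in> proj A0 PV" using x PV.P(4) by (auto simp: proj_def mon_degree_0 emb_in_A_iff)
  then have "c \<in> proj A0 P'" using proj_PV P'(2) by simp
  then show ?thesis by (simp add: proj_def mon_degree_0)
qed

text \<open>Values are integers, so a positive value is at least 1, and the m-th power of the
  element stays of nonnegative value after division by \<open>t\<close>, whose value is m. Up to a
  function that is nonzero at \<open>a\<close>, this power is therefore \<open>t\<close> times an
  element of A, and \<open>t\<close> lies in P'.\<close>

lemma same_sign_in:
  assumes P': "primeideal P' (ring_on A)" "proj A0 P' = a" and x: "mon c n \<in> PV" "0 \<le> \<sigma> * n"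
  shows "mon c n \<in> P'"
proof (cases "c = 0")
  case True
  then show ?thesis using A.primeD[OF P'(1)] by simp
next
  case False
  note PD = A.primeD[OF P'(1)]
  obtain t where t: "t \<in> a" "t \<noteq> 0" "ord a t = 1" by (rule V.uniformizer_in)
  have cp: "c \<in> piece A0 Dp Dm n" "0 < G.W (mon c n)" using x False by (auto simp: mon_in_PV_iff)
  define k where "k = nat m"
  have k: "int k = m" using m_pos by (simp add: k_def)
  have "G.W (mon (c ^ k / t) (m * n)) = m * (m * ord a c - e * n) - m"
    using False t by (simp add: G.W_mon V.div V.pow k algebra_simps)
  also have "\<dots> = m * (G.W (mon c n) - 1)" using False by (simp add: G.W_mon algebra_simps)
  also have "\<dots> \<ge> 0" using cp(2) m_pos by simp
  finally have "0 \<le> G.W (mon (c ^ k / t) (m * n))" .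
  moreover have "0 \<le> \<sigma> * (m * n)" using x(2) m_pos by (metis mult.left_commute mult_nonneg_nonneg order_less_imp_le)
  ultimately obtain h where h: "h \<in> A0" "h \<notin> a" "h * (c ^ k / t) \<in> piece A0 Dp Dm (m * n)"
    using clear_denominator[of "c ^ k / t" "m * n"] False t by auto
  have tP: "emb t \<in> P'" using t(1) P'(2) by (auto simp: proj_def)
  have "emb h * mon c n ^ k = emb t * mon (h * (c ^ k / t)) (m * n)"
    using t(2) by (simp add: mon_power emb_mult_mon k)
  also have "\<dots> \<in> P'" using PD(8)[OF mon_in_A[OF h(3)] tP] by (simp add: mult.commute)
  finally have "emb h * mon c n ^ k \<in> P'" .
  moreover have "emb h \<notin> P'" using h P'(2) by (auto simp: proj_def)
  moreover have "mon c n \<in> A" using cp by (simp add: mon_in_A_iff)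
  moreover have "emb h \<in> A" using h by (simp add: emb_in_A_iff)
  ultimately show ?thesis using PD(3)[OF _ A.power_in] A.prime_power[OF P'(1)] by blast
qed

text \<open>Suitable powers of elements of opposite degrees have a product of degree 0, which can be tested
  on the curve.\<close>

lemma opposite_product:
  assumes P': "primeideal P' (ring_on A)" "proj A0 P' = a"
    and x: "c \<in> piece A0 Dp Dm n" "c \<noteq> 0" and y: "d \<in> piece A0 Dp Dm k" "d \<noteq> 0" "\<sigma> * n \<le> 0" "0 < \<sigma> * k"
  shows "mon c n ^ nat \<bar>k\<bar> * mon d k ^ nat \<bar>n\<bar> \<in> P' \<longleftrightarrow> 0 < \<bar>k\<bar> * G.W (mon c n) + \<bar>n\<bar> * G.W (mon d k)"
proof -
  let ?f = "c ^ nat \<bar>k\<bar> * d ^ nat \<bar>n\<bar>"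
  have "\<bar>k\<bar> * n + \<bar>n\<bar> * k = 0" using y(3,4) sigma by (auto simp: abs_if split: if_splits)
  then have eq: "mon c n ^ nat \<bar>k\<bar> * mon d k ^ nat \<bar>n\<bar> = emb ?f"
    by (simp add: mon_power mon_mult flip: mon_degree_0)
  moreover have "mon c n ^ nat \<bar>k\<bar> * mon d k ^ nat \<bar>n\<bar> \<in> A" using x y by (intro A.mult_in A.power_in mon_in_A)
  ultimately have fA: "?f \<in> A0" using emb_in_A_iff by metis
  have f0: "?f \<noteq> 0" using x y by simp
  have "G.W (emb ?f) = \<bar>k\<bar> * G.W (mon c n) + \<bar>n\<bar> * G.W (mon d k)"
    unfolding eq[symmetric] using x y by (simp add: G.P.fract.mult G.P.fract.pow)
  moreover have "emb ?f \<in> P' \<longleftrightarrow> ?f \<in> a" using P'(2) fA by (auto simp: proj_def)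
  moreover have "?f \<in> a \<longleftrightarrow> 0 < ord a ?f" using V.P_iff[OF fA] f0 by blast
  then have "?f \<in> a \<longleftrightarrow> 0 < G.W (emb ?f)" unfolding G.W_emb[OF f0] using m_pos zero_less_mult_pos mult_pos_pos by blast
  ultimately show ?thesis unfolding eq by simp
qed

text \<open>Degrees on the side of \<sigma> are covered by \<open>same_sign_in\<close>. For the
  opposite degrees, multiply by powers of the element that P' misses: the product has degree 0 and
  positive value, hence lies in P'.\<close>

lemma PV_subset:
  assumes P': "primeideal P' (ring_on A)" "proj A0 P' = a"
    and y: "d \<in> piece A0 Dp Dm k" "mon d k \<notin> P'" "0 < \<sigma> * k"
  shows "PV \<subseteq> P'"
proof
  note PD = A.primeD[OF P'(1)]
  fix x assume x: "x \<in> PV"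
  then obtain c where c: "finite {n. c n \<noteq> 0}" "x = laurent c" using PV.P(4) by (metis A_cases subsetD)
  have "mon (c n) n \<in> P'" for n
  proof (cases "0 \<le> \<sigma> * n \<or> c n = 0")
    case True
    then show ?thesis using same_sign_in[OF P', of "c n" n] x PV_iff[OF c(1)] c(2) PD(5) by auto
  next
    case False
    have cn: "c n \<in> piece A0 Dp Dm n" "0 < G.W (mon (c n) n)" using x PV_iff[OF c(1)] c(2) False by (auto simp: mon_in_PV_iff)
    have d0: "d \<noteq> 0" using y(2) PD(5) by auto
    have "0 < \<bar>k\<bar> * G.W (mon (c n) n)" using cn(2) y(3) by (intro mult_pos_pos) auto
    moreover have "0 \<le> \<bar>n\<bar> * G.W (mon d k)" using piece_nonneg[OF y(1) d0] by simp
    ultimately have "mon (c n) n ^ nat \<bar>k\<bar> * mon d k ^ nat \<bar>n\<bar> \<in> P'"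
      using opposite_product[OF P' cn(1) _ y(1) d0] False y(3) by simp
    moreover have "mon (c n) n ^ nat \<bar>k\<bar> \<in> A" "mon d k ^ nat \<bar>n\<bar> \<in> A"
      using cn y by (auto intro!: A.power_in mon_in_A)
    ultimately have "mon (c n) n ^ nat \<bar>k\<bar> \<in> P' \<or> mon d k ^ nat \<bar>n\<bar> \<in> P'" using PD(3) by blast
    then show ?thesis using A.prime_power[OF P'(1) mon_in_A] cn y by blast
  qed
  then show "x \<in> P'" unfolding c(2) laurent_def mon_def[symmetric]
    by (intro A.field_ideal_sum[OF PD(1)]) auto
qed

text \<open>A homogeneous element of A outside \<open>PV\<close> has value 0, as has the given
  element that P' misses. For opposite degrees their powers multiply to a degree 0 element outside
  P'. For degrees of the same sign, powers of equal degree differ by a unit of the local ring at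
  \<open>a\<close>. Either way membership in P' is impossible.\<close>

lemma homogeneous_notin:
  assumes P': "primeideal P' (ring_on A)" "proj A0 P' = a"
    and y: "d \<in> piece A0 Dp Dm k" "mon d k \<notin> P'" "0 < \<sigma> * k"
    and x: "c \<in> piece A0 Dp Dm n" "mon c n \<in> P'"
  shows "mon c n \<in> PV"
proof (rule ccontr)
  assume n: "mon c n \<notin> PV"
  note PD = A.primeD[OF P'(1)]
  have c0: "c \<noteq> 0" using n PV.P(5) by auto
  have Wc: "G.W (mon c n) = 0" using n x(1) c0 piece_nonneg[OF x(1) c0] by (auto simp: mon_in_PV_iff)
  have d0: "d \<noteq> 0" using y(2) PD(5) by auto
  have "mon d k \<notin> PV" using PV_subset[OF P' y] y(2) by auto
  then have Wd: "G.W (mon d k) = 0" using y(1) d0 piece_nonneg[OF y(1) d0] by (auto simp: mon_in_PV_iff)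
  have xA: "mon c n \<in> A" "mon d k \<in> A" using x y by (auto simp: mon_in_A_iff)
  have k0: "nat \<bar>k\<bar> > 0" using y(3) by auto
  have xk: "mon c n ^ nat \<bar>k\<bar> \<in> P'"
  proof -
    have "mon c n ^ nat \<bar>k\<bar> = mon c n * mon c n ^ (nat \<bar>k\<bar> - 1)" using k0 by (simp flip: power_Suc)
    then show ?thesis using PD(8)[OF A.power_in[OF xA(1)] x(2)] by simp
  qed
  show False
  proof (cases "\<sigma> * n \<le> 0")
    case True
    have "mon c n ^ nat \<bar>k\<bar> * mon d k ^ nat \<bar>n\<bar> \<notin> P'"
      using opposite_product[OF P' x(1) c0 y(1) d0 True y(3)] Wc Wd by simp
    then show False using PD(8)[OF A.power_in[OF xA(2)] xk] by blast
  next
    case False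
    have nk: "\<bar>k\<bar> * n = \<bar>n\<bar> * k" using False y(3) sigma by (auto simp: abs_if split: if_splits)
    define f where "f = c ^ nat \<bar>k\<bar> / d ^ nat \<bar>n\<bar>"
    have f: "mon c n ^ nat \<bar>k\<bar> = emb f * mon d k ^ nat \<bar>n\<bar>"
      using d0 by (simp add: f_def mon_power emb_mult_mon nk)
    have f0: "f \<noteq> 0" using c0 d0 by (simp add: f_def)
    have "G.W (mon c n ^ nat \<bar>k\<bar>) = G.W (emb f) + G.W (mon d k ^ nat \<bar>n\<bar>)"
      unfolding f using f0 d0 by (intro G.P.fract.mult) auto
    then have "G.W (emb f) = 0" using G.P.fract.pow[of "mon c n"] G.P.fract.pow[of "mon d k"] c0 d0 Wc Wd by simp
    then have "ord a f = 0" using f0 m_pos by (simp add: G.W_emb)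
    then have "f \<in> localization A0 a" "1 / f \<in> localization A0 a" using V.inv f0 by (auto simp: V.loc_iff)
    then obtain p q where pq: "1 / f = p / q" "p \<in> A0" "q \<in> A0" "q \<notin> a" unfolding localization_def by blast
    have q0: "q \<noteq> 0" using pq aD by auto
    then have "p \<noteq> 0" using pq f0 by auto
    then have fq: "q = p * f" using pq(1) q0 f0 by (simp add: field_simps)
    have "emb q * mon d k ^ nat \<bar>n\<bar> = emb p * mon c n ^ nat \<bar>k\<bar>" unfolding fq f by (simp add: emb_mult)
    also have "\<dots> \<in> P'" using PD(7)[OF _ xk, of "emb p"] pq by (simp add: emb_in_A_iff)
    finally have "emb q \<in> P' \<or> mon d k ^ nat \<bar>n\<bar> \<in> P'"
      using PD(3)[of "emb q" "mon d k ^ nat \<bar>n\<bar>"] pq A.power_in[OF xA(2)] by (auto simp: emb_in_A_iff)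
    moreover have "emb q \<notin> P'" using pq P'(2) by (auto simp: proj_def)
    ultimately show False using A.prime_power[OF P'(1) xA(2)] y(2) by blast
  qed
qed

text \<open>An element in all translates of M has its homogeneous components in M, and homogeneous
  elements of M lie in \<open>PV\<close>. Taking Z only as a superset of the orbit lets the lemma
  apply to a whole fiber too.\<close>

lemma orbit_inter:
  assumes M: "M \<in> closed_points A" "proj A0 M = a"
    and y: "d \<in> piece A0 Dp Dm k" "mon d k \<notin> M" "0 < \<sigma> * k"
    and Z: "\<And>z. z \<noteq> 0 \<Longrightarrow> torus_act \<iota> z M \<in> Z" "Z \<noteq> {}"
      "\<And>N. N \<in> Z \<Longrightarrow> PV \<subseteq> N"
  shows "\<Inter> Z = PV"
proof
  show "PV \<subseteq> \<Inter> Z" using Z by blast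
  note MP = A.closed_point_prime[OF M(1)]
  note MD = A.primeD[OF MP]
  show "\<Inter> Z \<subseteq> PV"
  proof
    fix x assume x: "x \<in> \<Inter> Z"
    then have all: "x \<in> torus_act \<iota> z M" if "z \<noteq> 0" for z using Z(1) that by blast
    have "x \<in> M" using all[of 1] torus_act_1[OF MD(4)] by simp
    then obtain c where c: "finite {n. c n \<noteq> 0}" "\<And>n. c n \<in> piece A0 Dp Dm n" "x = laurent c"
      using MD(4) by (metis A_cases subsetD)
    have "mon (c n) n \<in> M" for n using orbit_core[OF MD(1) c(3,1) all] by blast
    then have "mon (c n) n \<in> PV" for n using homogeneous_notin[OF MP M(2) y c(2)] by blast
    then show "x \<in> PV" using PV_iff[OF c(1)] c(3) by blast
  qed
qed

text \<open>The constant m - e - 1 is the value of t u / (\<tau> s), the ratio of the wedge of dt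
  and du to the generator formed from \<tau> and s.\<close>

lemma ord_form_vertical:
  assumes t: "t \<noteq> 0" "ord a t = 1" and g: "g \<noteq> 0"
  shows "ord_form (emb \<circ> \<iota>) 2 A PV (\<lambda>d. g * wedge (emb \<circ> \<iota>) 2 (pair (emb t) u) d) = G.W g + m - e - 1"
proof -
  let ?L = "localization A PV" and ?i = "emb \<circ> \<iota>"
  obtain \<alpha> y where "m * \<alpha> + e * y = 1" by (rule bezout)
  moreover define \<beta> where "\<beta> = - y"
  ultimately have ab: "m * \<alpha> - e * \<beta> = 1" by simp
  define \<tau> s where "\<tau> = mon (t powi \<alpha>) \<beta>" and "s = mon (t powi e) m"
  have nz: "\<tau> \<noteq> 0" "s \<noteq> 0" using t by (auto simp: \<tau>_def s_def)
  have W: "G.W \<tau> = 1" "G.W s = 0"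
    using t ab by (simp_all add: \<tau>_def s_def G.W_mon V.powi)
  have tau_s: "\<tau> powi k * s powi l = mon (t powi (\<alpha> * k + e * l)) (\<beta> * k + m * l)" for k l
    using t by (simp add: \<tau>_def s_def mon_def emb_mult emb_powi power_int_mult_distrib power_int_add flip: power_int_mult)
  have L: "\<tau> \<in> ?L" "s \<in> ?L" "inverse s \<in> ?L" using W nz by (auto simp: PV.loc_iff G.P.fract.inverse)
  let ?D = "diff_span ?i ?L \<tau> s"
  have gens: "\<tau> \<in> ?D" "s \<in> ?D" by (rule PV.L.diff_span_gen)+
  have pw: "\<tau> powi k * s powi l \<in> ?D" if "k \<ge> 0" for k l
  proof -
    have "\<tau> powi k = \<tau> ^ nat k" using that by (simp add: power_int_def)
    moreover have "s powi l \<in> ?L" using W nz by (simp add: PV.loc_iff G.P.fract.powi)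
    ultimately show ?thesis
      using PV.L.diff_span_mult[OF PV.L.diff_span_power[OF gens(1) L(1), of "nat k"]
          PV.L.diff_span_powi[OF gens(2) L(2,3) nz(2), of l] PV.L.power_in[OF L(1)]] by simp
  qed
  have emb_t: "emb t \<in> ?D"
  proof -
    have "\<tau> powi m * s powi (- \<beta>) = mon (t powi (m * \<alpha> - e * \<beta>)) 0" unfolding tau_s by (simp add: mult.commute)
    then have "emb t = \<tau> powi m * s powi (- \<beta>)" unfolding ab by (simp add: mon_degree_0)
    then show ?thesis using pw[of m "- \<beta>"] m_pos by simp
  qed
  have D0t: "D0 t \<noteq> 0" using derivation_uniformizer(1)[OF D0 x0 a t] .
  have embL: "emb w \<in> ?L" if "w \<in> localization A0 a" for w
    using that m_pos by (cases "w = 0") (auto simp: PV.loc_iff V.loc_iff G.W_emb)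
  \<comment> \<open>On the curve, dw is a multiple of dt with coefficient regular at
    \<open>a\<close>; proportionality carries this over to derivations of K(u).\<close>
  have unit: "emb w \<in> ?D" if w: "w \<in> localization A0 a" for w
  proof -
    define w' where "w' = D0 w / D0 t"
    have w': "emb w' \<in> ?L" unfolding w'_def by (rule embL[OF derivation_uniformizer(2)[OF D0 x0 a t w]])
    obtain p q where pq: "p \<in> ?L" "q \<in> ?L" "\<And>d. derivation ?i d \<Longrightarrow> d (emb t) = p * d \<tau> + q * d s"
      using PV.L.diff_spanE[OF emb_t] by metis
    show ?thesis
    proof (rule PV.L.diff_spanI[of "emb w' * p" "emb w' * q"])
      fix d assume d: "derivation ?i d"
      have "emb (D0 w) * d (emb t) = emb (D0 t) * d (emb w)" by (rule derivations_proportional_emb[OF D0 d])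
      then have "d (emb w) = emb w' * d (emb t)" using D0t by (simp add: w'_def emb_divide field_simps)
      then show "d (emb w) = emb w' * p * d \<tau> + emb w' * q * d s" unfolding pq(3)[OF d] by (simp add: algebra_simps)
    qed (use w' pq in auto)
  qed
  have mon: "mon c n \<in> ?D" if c: "mon c n \<in> A" for c n
  proof (cases "c = 0")
    case True
    then show ?thesis using PV.L.diff_span_0 by simp
  next
    case False
    \<comment> \<open>Inverting the exponent matrix of determinant 1 expresses t^j u^n as \<tau>^k
      s^l. The exponent \<open>k\<close> is the value of the element, so it is nonnegative on A;
      \<open>s\<close> is a unit, so \<open>l\<close> may have any sign.\<close>
    define j k l where "j = ord a c" and "k = m * j - e * n" and "l = n * \<alpha> - j * \<beta>"
    define w where "w = c / t powi j"
    have "G.W (mon c n) = k" using False by (simp add: G.W_mon k_def j_def)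
    then have k0: "k \<ge> 0" using A_nonneg[OF c] False by simp
    have e1: "\<alpha> * k + e * l = (m * \<alpha> - e * \<beta>) * j" "\<beta> * k + m * l = (m * \<alpha> - e * \<beta>) * n"
      by (simp_all add: k_def l_def algebra_simps)
    have "\<tau> powi k * s powi l = mon (t powi j) n" unfolding tau_s e1 ab by simp
    then have "mon c n = emb w * (\<tau> powi k * s powi l)" using t by (simp add: w_def emb_mult_mon)
    moreover have wL: "w \<in> localization A0 a" using False t by (simp add: V.loc_iff w_def V.div V.powi j_def)
    moreover have "\<tau> powi k * s powi l \<in> ?L" using nz W k0 by (simp add: PV.loc_iff G.P.fract.mult G.P.fract.powi)
    ultimately show ?thesis using PV.L.diff_span_mult[OF unit[OF wL] pw[OF k0]] embL[OF wL] by simp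
  qed
  have AD: "x \<in> ?D" if x: "x \<in> A" for x
  proof -
    obtain c where c: "finite {n. c n \<noteq> 0}" "\<And>n. c n \<in> piece A0 Dp Dm n" "x = laurent c"
      using A_cases[OF x] by metis
    then show ?thesis unfolding c(3) laurent_def mon_def[symmetric]
      by (intro PV.L.diff_span_sum mon mon_in_A)
  qed
  have LD: "?L \<subseteq> ?D"
  proof
    fix x assume "x \<in> ?L"
    then obtain p q where pq: "x = p / q" "p \<in> A" "q \<in> A" "q \<notin> PV" unfolding localization_def by blast
    have q0: "q \<noteq> 0" using pq PV.P(5) by auto
    have "inverse q \<in> ?L" using PV.in_locI[of 1 q] pq by (simp add: inverse_eq_divide)
    then show "x \<in> ?D" unfolding pq(1)
      using PV.L.diff_span_div[OF AD[OF pq(2)] AD[OF pq(3)] PV.loc_incl[OF pq(2)]] q0 by simp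
  qed
  have gen: "forms ?i 2 ?L = {\<lambda>d. x * wedge ?i 2 (pair \<tau> s) d |x. x \<in> ?L}"
    by (rule PV.L.forms_2_eq[OF L(1,2) LD])
  define H where "H = emb t * u / (\<tau> * s)"
  have H: "wedge ?i 2 (pair (emb t) u) d = H * wedge ?i 2 (pair \<tau> s) d" for d
  proof (cases "derivation ?i (d 0) \<and> derivation ?i (d 1)")
    case True
    have dm: "D (mon (t powi i) j) = mon (t powi i) j * (of_int i * D (emb t) / emb t + of_int j * D u / u)"
      if "derivation ?i D" for D i j
    proof -
      interpret D: deriv ?i D using that by unfold_locales
      have et: "emb t \<noteq> 0" using t by simp
      have p: "x powi (n - 1) = x powi n / x" if "x \<noteq> 0" for x :: "'k poly fract" and n
        using that by (simp add: power_int_diff)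
      show ?thesis
        unfolding mon_def emb_powi D.mult D.powi[OF et] D.powi[OF u_nonzero] p[OF et] p[OF u_nonzero]
        by (simp add: distrib_left mult_ac)
    qed
    let ?T = "\<lambda>i. d i (emb t) / emb t" and ?U = "\<lambda>i. d i u / u"
    have e1: "d i \<tau> = \<tau> * (of_int \<alpha> * ?T i + of_int \<beta> * ?U i)" "d i s = s * (of_int e * ?T i + of_int m * ?U i)"
      if "i = 0 \<or> i = 1" for i
      using dm[of "d i"] True that unfolding \<tau>_def s_def by auto
    have aux: "x * (\<alpha> * T + \<beta> * U) * (y * (e * T' + m * U')) - y * (e * T + m * U) * (x * (\<alpha> * T' + \<beta> * U')) =
        x * y * ((m * \<alpha> - e * \<beta>) * (T * U' - U * T'))" for x y \<alpha> \<beta> e m T U T' U' :: "'k poly fract"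
      by (simp add: algebra_simps)
    have "d 0 \<tau> * d 1 s - d 0 s * d 1 \<tau> = \<tau> * s * (of_int (m * \<alpha> - e * \<beta>) * (?T 0 * ?U 1 - ?U 0 * ?T 1))"
      unfolding e1[OF disjI1[OF refl]] e1[OF disjI2[OF refl]] of_int_diff of_int_mult by (rule aux)
    also have "H * \<dots> = emb t * u * (?T 0 * ?U 1 - ?U 0 * ?T 1)" unfolding ab using nz by (simp add: H_def)
    also have "\<dots> = d 0 (emb t) * d 1 u - d 0 u * d 1 (emb t)" using t by (simp add: field_simps)
    finally show ?thesis using True unfolding wedge_2 pair_def by simp
  qed (auto simp: wedge_2)
  have H0: "H \<noteq> 0" using t nz by (simp add: H_def)
  have WH: "G.W H = m - e - 1"
    using t nz W by (simp add: H_def G.P.fract.div G.P.fract.mult G.W_emb G.W_u)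
  obtain D1 where D1: "derivation ?i D1" "\<And>x. D1 (emb x) = emb (D0 x)" "D1 u = 0"
    using coefficient_derivation[OF D0] by metis
  obtain D2 where D2: "derivation ?i D2" "\<And>x. D2 (emb x) = 0" "D2 u = 1" using u_derivation by metis
  have "wedge ?i 2 (pair (emb t) u) (\<lambda>i. if i = 0 then D1 else D2) \<noteq> 0"
    unfolding wedge_2 using D1 D2 D0t by (simp add: pair_def)
  then have nz': "wedge ?i 2 (pair \<tau> s) (\<lambda>i. if i = 0 then D1 else D2) \<noteq> 0" unfolding H by simp
  have eq: "(\<lambda>d. g * wedge ?i 2 (pair (emb t) u) d) = (\<lambda>d. (g * H) * wedge ?i 2 (pair \<tau> s) d)"
    unfolding H by (simp add: mult.assoc)
  have gH: "g * H \<noteq> 0" using g H0 by simp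
  have "ord_form ?i 2 A PV (\<lambda>d. g * wedge ?i 2 (pair (emb t) u) d) =
      ord_form ?i 2 A PV (\<lambda>d. (g * H) * wedge ?i 2 (pair \<tau> s) d)"
    by (rule arg_cong[OF eq])
  also have "\<dots> = G.W (g * H)" 
    by (rule PV.ord_form_eq[where \<eta> = "wedge ?i 2 (pair \<tau> s)" and ?d0.0 = "\<lambda>i. if i = 0 then D1 else D2"])
      (fact gen nz' gH)+
  also have "\<dots> = G.W g + G.W H" by (rule G.P.fract.mult[OF g H0])
  finally show ?thesis unfolding WH by linarith
qed

end

section \<open>Prime divisors dominating the curve\<close>

context dpd begin

text \<open>Vanish to high order wherever D_+ or D_- is nonzero. The construction of
  \<open>h\<close> needs an auxiliary point \<open>a\<close> at which \<open>h\<close> does not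
  vanish, so a power of a uniformizer is added for \<open>a\<close> itself.\<close>

lemma ex_nonzero_piece: "\<exists>h\<in>piece A0 Dp Dm n. h \<in> A0 \<and> h \<noteq> 0"
proof -
  obtain a where a: "a \<in> closed_points A0" using ex_closed_point by blast
  interpret d: dvr A0 a "ord_at A0 a" by (rule dvr_ord[OF a])
  define B where "B = {b. Dp b \<noteq> 0} \<union> {b. Dm b \<noteq> 0} - {a}"
  have B: "finite B" "B \<subseteq> closed_points A0" "a \<notin> B" using Dp Dm by (auto simp: B_def Q_divisor_def)
  define N where "N b = nat \<lceil>\<bar>of_int n * Dp b\<bar> + \<bar>of_int n * Dm b\<bar>\<rceil>" for b
  have N: "\<bar>of_int n * Dp b\<bar> + \<bar>of_int n * Dm b\<bar> \<le> of_int (int (N b))" for b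
  proof -
    define q where "q = \<bar>of_int n * Dp b\<bar> + \<bar>of_int n * Dm b\<bar>"
    have "q \<le> of_int \<lceil>q\<rceil>" by simp
    also have "\<dots> \<le> of_int (int (N b))" unfolding N_def q_def[symmetric] by simp
    finally show ?thesis by (simp add: q_def)
  qed
  obtain h where h: "h \<in> A0" "h \<notin> a" "\<And>b. b \<in> B \<Longrightarrow> int (N b) \<le> ord b h"
    using avoid_and_vanish[OF a B, of N] by blast
  obtain t where t: "t \<in> a" "t \<noteq> 0" "ord a t = 1" by (rule d.uniformizer_in)
  have tA: "t \<in> A0" using t d.P(4) by auto
  have h0: "h \<noteq> 0" using h d.P(5) by auto
  define g where "g = h * t ^ N a"
  have gA: "g \<in> A0" "g \<noteq> 0" using h h0 t tA by (auto simp: g_def)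
  have "0 \<le> of_int (ord b g) + of_int n * Dp b \<and> 0 \<le> of_int (ord b g) - of_int n * Dm b"
    if b: "b \<in> closed_points A0" for b
  proof -
    interpret c: dvr A0 b "ord_at A0 b" by (rule dvr_ord[OF b])
    have og: "ord b g = ord b h + int (N a) * ord b t" using h0 t by (simp add: g_def c.mult c.pow)
    have nn: "0 \<le> ord b h" "0 \<le> ord b t" using c.nonneg h h0 t tA by auto
    have ge: "of_int (int (N b)) \<le> (of_int (ord b g) :: rat)" if "b = a \<or> b \<in> B"
    proof -
      have "int (N b) \<le> ord b g" using that
      proof
        assume "b = a"
        then show ?thesis using og t(3) nn by simp
      next
        assume "b \<in> B"
        then show ?thesis using og h(3) nn by (simp add: add_increasing2)
      qed
      then show ?thesis by (simp only: of_int_le_iff)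
    qed
    show ?thesis
    proof (cases "b = a \<or> b \<in> B")
      case True
      then show ?thesis using ge[OF True] N[of b] by (auto simp: abs_if split: if_splits)
    next
      case False
      then have "Dp b = 0" "Dm b = 0" by (auto simp: B_def)
      moreover have "0 \<le> ord b g" using og nn by simp
      ultimately show ?thesis by simp
    qed
  qed
  then have "g \<in> piece A0 Dp Dm n" unfolding piece_iff by blast
  then show ?thesis using gA by blast
qed

end

text \<open>As P meets A0 in 0 only, nonzero functions on the curve become units. The local ring
  thus contains K and, by \<open>ex_nonzero_piece\<close>, all powers of u.\<close>

locale horizontal = dpd \<iota> A0 S Dp Dm D0 x0 for \<iota> :: "complex \<Rightarrow> 'k::field" and A0 S Dp Dm D0 x0 +
  fixes P :: "'k poly fract set"
  assumes P: "P \<in> prime_divisors A" and proj: "proj A0 P = {0}"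
begin

sublocale H: loc_ring A P
  using P A.field_subring_axioms by (simp add: loc_ring_def loc_ring_axioms_def prime_divisors_def)

sublocale HL: field_subring "localization A P"
  by (rule H.field_subring_localization)

lemma emb_notin: "b \<in> A0 \<Longrightarrow> b \<noteq> 0 \<Longrightarrow> emb b \<notin> P"
  using proj by (auto simp: proj_def)

lemma emb_in_loc: "emb c \<in> localization A P"
proof -
  obtain a b where ab: "a \<in> A0" "b \<in> A0" "b \<noteq> 0" "c = a / b" using frac by blast
  then show ?thesis using H.in_locI[of "emb a" "emb b"] emb_notin by (simp add: emb_divide emb_in_A_iff)
qed

lemma u_powi_in_loc: "u powi n \<in> localization A P"
proof -
  obtain h where h: "h \<in> piece A0 Dp Dm n" "h \<in> A0" "h \<noteq> 0" using ex_nonzero_piece by blast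
  have "mon h n / emb h \<in> localization A P"
    using h emb_notin by (intro H.in_locI mon_in_A) (auto simp: emb_in_A_iff)
  then show ?thesis using h by (simp add: mon_def)
qed

lemma to_fract_in_loc: "to_fract p \<in> localization A P"
  unfolding to_fract_eq_sum mon_def by (intro HL.sum_in HL.mult_in emb_in_loc u_powi_in_loc)

text \<open>The maximal ideal meets the principal ideal domain K[u] in an ideal. By division with
  remainder, a polynomial \<open>p\<close> of least degree in it divides all others, and splitting
  off \<open>p\<close> repeatedly makes every polynomial a unit times a power of
  \<open>p\<close>.\<close>

lemma dvr: "dvr A P (ord_at A P)"
proof -
  let ?L = "localization A P" and ?M = "local_max A P"
  have emb_max: "emb c \<notin> ?M" if "c \<noteq> 0" for c
    using emb_in_loc[of "1 / c"] that by (auto simp: H.local_max_eq emb_divide)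
  have "P \<noteq> {0}" using P by (auto simp: A.prime_divisors_iff)
  then obtain x where x: "x \<in> P" "x \<noteq> 0" using H.P(5) by auto
  then obtain c where c: "finite {n. c n \<noteq> 0}" "x = laurent c" using H.P(4) by (metis A_cases subsetD)
  obtain N Q where Q: "laurent c = u powi (- int N) * to_fract Q" using laurent_poly[OF c(1)] by metis
  have "x / 1 \<in> ?M" unfolding local_max_def using x(1) H.P(2) by blast
  then have "x \<in> ?M" by simp
  then have "u powi int N * x \<in> ?M" by (rule H.local_max_mult[OF u_powi_in_loc])
  moreover have "u powi int N * x = to_fract Q" unfolding c(2) Q by (simp add: power_int_minus)
  moreover have "Q \<noteq> 0" using Q c(2) x(2) by (intro notI) simp
  ultimately have "Q \<noteq> 0 \<and> to_fract Q \<in> ?M" by simp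
  then obtain p where p: "p \<noteq> 0" "to_fract p \<in> ?M"
    and min: "\<And>q. q \<noteq> 0 \<Longrightarrow> to_fract q \<in> ?M \<Longrightarrow> degree p \<le> degree q"
    using ex_has_least_nat[of "\<lambda>q. q \<noteq> 0 \<and> to_fract q \<in> ?M" Q degree] by blast
  have dvd: "p dvd q" if q: "to_fract q \<in> ?M" for q
  proof (rule ccontr)
    assume "\<not> p dvd q"
    then have r: "q mod p \<noteq> 0" by (simp add: mod_eq_0_iff_dvd)
    have "q mod p = q - q div p * p" by (rule minus_div_mult_eq_mod[symmetric])
    also have "\<dots> = q + (- (q div p)) * p" by simp
    finally have "q mod p = q + (- (q div p)) * p" .
    then have "to_fract (q mod p) = to_fract q + to_fract (- (q div p)) * to_fract p"
      by (simp only: to_fract_add to_fract_mult)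
    also have "\<dots> \<in> ?M" by (intro H.local_max_add H.local_max_mult q p to_fract_in_loc)
    finally have "degree p \<le> degree (q mod p)" using min r by blast
    moreover have "degree (q mod p) < degree p" using degree_mod_less[OF p(1), of q] r by blast
    ultimately show False by simp
  qed
  have deg: "degree p > 0"
  proof (rule ccontr)
    assume "\<not> degree p > 0"
    then obtain c where "p = [:c:]" by (metis degree_eq_zeroE neq0_conv)
    then show False using p emb_max[of c] by (auto simp: emb_def)
  qed
  define U where "U = {x. x \<noteq> 0 \<and> x \<in> ?L \<and> 1 / x \<in> ?L}"
  have poly: "\<exists>n g. g \<in> U \<and> to_fract q = g * to_fract p ^ n" if "q \<noteq> 0" for q
    using that
  proof (induction "degree q" arbitrary: q rule: less_induct)
    case less
    show ?case
    proof (cases "to_fract q \<in> ?M")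
      case False
      then have "to_fract q \<in> U" using less.prems to_fract_in_loc[of q] by (simp add: U_def H.local_max_eq)
      then show ?thesis by (intro exI[of _ 0] exI[of _ "to_fract q"]) simp
    next
      case True
      then obtain q' where q': "q = p * q'" using dvd by (metis dvdE)
      then have "q' \<noteq> 0" using less.prems by auto
      then have "degree q' < degree q" unfolding q' using p deg by (simp add: degree_mult_eq)
      then obtain n g where "g \<in> U" "to_fract q' = g * to_fract p ^ n" using less.hyps \<open>q' \<noteq> 0\<close> by blast
      then show ?thesis unfolding q' by (intro exI[of _ "Suc n"] exI[of _ g]) (simp add: mult_ac)
    qed
  qed
  show ?thesis
  proof (rule H.dvr_of_uniformizer[of "to_fract p"])
    show "to_fract p \<in> ?L" "to_fract p \<noteq> 0" using to_fract_in_loc p by auto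
    show "1 / to_fract p \<notin> ?L" using p by (simp add: H.local_max_eq)
    fix f :: "'k poly fract" assume f: "f \<noteq> 0"
    obtain q r where qr: "r \<noteq> 0" "f = to_fract q / to_fract r" by (metis fract_cases)
    then have "q \<noteq> 0" using f by auto
    obtain n g where g: "g \<in> U" "to_fract q = g * to_fract p ^ n" using poly[OF \<open>q \<noteq> 0\<close>] by blast
    obtain k h where h: "h \<in> U" "to_fract r = h * to_fract p ^ k" using poly[OF qr(1)] by blast
    have nz: "g \<noteq> 0" "h \<noteq> 0" using g h unfolding U_def by blast+
    have "f = g * (1 / h) * to_fract p powi (int n - int k)"
      using p nz unfolding qr(2) g(2) h(2) by (simp add: power_int_diff)
    moreover have "g * (1 / h) \<in> ?L" using g h HL.mult_in unfolding U_def by blast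
    moreover have "h * (1 / g) \<in> ?L" using g h HL.mult_in unfolding U_def by blast
    then have "1 / (g * (1 / h)) \<in> ?L" using nz by simp
    ultimately show "\<exists>n. \<exists>g\<in>{x. x \<noteq> 0 \<and> x \<in> ?L \<and> 1 / x \<in> ?L}. f = g * to_fract p powi n"
      using nz by (intro exI[of _ "int n - int k"] bexI[of _ "g * (1 / h)"]) auto
  qed
qed

text \<open>The local ring contains K and the inverse of u, so the differentials of x0 and u
  generate its differentials, and no correction to the order of \<open>g\<close> arises.\<close>

lemma ord_form_horizontal:
  assumes g: "g \<noteq> 0"
  shows "ord_form (emb \<circ> \<iota>) 2 A P (\<lambda>d. g * wedge (emb \<circ> \<iota>) 2 (pair (emb x0) u) d) = ord_at A P g"
proof -
  interpret HD: dvr A P "ord_at A P" by (rule dvr)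
  let ?L = "localization A P" and ?i = "emb \<circ> \<iota>"
  let ?D = "diff_span ?i ?L (emb x0) u"
  have uL: "u \<in> ?L" "inverse u \<in> ?L" using u_powi_in_loc[of 1] u_powi_in_loc[of "- 1"] by (simp_all add: power_int_minus)
  have emb: "emb c \<in> ?D" for c
  proof (rule HL.diff_spanI[of "emb (D0 c / D0 x0)" 0])
    fix d assume d: "derivation ?i d"
    have "emb (D0 c) * d (emb x0) = emb (D0 x0) * d (emb c)" by (rule derivations_proportional_emb[OF D0 d])
    then show "d (emb c) = emb (D0 c / D0 x0) * d (emb x0) + 0 * d u" using x0 by (simp add: emb_divide field_simps)
  qed (auto intro: emb_in_loc)
  have mon: "mon c n \<in> ?D" for c n
    unfolding mon_def
    by (intro HL.diff_span_mult emb HL.diff_span_powi HL.diff_span_gen uL u_nonzero emb_in_loc u_powi_in_loc)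
  have AD: "x \<in> ?D" if x: "x \<in> A" for x
  proof -
    obtain c where c: "finite {n. c n \<noteq> 0}" "\<And>n. c n \<in> piece A0 Dp Dm n" "x = laurent c"
      using A_cases[OF x] by metis
    then show ?thesis unfolding c(3) laurent_def mon_def[symmetric]
      by (intro HL.diff_span_sum mon)
  qed
  have LD: "?L \<subseteq> ?D"
  proof
    fix x assume "x \<in> ?L"
    then obtain p q where pq: "x = p / q" "p \<in> A" "q \<in> A" "q \<notin> P" unfolding localization_def by blast
    have q0: "q \<noteq> 0" using H.notin_nz pq by auto
    have "inverse q \<in> ?L" using H.in_locI[of 1 q] pq by (simp add: inverse_eq_divide)
    then show "x \<in> ?D" unfolding pq(1)
      using HL.diff_span_div[OF AD[OF pq(2)] AD[OF pq(3)] H.loc_incl[OF pq(2)]] q0 by simp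
  qed
  have gen: "forms ?i 2 ?L = {\<lambda>d. x * wedge ?i 2 (pair (emb x0) u) d |x. x \<in> ?L}"
    by (rule HL.forms_2_eq[OF emb_in_loc uL(1) LD])
  obtain D1 where D1: "derivation ?i D1" "\<And>x. D1 (emb x) = emb (D0 x)" "D1 u = 0"
    using coefficient_derivation[OF D0] by metis
  obtain D2 where D2: "derivation ?i D2" "\<And>x. D2 (emb x) = 0" "D2 u = 1" using u_derivation by metis
  have nz: "wedge ?i 2 (pair (emb x0) u) (\<lambda>i. if i = 0 then D1 else D2) \<noteq> 0"
    unfolding wedge_2 using D1 D2 x0 by (simp add: pair_def)
  show ?thesis 
    by (rule HD.ord_form_eq[where \<eta> = "wedge ?i 2 (pair (emb x0) u)" and ?d0.0 = "\<lambda>i. if i = 0 then D1 else D2"])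
      (fact gen nz g)+
qed

end

section \<open>The canonical divisor\<close>

context dpd begin

text \<open>A version of \<open>PV\<close> free of the locale, so that the primes of different
  slopes over a point can be compared.\<close>

definition vprime :: "'k set \<Rightarrow> int \<Rightarrow> int \<Rightarrow> 'k poly fract set" where
  "vprime a m e = {x \<in> A. x = 0 \<or> 0 < fract_val (gauss_val (ord a) m e) x}"

lemma verticalI:
  assumes "a \<in> closed_points A0" "m > 0" "gcd e m = 1"
    "(\<sigma> = 1 \<and> Dp a = - (of_int e / of_int m)) \<or> (\<sigma> = - 1 \<and> Dm a = of_int e / of_int m)"
  shows "vertical \<iota> A0 S Dp Dm D0 x0 a m e \<sigma>"
  using assms by (intro vertical.intro dpd_axioms vertical_axioms.intro)

lemma proj_torus_act:
  assumes "M \<in> closed_points A" "z \<noteq> 0"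
  shows "proj A0 (torus_act \<iota> z M) = proj A0 M"
  using mon_torus_act[OF assms(2) A.primeD(1)[OF A.closed_point_prime[OF assms(1)]], of _ 0]
  by (auto simp: proj_def mon_degree_0)

end

context vertical begin

lemma PV_eq: "PV = vprime a m e"
  by (simp add: PV_def vprime_def)

text \<open>A homogeneous element acquires only a nonzero scalar under the torus, so the one that
  does not vanish somewhere on Z vanishes nowhere on it; this makes every point of Z contain the
  centre. The second conclusion later separates the two components over a point.\<close>

lemma orbit_over_inter:
  assumes Z: "orbit_over \<iota> A0 Dp Dm N a Z" and N: "\<And>n. n \<in> N \<Longrightarrow> 0 < \<sigma> * n"
  shows "\<Inter> Z = vprime a m e" and "\<exists>n\<in>N. \<exists>f\<in>piece A0 Dp Dm n. mon f n \<notin> vprime a m e"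
proof -
  obtain M where M: "M \<in> closed_points A" "Z = {torus_act \<iota> z M |z. z \<noteq> 0}"
    using Z unfolding orbit_over_def torus_orbits_def by blast
  note MD = A.primeD[OF A.closed_point_prime[OF M(1)]]
  obtain n f N' where f: "n \<in> N" "f \<in> piece A0 Dp Dm n" "N' \<in> Z" "mon f n \<notin> N'"
    using Z unfolding orbit_over_def mon_def by blast
  have Zz: "torus_act \<iota> z M \<in> Z" if "z \<noteq> 0" for z using M(2) that by blast
  have MZ: "M \<in> Z" using Zz[of 1] torus_act_1[OF MD(4)] by simp
  have prj: "proj A0 M = a" using MZ Z unfolding orbit_over_def fiber_def by blast
  have nM: "mon f n \<notin> M" using f(3,4) M(2) mon_torus_act[OF _ MD(1)] by blast
  have sub: "PV \<subseteq> N'" if N': "N' \<in> Z" for N'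
  proof -
    obtain z where z: "z \<noteq> 0" "N' = torus_act \<iota> z M" using N' M(2) by blast
    have cl: "N' \<in> closed_points A" unfolding z(2) by (rule torus_act_closed_point[OF M(1) z(1)])
    have "proj A0 N' = a" unfolding z(2) proj_torus_act[OF M(1) z(1)] by (rule prj)
    moreover have "mon f n \<notin> N'" unfolding z(2) using mon_torus_act[OF z(1) MD(1)] nM by blast
    ultimately show ?thesis using PV_subset[OF A.closed_point_prime[OF cl] _ f(2) _ N[OF f(1)]] by blast
  qed
  show "\<Inter> Z = vprime a m e"
    using orbit_inter[OF M(1) prj f(2) nM N[OF f(1)] Zz _ sub] MZ unfolding PV_eq by blast
  have "mon f n \<notin> PV" using sub[OF MZ] nM by blast
  then show "\<exists>n\<in>N. \<exists>f\<in>piece A0 Dp Dm n. mon f n \<notin> vprime a m e" using f unfolding PV_eq by blast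
qed

end

context dpd begin

section \<open>Fibers with equal slopes and rational forms\<close>

lemma finite_points: "finite (a_points A0 Dp Dm)" "finite (b_points A0 Dp Dm)"
proof -
  have f: "finite ({a. Dp a \<noteq> 0} \<union> {a. Dm a \<noteq> 0})" using Dp Dm by (simp add: Q_divisor_def)
  show "finite (a_points A0 Dp Dm)" "finite (b_points A0 Dp Dm)"
    by (rule finite_subset[OF _ f]; auto simp: a_points_def b_points_def)+
qed

text \<open>If the two slopes at a agree, the element \<open>t\<^sup>e u\<^sup>m\<close> is a unit of A near a.\<close>

lemma balanced_witness:
  assumes a: "a \<in> closed_points A0" "m > 0" "gcd e m = 1"
    "Dp a = - (of_int e / of_int m)" "Dm a = of_int e / of_int m"
    and P: "primeideal P (ring_on A)" "proj A0 P = a"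
  shows "\<exists>d\<in>piece A0 Dp Dm m. mon d m \<notin> P"
proof -
  interpret v1: vertical \<iota> A0 S Dp Dm D0 x0 a m e 1 using a by (intro verticalI) auto
  interpret v2: vertical \<iota> A0 S Dp Dm D0 x0 a m e "- 1" using a by (intro verticalI) auto
  note PD = A.primeD[OF P(1)]
  obtain t where t: "t \<noteq> 0" "ord a t = 1" by (rule v1.V.uniformizer)
  have "0 \<le> v1.G.W (mon (t powi e) m)" "0 \<le> v1.G.W (mon (t powi (- e)) (- m))"
    using t by (simp_all add: v1.G.W_mon v1.V.powi)
  then obtain h h' where h: "h \<in> A0" "h \<notin> a" "h * t powi e \<in> piece A0 Dp Dm m"
      "h' \<in> A0" "h' \<notin> a" "h' * t powi (- e) \<in> piece A0 Dp Dm (- m)"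
    using v1.clear_denominator[of "t powi e" m] v2.clear_denominator[of "t powi (- e)" "- m"] t a(2) by auto
  have "mon (h * t powi e) m * mon (h' * t powi (- e)) (- m) = emb (h * h')"
    using t by (simp add: mon_mult mon_degree_0 power_int_minus)
  moreover have "emb (h * h') \<notin> P"
    using h v1.V.prod_notin P(2) by (auto simp: proj_def)
  ultimately have "mon (h * t powi e) m \<notin> P" using PD(8)[OF mon_in_A[OF h(6)]] by metis
  then show ?thesis using h(3) by blast
qed

lemma balanced_subset:
  assumes a: "a \<in> closed_points A0" "m > 0" "gcd e m = 1"
    "Dp a = - (of_int e / of_int m)" "Dm a = of_int e / of_int m"
    and P: "primeideal P (ring_on A)" "proj A0 P = a"
  shows "vprime a m e \<subseteq> P"
proof -
  interpret v1: vertical \<iota> A0 S Dp Dm D0 x0 a m e 1 using a by (intro verticalI) auto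
  show ?thesis using balanced_witness[OF a P] v1.PV_subset[OF P, of _ m] a(2) by (auto simp: v1.PV_eq)
qed

text \<open>A closed point above the centre lies over \<open>a\<close>, as \<open>a\<close> is
  maximal. Every point of the fiber contains the centre, so \<open>orbit_inter\<close> applies with
  the full fiber in place of an orbit.\<close>

lemma balanced_fiber:
  assumes a: "a \<in> closed_points A0" "m > 0" "gcd e m = 1"
    "Dp a = - (of_int e / of_int m)" "Dm a = of_int e / of_int m"
  shows "\<Inter> (fiber A0 A a) = vprime a m e"
proof -
  interpret v1: vertical \<iota> A0 S Dp Dm D0 x0 a m e 1 using a by (intro verticalI) auto
  note PVD = A.primeD[OF v1.PV.prime]
  obtain M where M: "M \<in> closed_points A" "v1.PV \<subseteq> M"
    using A.exists_closed_point[OF PVD(1,2)] by blast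
  note MP = A.closed_point_prime[OF M(1)]
  have "proj A0 v1.PV \<subseteq> proj A0 M" using M(2) by (auto simp: proj_def)
  then have pM: "proj A0 M = a"
    using closed_pointD[OF a(1), of "proj A0 M"] primeD(1,2)[OF prime_proj[OF MP]] v1.proj_PV by auto
  obtain d where d: "d \<in> piece A0 Dp Dm m" "mon d m \<notin> M" using balanced_witness[OF a MP pM] by blast
  have "\<Inter> (fiber A0 A a) = v1.PV"
  proof (rule v1.orbit_inter[OF M(1) pM d])
    show "torus_act \<iota> z M \<in> fiber A0 A a" if "z \<noteq> 0" for z
      using torus_act_closed_point[OF M(1) that] proj_torus_act[OF M(1) that] pM by (simp add: fiber_def)
    show "fiber A0 A a \<noteq> {}" using M(1) pM by (auto simp: fiber_def)
    show "v1.PV \<subseteq> N" if "N \<in> fiber A0 A a" for N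
      using balanced_subset[OF a A.closed_point_prime] that by (auto simp: fiber_def v1.PV_eq)
  qed (use a in auto)
  then show ?thesis by (simp add: v1.PV_eq)
qed

lemma prime_divisor_eqI:
  assumes P: "P \<in> prime_divisors A" and Q: "Q \<in> prime_divisors A" "Q \<subseteq> P"
  shows "P = Q"
  using assms by (auto simp: A.prime_divisors_iff)

text \<open>At \<open>a\<close> the regular 1-forms are generated by dt, and d x0 is D0 x0 / D0 t
  times dt.\<close>

lemma ord_form_curve:
  assumes a: "a \<in> closed_points A0" and t: "t \<noteq> 0" "ord a t = 1" and g: "g \<noteq> 0"
  shows "ord_form \<iota> 1 A0 a (\<lambda>d. g * wedge \<iota> 1 (\<lambda>_. x0) d) = ord a g + ord a (D0 x0) - ord a (D0 t)"
proof -
  interpret V: dvr A0 a "ord_at A0 a" by (rule dvr_ord[OF a])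
  let ?L = "localization A0 a"
  have D0t: "D0 t \<noteq> 0" by (rule derivation_uniformizer(1)[OF D0 x0 a t])
  have proportional: "d x = D0 x / D0 t * d t" if d: "derivation \<iota> d" for d x
    using derivations_proportional[OF D0 d, of x t] D0t by (simp add: field_simps)
  have "?L \<subseteq> diff_span \<iota> ?L t 0"
  proof
    fix x assume x: "x \<in> ?L"
    show "x \<in> diff_span \<iota> ?L t 0"
    proof (rule V.L.diff_spanI[of "D0 x / D0 t" 0])
      show "D0 x / D0 t \<in> ?L" by (rule derivation_uniformizer(2)[OF D0 x0 a t x])
      show "d x = D0 x / D0 t * d t + 0 * d 0" if "derivation \<iota> d" for d using proportional[OF that, of x] by simp
    qed auto
  qed
  moreover have "t \<in> ?L" using t by (simp add: V.loc_iff)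
  ultimately have gen: "forms \<iota> 1 ?L = {\<lambda>d. s * wedge \<iota> 1 (\<lambda>_. t) d |s. s \<in> ?L}"
    by (intro V.L.forms_1_eq)
  have eq: "(\<lambda>d. g * wedge \<iota> 1 (\<lambda>_. x0) d) = (\<lambda>d. (g * (D0 x0 / D0 t)) * wedge \<iota> 1 (\<lambda>_. t) d)"
  proof
    fix d
    show "g * wedge \<iota> 1 (\<lambda>_. x0) d = (g * (D0 x0 / D0 t)) * wedge \<iota> 1 (\<lambda>_. t) d"
      unfolding wedge_1 using proportional[of "d 0" x0] by simp
  qed
  have nz: "wedge \<iota> 1 (\<lambda>_. t) (\<lambda>_. D0) \<noteq> 0" unfolding wedge_1 using D0 D0t by simp
  have g0: "g * (D0 x0 / D0 t) \<noteq> 0" using g x0 D0t by simp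
  have "ord_form \<iota> 1 A0 a (\<lambda>d. g * wedge \<iota> 1 (\<lambda>_. x0) d) =
      ord_form \<iota> 1 A0 a (\<lambda>d. (g * (D0 x0 / D0 t)) * wedge \<iota> 1 (\<lambda>_. t) d)" by (rule arg_cong[OF eq])
  also have "\<dots> = ord a (g * (D0 x0 / D0 t))"
    by (rule V.ord_form_eq[where \<eta> = "wedge \<iota> 1 (\<lambda>_. t)" and ?d0.0 = "\<lambda>_. D0"]) (fact gen nz g0)+
  finally show ?thesis using g x0 D0t by (simp add: V.mult V.div)
qed

lemma emb_diff_span: "emb c \<in> diff_span (emb \<circ> \<iota>) UNIV (emb x0) u"
proof (rule field_subring.diff_spanI[OF field_subring_UNIV, of "emb (D0 c / D0 x0)" 0])
  fix d assume d: "derivation (emb \<circ> \<iota>) d"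
  have "emb (D0 c) * d (emb x0) = emb (D0 x0) * d (emb c)" by (rule derivations_proportional_emb[OF D0 d])
  then show "d (emb c) = emb (D0 c / D0 x0) * d (emb x0) + 0 * d u" using x0 by (simp add: emb_divide field_simps)
qed auto

text \<open>K(u) is generated as a field by K and u, and differentials of elements of K are
  multiples of d x0.\<close>

lemma rational_forms:
  "forms (emb \<circ> \<iota>) 2 UNIV = {\<lambda>d. s * wedge (emb \<circ> \<iota>) 2 (pair (emb x0) u) d |s. True}"
proof -
  interpret U: field_subring "UNIV :: 'k poly fract set" by (rule field_subring_UNIV)
  let ?D = "diff_span (emb \<circ> \<iota>) UNIV (emb x0) (u :: 'k poly fract)"
  have mon: "mon c n \<in> ?D" for c n
    unfolding mon_def by (intro U.diff_span_mult emb_diff_span U.diff_span_powi U.diff_span_gen) auto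
  have poly: "to_fract p \<in> ?D" for p
    unfolding to_fract_eq_sum by (intro U.diff_span_sum mon)
  have "UNIV \<subseteq> ?D"
  proof
    fix x :: "'k poly fract"
    obtain q p where "q \<noteq> 0" "x = to_fract p / to_fract q" by (metis fract_cases)
    then show "x \<in> ?D" using U.diff_span_div[OF poly poly] by auto
  qed
  then show ?thesis using U.forms_2_eq[of "emb x0" u] by simp
qed

lemma wedge_nonzero:
  obtains d where "wedge (emb \<circ> \<iota>) 2 (pair (emb x0) u) d \<noteq> 0"
proof -
  obtain D1 where D1: "derivation (emb \<circ> \<iota>) D1" "\<And>x. D1 (emb x) = emb (D0 x)" "D1 u = 0"
    using coefficient_derivation[OF D0] by metis
  obtain D2 where D2: "derivation (emb \<circ> \<iota>) D2" "\<And>x. D2 (emb x) = 0" "D2 u = 1" using u_derivation by metis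
  have "wedge (emb \<circ> \<iota>) 2 (pair (emb x0) u) (\<lambda>i. if i = 0 then D1 else D2) \<noteq> 0"
    unfolding wedge_2 using D1 D2 x0 by (simp add: pair_def)
  then show ?thesis by (rule that)
qed

end

locale ramified = dpd \<iota> A0 S Dp Dm D0 x0 for \<iota> :: "complex \<Rightarrow> 'k::field" and A0 S Dp Dm D0 x0 +
  fixes e m ep mp em mm :: "'k set \<Rightarrow> int" and Op Om :: "'k set \<Rightarrow> 'k poly fract set set"
    and KC :: "'k set \<Rightarrow> int" and g :: 'k
  assumes a: "\<And>a. a \<in> a_points A0 Dp Dm \<Longrightarrow>
      Dp a = - (of_int (e a) / of_int (m a)) \<and> Dm a = of_int (e a) / of_int (m a) \<and>
      m a > 0 \<and> gcd (e a) (m a) = 1"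
    and bp: "\<And>b. b \<in> b_points A0 Dp Dm \<Longrightarrow>
      Dp b = - (of_int (ep b) / of_int (mp b)) \<and> mp b > 0 \<and> gcd (ep b) (mp b) = 1"
    and bm: "\<And>b. b \<in> b_points A0 Dp Dm \<Longrightarrow>
      Dm b = of_int (em b) / of_int (mm b) \<and> mm b < 0 \<and> gcd (em b) (mm b) = 1"
    and Op: "\<And>b. b \<in> b_points A0 Dp Dm \<Longrightarrow> orbit_over \<iota> A0 Dp Dm {0<..} b (Op b)"
    and Om: "\<And>b. b \<in> b_points A0 Dp Dm \<Longrightarrow> orbit_over \<iota> A0 Dp Dm {..<0} b (Om b)"
    and g: "g \<noteq> 0" and KC: "KC = form_divisor \<iota> 1 A0 (\<lambda>d. g * wedge \<iota> 1 (\<lambda>_. x0) d)"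
begin

section \<open>The ramification divisor and the divisors of 2-forms\<close>

lemma a_pointD: "a \<in> a_points A0 Dp Dm \<Longrightarrow> a \<in> closed_points A0"
  and b_pointD: "b \<in> b_points A0 Dp Dm \<Longrightarrow> b \<in> closed_points A0"
  by (auto simp: a_points_def b_points_def)

lemma vertical_a: "a \<in> a_points A0 Dp Dm \<Longrightarrow> vertical \<iota> A0 S Dp Dm D0 x0 a (m a) (e a) 1"
  using a a_pointD by (intro verticalI) auto

lemma vertical_p: "b \<in> b_points A0 Dp Dm \<Longrightarrow> vertical \<iota> A0 S Dp Dm D0 x0 b (mp b) (ep b) 1"
  using bp b_pointD by (intro verticalI) auto

text \<open>As \<open>mm b\<close> is negative, both integers change sign: this makes the
  multiplicity positive and keeps the fraction.\<close>

lemma vertical_m: "b \<in> b_points A0 Dp Dm \<Longrightarrow> vertical \<iota> A0 S Dp Dm D0 x0 b (- mm b) (- em b) (- 1)"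
  using bm b_pointD by (intro verticalI) auto

lemma inter_a: "a \<in> a_points A0 Dp Dm \<Longrightarrow> \<Inter> (fiber A0 A a) = vprime a (m a) (e a)"
  using a a_pointD by (intro balanced_fiber) auto

lemma inter_p: "b \<in> b_points A0 Dp Dm \<Longrightarrow> \<Inter> (Op b) = vprime b (mp b) (ep b)"
  using vertical.orbit_over_inter(1)[OF vertical_p Op] by auto

lemma inter_m: "b \<in> b_points A0 Dp Dm \<Longrightarrow> \<Inter> (Om b) = vprime b (- mm b) (- em b)"
  using vertical.orbit_over_inter(1)[OF vertical_m Om] by auto

lemma vprime_prime_divisor:
  assumes "vertical \<iota> A0 S Dp Dm D0 x0 a m' e' \<sigma>"
  shows "vprime a m' e' \<in> prime_divisors A" "proj A0 (vprime a m' e') = a"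
proof -
  interpret v: vertical \<iota> A0 S Dp Dm D0 x0 a m' e' \<sigma> by (rule assms)
  show "vprime a m' e' \<in> prime_divisors A" "proj A0 (vprime a m' e') = a"
    using v.PV_prime_divisor v.proj_PV by (simp_all add: v.PV_eq)
qed

text \<open>Take an element of positive degree that does not vanish on the first component. Since
  D_+ + D_- is negative at b, its value for the other slope is positive, so it vanishes on the
  second one.\<close>

lemma distinct_pm:
  assumes b: "b \<in> b_points A0 Dp Dm"
  shows "vprime b (mp b) (ep b) \<noteq> vprime b (- mm b) (- em b)"
proof -
  interpret p: vertical \<iota> A0 S Dp Dm D0 x0 b "mp b" "ep b" 1 by (rule vertical_p[OF b])
  interpret q: vertical \<iota> A0 S Dp Dm D0 x0 b "- mm b" "- em b" "- 1" by (rule vertical_m[OF b])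
  obtain n f where f: "n > 0" "f \<in> piece A0 Dp Dm n" "mon f n \<notin> vprime b (mp b) (ep b)"
    using p.orbit_over_inter(2)[OF Op[OF b]] by auto
  have f0: "f \<noteq> 0" using f(3) p.PV.P(5) by (auto simp: p.PV_eq)
  have "0 \<le> of_int (ord b f) + of_int n * Dp b" using f(2) f0 p.a by (simp add: piece_iff)
  moreover have "of_int n * (Dp b + Dm b) < 0" using b f(1) by (simp add: b_points_def mult_pos_neg)
  ultimately have "0 < of_int (ord b f) - of_int n * Dm b" by (simp add: algebra_simps)
  then have "0 < of_int (- mm b) * (of_int (ord b f) - of_int n * Dm b)" using bm[OF b] by (intro mult_pos_pos) auto
  also have "\<dots> = of_int (- mm b * ord b f - (- em b) * n)" using bm[OF b] by (simp add: field_simps)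
  finally have "0 < - mm b * ord b f - (- em b) * n" by (simp only: of_int_0_less_iff)
  then have "0 < q.G.W (mon f n)" using f0 by (simp add: q.G.W_mon)
  then have "mon f n \<in> vprime b (- mm b) (- em b)" using f(2) by (simp add: vprime_def mon_in_A_iff)
  then show ?thesis using f(3) by auto
qed

definition ram :: "'k poly fract set \<Rightarrow> int" where
  "ram P = (\<Sum>a\<in>a_points A0 Dp Dm. (m a - 1) * curve_divisor (fiber A0 A a) P)
      + (\<Sum>b\<in>b_points A0 Dp Dm. (mp b - 1) * curve_divisor (Op b) P
          + (- mm b - 1) * curve_divisor (Om b) P)"

text \<open>The prime of each component contracts to the point below it, so only the summand for the
  image of P survives.\<close>

lemma ram_eq:
  "ram P = (if proj A0 P \<in> a_points A0 Dp Dm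
      then (m (proj A0 P) - 1) * curve_divisor (fiber A0 A (proj A0 P)) P else 0)
    + (if proj A0 P \<in> b_points A0 Dp Dm then (mp (proj A0 P) - 1) * curve_divisor (Op (proj A0 P)) P
        + (- mm (proj A0 P) - 1) * curve_divisor (Om (proj A0 P)) P else 0)"
proof -
  have 1: "curve_divisor (fiber A0 A a) P = 0" if "a \<in> a_points A0 Dp Dm" "a \<noteq> proj A0 P" for a
    using that inter_a vprime_prime_divisor(2)[OF vertical_a[OF that(1)]] by (auto simp: curve_divisor_def)
  have 2: "curve_divisor (Op b) P = 0" "curve_divisor (Om b) P = 0"
    if "b \<in> b_points A0 Dp Dm" "b \<noteq> proj A0 P" for b
    using that inter_p inter_m vprime_prime_divisor(2)[OF vertical_p[OF that(1)]]
      vprime_prime_divisor(2)[OF vertical_m[OF that(1)]] by (auto simp: curve_divisor_def)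
  have "(\<Sum>a\<in>a_points A0 Dp Dm. (m a - 1) * curve_divisor (fiber A0 A a) P) =
      (\<Sum>a\<in>a_points A0 Dp Dm. if a = proj A0 P then (m a - 1) * curve_divisor (fiber A0 A a) P else 0)"
    using 1 by (intro sum.cong refl) auto
  moreover have "(\<Sum>b\<in>b_points A0 Dp Dm. (mp b - 1) * curve_divisor (Op b) P + (- mm b - 1) * curve_divisor (Om b) P) =
      (\<Sum>b\<in>b_points A0 Dp Dm. if b = proj A0 P
        then (mp b - 1) * curve_divisor (Op b) P + (- mm b - 1) * curve_divisor (Om b) P else 0)"
    using 2 by (intro sum.cong refl) auto
  ultimately show ?thesis unfolding ram_def using finite_points by simp
qed

text \<open>In each case P contains one of the monomial primes, and equality follows since both have
  height one. At an a-point the slopes agree; where both divisors vanish, \<open>m' = 1\<close> and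
  \<open>e' = 0\<close> give no ramification; at a b-point the sign of the degree of a homogeneous
  element outside P selects the component.\<close>

lemma classify:
  assumes P: "P \<in> prime_divisors A" and c: "proj A0 P = c" "c \<in> closed_points A0"
  obtains m' e' \<sigma> where "vertical \<iota> A0 S Dp Dm D0 x0 c m' e' \<sigma>" "P = vprime c m' e'" "ram P = m' - 1"
proof -
  have PP: "primeideal P (ring_on A)" using P by (simp add: prime_divisors_def)
  note PD = A.primeD[OF PP]
  have le: "Dp c + Dm c \<le> 0" by (rule Dp_Dm)
  consider (a) "c \<in> a_points A0 Dp Dm" | (b) "c \<in> b_points A0 Dp Dm" | (z) "Dp c = 0" "Dm c = 0"
    "c \<notin> a_points A0 Dp Dm" "c \<notin> b_points A0 Dp Dm"
  proof -
    have "c \<in> b_points A0 Dp Dm" if "Dp c + Dm c < 0" using c that by (simp add: b_points_def)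
    moreover have "c \<in> a_points A0 Dp Dm" if "Dp c + Dm c = 0" "Dp c \<noteq> 0"
      using c that by (simp add: a_points_def eq_neg_iff_add_eq_0)
    moreover have "c \<notin> b_points A0 Dp Dm" "c \<notin> a_points A0 Dp Dm" if "Dp c = 0" "Dm c = 0"
      using that by (simp_all add: a_points_def b_points_def)
    ultimately show ?thesis using le that by (metis add_0 order_le_less)
  qed
  then show ?thesis
  proof cases
    case a': a
    have nb: "c \<notin> b_points A0 Dp Dm" using a' by (auto simp: a_points_def b_points_def)
    have "vprime c (m c) (e c) \<subseteq> P" using a[OF a'] c PP by (intro balanced_subset) auto
    then have "P = vprime c (m c) (e c)"
      using prime_divisor_eqI[OF P vprime_prime_divisor(1)[OF vertical_a[OF a']]] by blast
    moreover have "ram P = m c - 1"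
      unfolding ram_eq c using calculation a' nb inter_a[OF a'] by (simp add: curve_divisor_def)
    ultimately show ?thesis using that vertical_a[OF a'] by blast
  next
    case z
    have v: "vertical \<iota> A0 S Dp Dm D0 x0 c 1 0 1" using z c by (intro verticalI) auto
    have "vprime c 1 0 \<subseteq> P" using z c PP by (intro balanced_subset) auto
    then have "P = vprime c 1 0" using prime_divisor_eqI[OF P vprime_prime_divisor(1)[OF v]] by blast
    moreover have "ram P = 1 - 1" unfolding ram_eq c using z by simp
    ultimately show ?thesis using that v by blast
  next
    case b
    have na: "c \<notin> a_points A0 Dp Dm" using b by (auto simp: a_points_def b_points_def)
    interpret p: vertical \<iota> A0 S Dp Dm D0 x0 c "mp c" "ep c" 1 by (rule vertical_p[OF b])
    interpret q: vertical \<iota> A0 S Dp Dm D0 x0 c "- mm c" "- em c" "- 1" by (rule vertical_m[OF b])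
    have "vprime c (mp c) (ep c) \<subseteq> P \<or> vprime c (- mm c) (- em c) \<subseteq> P"
    proof (cases "\<exists>k d. k \<noteq> 0 \<and> d \<in> piece A0 Dp Dm k \<and> mon d k \<notin> P")
      case True
      then obtain k d where k: "k \<noteq> 0" "d \<in> piece A0 Dp Dm k" "mon d k \<notin> P" by blast
      show ?thesis
      proof (cases "k > 0")
        case True
        then have "p.PV \<subseteq> P" using p.PV_subset[OF PP c(1) k(2,3)] by simp
        then show ?thesis by (simp add: p.PV_eq)
      next
        case False
        then have "q.PV \<subseteq> P" using q.PV_subset[OF PP c(1) k(2,3)] k(1) by simp
        then show ?thesis by (simp add: q.PV_eq)
      qed
    next
      case False
      \<comment> \<open>Here P contains all homogeneous elements of nonzero degree of A, so only
        degree 0 has to be checked, where both primes contract to the same point.\<close>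
      have "p.PV \<subseteq> P"
      proof
        fix x assume x: "x \<in> p.PV"
        then obtain f where f: "finite {n. f n \<noteq> 0}" "x = laurent f" using p.PV.P(4) by (metis A_cases subsetD)
        have fn: "mon (f n) n \<in> p.PV" for n using x p.PV_iff[OF f(1)] f(2) by blast
        have "mon (f n) n \<in> P" for n
        proof (cases "n = 0")
          case True
          then show ?thesis using p.degree_0_in[OF PP c(1)] fn[of n] by simp
        next
          case nz: False
          have "f n \<in> piece A0 Dp Dm n" using fn[of n] by (simp add: p.mon_in_PV_iff)
          then show ?thesis using False nz by blast
        qed
        then show "x \<in> P" unfolding f(2) laurent_def mon_def[symmetric]
          by (intro A.field_ideal_sum[OF PD(1)]) auto
      qed
      then show ?thesis by (simp add: p.PV_eq)
    qed
    then consider "P = vprime c (mp c) (ep c)" | "P = vprime c (- mm c) (- em c)"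
      using prime_divisor_eqI[OF P vprime_prime_divisor(1)[OF vertical_p[OF b]]]
        prime_divisor_eqI[OF P vprime_prime_divisor(1)[OF vertical_m[OF b]]] by blast
    then show ?thesis
    proof cases
      case 1
      have "ram P = mp c - 1"
        unfolding ram_eq c using 1 b na distinct_pm[OF b] inter_p[OF b] inter_m[OF b] by (simp add: curve_divisor_def)
      then show ?thesis using that vertical_p[OF b] 1 by blast
    next
      case 2
      have "ram P = - mm c - 1"
        unfolding ram_eq c using 2 b na distinct_pm[OF b] inter_p[OF b] inter_m[OF b] by (simp add: curve_divisor_def)
      then show ?thesis using that vertical_m[OF b] 2 by blast
    qed
  qed
qed

text \<open>The divisor of \<open>\<omega> \<and> du/u\<close>, with \<open>\<omega>\<close> the form on the curve that defines \<open>KC\<close>, multiplied by f.\<close>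

lemma form_divisor_eq:
  assumes f: "f \<noteq> 0"
  shows "form_divisor (emb \<circ> \<iota>) 2 A (\<lambda>d. (f * emb g / u) * wedge (emb \<circ> \<iota>) 2 (pair (emb x0) u) d) P =
    pullback A0 A KC P + ram P + principal_divisor A f P"
proof (cases "P \<in> prime_divisors A")
  case False
  have "ram P = 0"
  proof -
    have "curve_divisor (fiber A0 A a) P = 0" if "a \<in> a_points A0 Dp Dm" for a
      using False inter_a[OF that] vprime_prime_divisor(1)[OF vertical_a[OF that]] by (auto simp: curve_divisor_def)
    moreover have "curve_divisor (Op b) P = 0" "curve_divisor (Om b) P = 0" if "b \<in> b_points A0 Dp Dm" for b
      using False inter_p[OF that] vprime_prime_divisor(1)[OF vertical_p[OF that]]
        inter_m[OF that] vprime_prime_divisor(1)[OF vertical_m[OF that]] by (auto simp: curve_divisor_def)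
    ultimately show ?thesis by (simp add: ram_def)
  qed
  then show ?thesis using False by (simp add: form_divisor_def pullback_def principal_divisor_def)
next
  case True
  have PP: "primeideal P (ring_on A)" using True by (simp add: prime_divisors_def)
  have g': "f * emb g / u \<noteq> 0" using f g by simp
  show ?thesis
  proof (cases "proj A0 P = {0}")
    case p0: True
    interpret h: horizontal \<iota> A0 S Dp Dm D0 x0 P using True p0 by unfold_locales
    interpret hd: dvr A P "ord_at A P" by (rule h.dvr)
    have n: "{0} \<notin> closed_points A0" unfolding prime_divisors_eq[symmetric] prime_divisors_iff by simp
    have "pullback A0 A KC P = 0" using n p0 by (simp add: pullback_def prime_divisors_eq)
    moreover have "ram P = 0" using n a_pointD b_pointD p0 by (auto simp: ram_eq)
    moreover have "ord_at A P (emb g) = 0"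
    proof -
      have "emb g \<in> localization A P" "emb (1 / g) \<in> localization A P" by (rule h.emb_in_loc)+
      then show ?thesis using g hd.inv[of "emb g"] by (simp add: hd.loc_iff emb_divide)
    qed
    moreover have "ord_at A P u = 0"
    proof -
      have "u powi 1 \<in> localization A P" "u powi (- 1) \<in> localization A P" by (rule h.u_powi_in_loc)+
      then show ?thesis using hd.inverse[of u] by (simp add: hd.loc_iff power_int_minus)
    qed
    ultimately show ?thesis
      using True h.ord_form_horizontal[OF g'] f g
      by (simp add: form_divisor_def principal_divisor_def hd.mult hd.div)
  next
    case False
    define c where "c = proj A0 P"
    have c: "c \<in> closed_points A0" using nonzero_prime_closed[OF prime_proj[OF PP] False] by (simp add: c_def)
    obtain m' e' \<sigma> where v: "vertical \<iota> A0 S Dp Dm D0 x0 c m' e' \<sigma>" "P = vprime c m' e'" "ram P = m' - 1"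
      using classify[OF True _ c] c_def by metis
    interpret v: vertical \<iota> A0 S Dp Dm D0 x0 c m' e' \<sigma> by (rule v(1))
    have PPV: "P = v.PV" using v(2) by (simp add: v.PV_eq)
    obtain t where t: "t \<noteq> 0" "ord c t = 1" by (rule v.V.uniformizer)
    have D0t: "D0 t \<noteq> 0" by (rule derivation_uniformizer(1)[OF D0 x0 c t])
    have KCc: "KC c = ord c g + ord c (D0 x0) - ord c (D0 t)"
      using ord_form_curve[OF c t g] c by (simp add: KC form_divisor_def prime_divisors_eq)
    \<comment> \<open>A power of the uniformizer is a local equation. Whichever one the choice
      operator picks, its order on the curve is \<open>KC c\<close>, so its value at P is
      \<open>m' * KC c\<close>.\<close>
    have "\<exists>q. q \<noteq> 0 \<and> ord c q = KC c" using t by (intro exI[of _ "t powi KC c"]) (simp add: v.V.powi)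
    then have q: "(SOME q. q \<noteq> 0 \<and> ord c q = KC c) \<noteq> 0 \<and> ord c (SOME q. q \<noteq> 0 \<and> ord c q = KC c) = KC c"
      by (rule someI_ex)
    have pb: "pullback A0 A KC P = m' * KC c"
      using True c q v.PV.ord_at_eq by (simp add: pullback_def prime_divisors_eq c_def[symmetric] PPV[symmetric] v.G.W_emb)
    define G where "G = f * emb g / u * emb (D0 x0 / D0 t)"
    have G0: "G \<noteq> 0" using f g x0 D0t by (simp add: G_def)
    have "wedge (emb \<circ> \<iota>) 2 (pair (emb x0) u) d = emb (D0 x0 / D0 t) * wedge (emb \<circ> \<iota>) 2 (pair (emb t) u) d" for d
    proof (cases "derivation (emb \<circ> \<iota>) (d 0) \<and> derivation (emb \<circ> \<iota>) (d 1)")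
      case True
      have "D (emb x0) = emb (D0 x0 / D0 t) * D (emb t)" if "derivation (emb \<circ> \<iota>) D" for D
        using derivations_proportional_emb[OF D0 that, of x0 t] D0t by (simp add: emb_divide field_simps)
      then have "d 0 (emb x0) = emb (D0 x0 / D0 t) * d 0 (emb t)" "d 1 (emb x0) = emb (D0 x0 / D0 t) * d 1 (emb t)"
        using True by blast+
      then show ?thesis unfolding wedge_2 using True by (simp add: pair_def algebra_simps)
    qed (auto simp: wedge_2)
    then have "ord_form (emb \<circ> \<iota>) 2 A P (\<lambda>d. (f * emb g / u) * wedge (emb \<circ> \<iota>) 2 (pair (emb x0) u) d) =
        ord_form (emb \<circ> \<iota>) 2 A P (\<lambda>d. G * wedge (emb \<circ> \<iota>) 2 (pair (emb t) u) d)"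
      by (simp add: G_def mult.assoc)
    also have "\<dots> = v.G.W G + m' - e' - 1" unfolding PPV by (rule v.ord_form_vertical[OF t G0])
    \<comment> \<open>Dividing by u contributes \<open>e'\<close>, which cancels the
      \<open>- e'\<close> of \<open>ord_form_vertical\<close> and leaves a result of the same shape
      for both slopes.\<close>
    also have "v.G.W G = v.G.W f + m' * KC c + e'"
      using f g x0 D0t by (simp add: G_def v.G.P.fract.mult v.G.P.fract.div v.G.W_emb v.G.W_u emb_divide KCc algebra_simps)
    also have "v.G.W f = ord_at A P f" unfolding PPV using v.PV.ord_at_eq[OF f] by simp
    finally have "ord_form (emb \<circ> \<iota>) 2 A P (\<lambda>d. (f * emb g / u) * wedge (emb \<circ> \<iota>) 2 (pair (emb x0) u) d) =
        ord_at A P f + m' * KC c + e' + m' - e' - 1" .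
    then show ?thesis
      unfolding form_divisor_def principal_divisor_def pb v(3) if_P[OF True] by linarith
  qed
qed

text \<open>The nonzero rational 2-forms are exactly the multiples of one of them by nonzero
  functions f, and f contributes its principal divisor.\<close>

lemma canonical_class_eq:
  "canonical_class (emb \<circ> \<iota>) 2 A = divisor_class A (\<lambda>P. pullback A0 A KC P + ram P)"
proof -
  let ?w = "wedge (emb \<circ> \<iota>) 2 (pair (emb x0) (u :: 'k poly fract))"
  have "\<exists>f. f \<noteq> 0 \<and> form_divisor (emb \<circ> \<iota>) 2 A \<omega> = (\<lambda>P. pullback A0 A KC P + ram P + principal_divisor A f P)"
    if w: "\<omega> \<in> forms (emb \<circ> \<iota>) 2 UNIV" "\<omega> \<noteq> (\<lambda>_. 0)" for \<omega>
  proof -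
    obtain s where s: "\<omega> = (\<lambda>d. s * ?w d)" using w(1) unfolding rational_forms by blast
    then have s0: "s \<noteq> 0" using w(2) by auto
    define f where "f = s * u / emb g"
    have "\<omega> = (\<lambda>d. (f * emb g / u) * ?w d)" using g by (simp add: s f_def)
    moreover have "f \<noteq> 0" using s0 g by (simp add: f_def)
    ultimately show ?thesis using form_divisor_eq by blast
  qed
  moreover have "\<exists>\<omega>. \<omega> \<in> forms (emb \<circ> \<iota>) 2 UNIV \<and> \<omega> \<noteq> (\<lambda>_. 0) \<and>
      (\<lambda>P. pullback A0 A KC P + ram P + principal_divisor A f P) = form_divisor (emb \<circ> \<iota>) 2 A \<omega>"
    if f: "f \<noteq> 0" for f
  proof -
    obtain d where d: "?w d \<noteq> 0" by (rule wedge_nonzero)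
    have "(\<lambda>d. (f * emb g / u) * ?w d) \<noteq> (\<lambda>_. 0)" using fun_cong[of _ "\<lambda>_. 0" d] d f g by fastforce
    moreover have "(\<lambda>d. (f * emb g / u) * ?w d) \<in> forms (emb \<circ> \<iota>) 2 UNIV" unfolding rational_forms by blast
    moreover have "(\<lambda>P. pullback A0 A KC P + ram P + principal_divisor A f P) =
        form_divisor (emb \<circ> \<iota>) 2 A (\<lambda>d. (f * emb g / u) * ?w d)"
      by (rule ext) (rule form_divisor_eq[OF f, symmetric])
    ultimately show ?thesis by blast
  qed
  ultimately show ?thesis unfolding canonical_class_def divisor_class_def by blast
qed

end

lemma curve_of_smooth_affine_curve:
  assumes "smooth_affine_curve \<iota> A0"
  obtains S where "curve \<iota> A0 S"
proof -
  have h: "\<iota> \<in> ring_hom (ring_on UNIV) (ring_on UNIV)" "\<exists>S. finite S \<and> A0 = generate_ring (ring_on UNIV) (range \<iota> \<union> S)"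
    "\<And>x. \<exists>a\<in>A0. \<exists>b\<in>A0. b \<noteq> 0 \<and> x = a / b" "krull_dim A0 = 1" "smooth A0"
    using assms by (auto simp: smooth_affine_curve_def affine_variety_def)
  then obtain S where "finite S" "A0 = generate_ring (ring_on UNIV) (range \<iota> \<union> S)" by blast
  then show ?thesis using h
    by (intro that[of S] curve.intro affine.intro scalars.intro affine_axioms.intro curve_axioms.intro) auto
qed

theorem corollary4p25:
  fixes \<iota> :: "complex \<Rightarrow> 'k::field"
    and A0 :: "'k set"
    and Dp Dm :: "'k set \<Rightarrow> rat"
    and A :: "'k poly fract set"
    and e m ep mp em mm :: "'k set \<Rightarrow> int"
    and Op Om :: "'k set \<Rightarrow> 'k poly fract set set"
    and KC :: "'k set \<Rightarrow> int"
  assumes curve: "smooth_affine_curve \<iota> A0"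
    and Dp: "Q_divisor A0 Dp" and Dm: "Q_divisor A0 Dm"
    and Dp_Dm: "\<And>a. Dp a + Dm a \<le> 0"
    and A: "A = dpd_algebra A0 Dp Dm"
    and a: "\<And>a. a \<in> a_points A0 Dp Dm \<Longrightarrow>
      Dp a = - (of_int (e a) / of_int (m a)) \<and> Dm a = of_int (e a) / of_int (m a) \<and>
      m a > 0 \<and> gcd (e a) (m a) = 1"
    and bp: "\<And>b. b \<in> b_points A0 Dp Dm \<Longrightarrow>
      Dp b = - (of_int (ep b) / of_int (mp b)) \<and> mp b > 0 \<and> gcd (ep b) (mp b) = 1"
    and bm: "\<And>b. b \<in> b_points A0 Dp Dm \<Longrightarrow>
      Dm b = of_int (em b) / of_int (mm b) \<and> mm b < 0 \<and> gcd (em b) (mm b) = 1"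
    and Op: "\<And>b. b \<in> b_points A0 Dp Dm \<Longrightarrow> orbit_over \<iota> A0 Dp Dm {0<..} b (Op b)"
    and Om: "\<And>b. b \<in> b_points A0 Dp Dm \<Longrightarrow> orbit_over \<iota> A0 Dp Dm {..<0} b (Om b)"
    and KC: "KC \<in> canonical_class \<iota> 1 A0"
  shows "canonical_class (emb \<circ> \<iota>) 2 A = divisor_class A (\<lambda>P. pullback A0 A KC P
      + (\<Sum>a\<in>a_points A0 Dp Dm. (m a - 1) * curve_divisor (fiber A0 A a) P)
      + (\<Sum>b\<in>b_points A0 Dp Dm. (mp b - 1) * curve_divisor (Op b) P
          + (- mm b - 1) * curve_divisor (Om b) P))"
proof -
  obtain S where S: "curve \<iota> A0 S" by (rule curve_of_smooth_affine_curve[OF curve])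
  interpret C: curve \<iota> A0 S by (rule S)
  obtain \<omega> where \<omega>: "\<omega> \<in> forms \<iota> 1 UNIV" "\<omega> \<noteq> (\<lambda>_. 0)" "KC = form_divisor \<iota> 1 A0 \<omega>"
    using KC unfolding canonical_class_def by blast
  obtain k :: nat and c x where w: "\<omega> = (\<lambda>d. \<Sum>j<k. c j * wedge \<iota> 1 (x j) d)"
    using \<omega>(1) unfolding forms_def by blast
  \<comment> \<open>A nonzero form takes a nonzero value on some tuple, so one of its summands
    yields a derivation and an element that it does not kill.\<close>
  obtain d where "\<omega> d \<noteq> 0" using \<omega>(2) by auto
  then obtain j where "wedge \<iota> 1 (x j) d \<noteq> 0" unfolding w by (metis (no_types, lifting) mult_zero_right sum.neutral)
  then have D0: "derivation \<iota> (d 0)" "d 0 (x j 0) \<noteq> 0" unfolding wedge_1 by (auto split: if_splits)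
  define D x1 where "D = d 0" and "x1 = x j 0"
  have D: "derivation \<iota> D" "D x1 \<noteq> 0" using D0 by (simp_all add: D_def x1_def)
  interpret U: field_subring "UNIV :: 'k set" by (rule field_subring_UNIV)
  \<comment> \<open>The rational 1-forms are one-dimensional, so the given form is a multiple of d
    x1.\<close>
  have "UNIV \<subseteq> diff_span \<iota> UNIV x1 0"
  proof
    fix y
    show "y \<in> diff_span \<iota> UNIV x1 0"
    proof (rule U.diff_spanI[of "D y / D x1" 0])
      show "E y = D y / D x1 * E x1 + 0 * E 0" if "derivation \<iota> E" for E
        using C.derivations_proportional[OF D(1) that, of y x1] D(2) by (simp add: field_simps)
    qed auto
  qed
  then obtain g where g: "\<omega> = (\<lambda>d. g * wedge \<iota> 1 (\<lambda>_. x1) d)"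
    using \<omega>(1) U.forms_1_eq[of x1 \<iota>] by auto
  then have "g \<noteq> 0" using \<omega>(2) by auto
  interpret ramified \<iota> A0 S Dp Dm D x1 e m ep mp em mm Op Om KC g
  proof (intro ramified.intro dpd.intro dpd_axioms.intro ramified_axioms.intro)
    show "KC = form_divisor \<iota> 1 A0 (\<lambda>d. g * wedge \<iota> 1 (\<lambda>_. x1) d)" using \<omega>(3) g by simp
  qed (fact S Dp Dm Dp_Dm D a bp bm Op Om \<open>g \<noteq> 0\<close>)+
  show ?thesis using canonical_class_eq unfolding ram_def A by (simp add: add.assoc)
qed

end
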